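(* Let $T=(V,E)$ be a rooted tree with $n$ leaves and let $\hat p\in\mathcal{M}_T$ be such that each observed variable $X_i$ is non-degenerate under $\hat p$. Let $\widehat T$ be the $\hat p$-forest. (1) If each of the inner nodes of $T$ has degree at least three in $\widehat T$, then the $\hat p$-fiber is a finite set of points of cardinality $2^{|V|-n}$. (2) If each of the inner nodes of $T$ has degree at least two in $\widehat T$, then the $\hat p$-fiber is diffeomorphic to a disjoint union of polyhedra. In particular, it is a manifold with corners. Its dimension is $2l_2$, where $l_2$ is the number of (inner) nodes of $T$ having degree $2$ in $\widehat T$.
   Context: Trees. A leaf is a node of degree one; other nodes are inner. $T=(V,E)$ has a root $r$ and all edges are directed away from $r$; $\mathrm{pa}(v)$ is the parent of $v$. The leaves are identified with $[n]=\{1,\ldots,n\}$. $E(ij)$ is the set of edges on the path between nodes $i$ and $j$. Model. All variables $Y_v$, $v\in V$, are binary with values in $\{0,1\}$; $X=(X_1,\ldots,X_n)$ is the subvector at the leaves. $\Theta_T=[0,1]^{2|E|+1}$ has free parameters $\theta^{(r)}_1=P(Y_r=1)$ and $\theta^{(v)}_{1|i}=P(Y_v=1\mid Y_u=i)$ for $(u,v)\in E$, $i\in\{0,1\}$ (with $\theta^{(r)}_0=1-\theta^{(r)}_1$, $\theta^{(v)}_{0|i}=1-\theta^{(v)}_{1|i}$). The map $f_T:\Theta_T\to\Delta_{2^n-1}$ into the simplex of probability distributions on $\{0,1\}^n$ is $p_\beta(\theta)=\sum_{\alpha}\prod_{v\in V}\theta^{(v)}_{\alpha_v|\alpha_{\mathrm{pa}(v)}}$,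 the sum being over all $\alpha\in\{0,1\}^V$ whose restriction to the leaves is $\beta$. $\mathcal{M}_T=f_T(\Theta_T)$. Fiber. The $\hat p$-fiber is $\widehat\Theta_T=f_T^{-1}(\hat p)\subseteq\Theta_T$. Equivalently (up to polynomial isomorphism) it is its image $\widehat\Omega_T\subseteq\mathbb{R}^{|V|+|E|}$ under $\theta\mapsto((\bar\mu_v)_{v\in V},(\eta_{u,v})_{(u,v)\in E})$, where $\bar\mu_v=1-2E(Y_v)$ and $\eta_{u,v}=\theta^{(v)}_{1|1}-\theta^{(v)}_{1|0}$. $\hat p$-forest. Let $\hat\lambda_i=E_{\hat p}(X_i)$ and $\hat\mu_{ij}=\mathrm{Cov}_{\hat p}(X_i,X_j)$. It is always assumed that $\hat\lambda_i(1-\hat\lambda_i)\ne0$ for all $i\in[n]$. An edge $e\in E$ is isolated relative to $\hat p$ if $\hat\mu_{ij}=0$ for all distinct $i,j\in[n]$ such that $e\in E(ij)$. $\widehat E\subseteq E$ is the set of isolated edges, and $\widehat T=T\setminus\widehat E$ is the forest with node set $V$ and edge set $E\setminus\widehat E$.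
   Formalization: The dimension is shown to be at most 2l_2, with equality when some point of the fiber has all conditional probabilities strictly in (0,1) on forest edges at degree-2 nodes; the unconditional equality fails, e.g. for the path 1-h-2 with X_1=X_2 a fair coin. *)

theory Defs
  imports "HOL-Probability.Probability"
begin

text \<open>
  The node set is the universe of a finite type \<open>'v\<close>, and a tree is given by its set \<open>E\<close> of
  directed edges \<open>(pa v, v)\<close>.  The set \<open>[n]\<close> is the universe of a finite type \<open>'n\<close>, and the
  identification of \<open>[n]\<close> with the leaves is a bijection \<open>leaf\<close> onto the nodes of degree one.
  The value \<open>1\<close> of a binary variable is \<^term>\<open>True\<close>.
\<close>

section \<open>Rooted trees\<close>

definition rooted_tree :: "('v::finite \<times> 'v) set \<Rightarrow> 'v \<Rightarrow> bool" where
  "rooted_tree E r \<longleftrightarrow>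
     (\<forall>u. (u, r) \<notin> E) \<and> (\<forall>v. v \<noteq> r \<longrightarrow> (\<exists>!u. (u, v) \<in> E)) \<and> (\<forall>v. (r, v) \<in> E\<^sup>*)"

definition pa :: "('v \<times> 'v) set \<Rightarrow> 'v \<Rightarrow> 'v" where
  "pa E v = (THE u. (u, v) \<in> E)"

definition node_degree :: "('v \<times> 'v) set \<Rightarrow> 'v \<Rightarrow> nat" where
  "node_degree E v = card {e \<in> E. v = fst e \<or> v = snd e}"

definition leaf_labelling :: "('v \<times> 'v) set \<Rightarrow> ('n \<Rightarrow> 'v) \<Rightarrow> bool" where
  "leaf_labelling E leaf \<longleftrightarrow> bij_betw leaf UNIV {v. node_degree E v = 1}"

text \<open>Paths ignore the orientation of the edges.\<close>

definition is_path :: "('v \<times> 'v) set \<Rightarrow> 'v \<Rightarrow> 'v list \<Rightarrow> 'v \<Rightarrow> bool" where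
  "is_path E u xs v \<longleftrightarrow>
     xs \<noteq> [] \<and> hd xs = u \<and> last xs = v \<and> distinct xs \<and>
     successively (\<lambda>x y. (x, y) \<in> E \<or> (y, x) \<in> E) xs"

definition path_edges :: "('v \<times> 'v) set \<Rightarrow> 'v \<Rightarrow> 'v \<Rightarrow> ('v \<times> 'v) set" where
  "path_edges E u v =
     {(x, y) \<in> E. \<exists>xs k. is_path E u xs v \<and> Suc k < length xs \<and>
        {xs ! k, xs ! Suc k} = {x, y}}"

section \<open>The model\<close>

text \<open>
  For \<open>v \<noteq> r\<close> the coordinate \<open>(v, i)\<close> of a parameter vector is \<open>P(Y\<^sub>v = 1 | Y\<^bsub>pa v\<^esub> = i)\<close>, and
  the coordinate \<open>(r, False)\<close> is \<open>P(Y\<^sub>r = 1)\<close>.  The coordinate \<open>(r, True)\<close> is not a parameter; it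
  is pinned to \<open>0\<close>, so that \<open>Theta r\<close> is the cube \<open>[0,1]\<close> to the power \<open>2|E| + 1\<close>, sitting in a
  coordinate subspace.
\<close>

type_synonym 'v param = "real ^ ('v \<times> bool)"

definition Theta :: "'v::finite \<Rightarrow> 'v param set" where
  "Theta r = {\<theta>. (\<forall>v i. 0 \<le> \<theta> $ (v, i) \<and> \<theta> $ (v, i) \<le> 1) \<and> \<theta> $ (r, True) = 0}"

definition cond_prob :: "'v::finite param \<Rightarrow> 'v \<Rightarrow> bool \<Rightarrow> bool \<Rightarrow> real" where
  "cond_prob \<theta> v i x = (if x then \<theta> $ (v, i) else 1 - \<theta> $ (v, i))"

definition f_T ::
  "('v::finite \<times> 'v) set \<Rightarrow> 'v \<Rightarrow> ('n::finite \<Rightarrow> 'v) \<Rightarrow> 'v param \<Rightarrow> ('n \<Rightarrow> bool) \<Rightarrow> real" where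
  "f_T E r leaf \<theta> \<beta> =
     (\<Sum>\<alpha> | \<alpha> \<circ> leaf = \<beta>. \<Prod>v\<in>UNIV. cond_prob \<theta> v (if v = r then False else \<alpha> (pa E v)) (\<alpha> v))"

definition tree_model ::
  "('v::finite \<times> 'v) set \<Rightarrow> 'v \<Rightarrow> ('n::finite \<Rightarrow> 'v) \<Rightarrow> ('n \<Rightarrow> bool) pmf set" where
  "tree_model E r leaf = {p. pmf p \<in> f_T E r leaf ` Theta r}"

definition fiber ::
  "('v::finite \<times> 'v) set \<Rightarrow> 'v \<Rightarrow> ('n::finite \<Rightarrow> 'v) \<Rightarrow> ('n \<Rightarrow> bool) pmf \<Rightarrow> 'v param set" where
  "fiber E r leaf p = {\<theta> \<in> Theta r. f_T E r leaf \<theta> = pmf p}"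

section \<open>The forest of a distribution\<close>

definition leaf_mean :: "('n \<Rightarrow> bool) pmf \<Rightarrow> 'n \<Rightarrow> real" where
  "leaf_mean p i = measure_pmf.expectation p (\<lambda>x. of_bool (x i))"

definition leaf_cov :: "('n \<Rightarrow> bool) pmf \<Rightarrow> 'n \<Rightarrow> 'n \<Rightarrow> real" where
  "leaf_cov p i j =
     measure_pmf.expectation p
       (\<lambda>x. (of_bool (x i) - leaf_mean p i) * (of_bool (x j) - leaf_mean p j))"

definition isolated_edges ::
  "('v \<times> 'v) set \<Rightarrow> ('n \<Rightarrow> 'v) \<Rightarrow> ('n \<Rightarrow> bool) pmf \<Rightarrow> ('v \<times> 'v) set" where
  "isolated_edges E leaf p =
     {e \<in> E. \<forall>i j. i \<noteq> j \<and> e \<in> path_edges E (leaf i) (leaf j) \<longrightarrow> leaf_cov p i j = 0}"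

definition forest_edges ::
  "('v \<times> 'v) set \<Rightarrow> ('n \<Rightarrow> 'v) \<Rightarrow> ('n \<Rightarrow> bool) pmf \<Rightarrow> ('v \<times> 'v) set" where
  "forest_edges E leaf p = E - isolated_edges E leaf p"

text \<open>
  The following condition says that the distribution \<open>p\<close> does not force any edge of its forest
  at a degree-two node to carry a conditional probability \<open>0\<close> or \<open>1\<close>; it holds in particular if
  \<open>p\<close> is the image of a parameter vector with all parameters strictly between \<open>0\<close> and \<open>1\<close>.
  Without it the dimension of the fiber can drop: for the path on two leaves and one inner node,
  and \<open>p\<close> uniform on \<open>{(0,0), (1,1)}\<close>, the inner node has degree two in the forest, but the
  inner variable must equal either \<open>X\<^sub>1\<close> or \<open>1 - X\<^sub>1\<close>, so that the fiber consists of two points.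
\<close>

definition nondegenerate_at_degree_two ::
  "('v::finite \<times> 'v) set \<Rightarrow> 'v \<Rightarrow> ('n::finite \<Rightarrow> 'v) \<Rightarrow> ('n \<Rightarrow> bool) pmf \<Rightarrow> bool" where
  "nondegenerate_at_degree_two E r leaf p \<longleftrightarrow>
     (\<exists>\<theta>\<in>fiber E r leaf p. \<forall>(u, v)\<in>forest_edges E leaf p.
        node_degree (forest_edges E leaf p) u = 2 \<or> node_degree (forest_edges E leaf p) v = 2 \<longrightarrow>
        (\<forall>i. 0 < \<theta> $ (v, i) \<and> \<theta> $ (v, i) < 1))"

section \<open>Diffeomorphisms and manifolds with corners in Euclidean space\<close>

text \<open>The following two notions are meant for open sets \<open>U\<close> only.\<close>

primrec times_differentiable_on ::
  "nat \<Rightarrow> 'a::real_normed_vector set \<Rightarrow> ('a \<Rightarrow> 'b::real_normed_vector) \<Rightarrow> bool" where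
  "times_differentiable_on 0 U f \<longleftrightarrow> continuous_on U f"
| "times_differentiable_on (Suc k) U f \<longleftrightarrow>
     (\<forall>x\<in>U. f differentiable (at x)) \<and>
     (\<forall>h. times_differentiable_on k U (\<lambda>x. frechet_derivative f (at x) h))"

definition smooth_on_open ::
  "'a::real_normed_vector set \<Rightarrow> ('a \<Rightarrow> 'b::real_normed_vector) \<Rightarrow> bool" where
  "smooth_on_open U f \<longleftrightarrow> (\<forall>k. times_differentiable_on k U f)"

text \<open>Smoothness on an arbitrary subset means having smooth local extensions.\<close>

definition smooth_map_on :: "'a::euclidean_space set \<Rightarrow> ('a \<Rightarrow> 'b::euclidean_space) \<Rightarrow> bool" where
  "smooth_map_on X f \<longleftrightarrow>
     (\<forall>x\<in>X. \<exists>U g. open U \<and> x \<in> U \<and> smooth_on_open U g \<and> (\<forall>y\<in>U \<inter> X. g y = f y))"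

definition diffeomorphic :: "'a::euclidean_space set \<Rightarrow> 'b::euclidean_space set \<Rightarrow> bool" where
  "diffeomorphic X Y \<longleftrightarrow>
     (\<exists>f g. smooth_map_on X f \<and> smooth_map_on Y g \<and> f ` X = Y \<and> g ` Y = X \<and>
        (\<forall>x\<in>X. g (f x) = x) \<and> (\<forall>y\<in>Y. f (g y) = y))"

text \<open>
  The orthant \<open>[0,\<infinity>)\<close> to the power \<open>card B\<close> is realised in the coordinate subspace spanned by a
  set \<open>B\<close> of standard basis vectors.
\<close>

definition orthant :: "'a::euclidean_space set \<Rightarrow> 'a set" where
  "orthant B = {y. \<forall>b\<in>Basis. if b \<in> B then 0 \<le> y \<bullet> b else y \<bullet> b = 0}"

definition manifold_with_corners :: "nat \<Rightarrow> 'a::euclidean_space set \<Rightarrow> bool" where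
  "manifold_with_corners d X \<longleftrightarrow>
     (\<forall>x\<in>X. \<exists>U B W. open U \<and> x \<in> U \<and> B \<subseteq> Basis \<and> card B = d \<and>
        openin (top_of_set (orthant B :: 'a set)) W \<and> diffeomorphic (X \<inter> U) W)"

text \<open>
  Finiteness of the family makes every member open in the union, so that the union carries the
  topology of a disjoint union; without it every set would qualify, as a union of points.
\<close>

definition disjoint_polyhedra :: "nat \<Rightarrow> 'a::euclidean_space set set \<Rightarrow> bool" where
  "disjoint_polyhedra d \<P> \<longleftrightarrow>
     finite \<P> \<and> disjoint \<P> \<and> (\<forall>P\<in>\<P>. polyhedron P \<and> aff_dim P = int d)"

end

theory Submission
  imports Defs
begin

text \<open>
  Call two nodes equivalent if they lie in the same component of the forest, and pick a leaf
  \<open>\<rho>\<close> in every component. The fiber is described in the coordinates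
  \<open>x(v,s) = P(X\<^sub>\<rho> = 1 | Y\<^sub>v = s)\<close>, where \<open>\<rho>\<close> belongs to the component of \<open>v\<close>. Given \<open>p\<close>,
  \<open>x(v,-)\<close> determines the law of \<open>Y\<^sub>v\<close>, and \<open>x(u,-)\<close>, \<open>x(v,-)\<close> determine the joint law along a
  forest edge \<open>uv\<close>, by rational formulas; isolated edges carry independence. If \<open>u\<close> is nearer to
  \<open>\<rho>\<close> than \<open>v\<close>, the joint law is nonnegative iff both \<open>x(v,s)\<close> lie between \<open>x(u,0)\<close> and \<open>x(u,1)\<close>.

  At a leaf, \<open>x(v,-)\<close> is read off \<open>p\<close>; at a node of degree at least three it is determined by \<open>p\<close> up
  to exchanging the two states. At a node of degree two it is free, because summing out \<open>Y\<^sub>v\<close>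
  cancels \<open>x(v,-)\<close> from the law of the leaves. So, up to the choice of which state of each inner
  node has the larger value, the fiber is the set of nested intervals along chains of degree-two
  nodes with prescribed ends, that is, a product of (possibly degenerate) simplices.
\<close>

section \<open>Smooth maps and manifolds with corners\<close>

text \<open>In the parameters themselves the fiber is cut out by polynomial equations of high
  degree; the conditional means of one fixed leaf make it piecewise linear. If \<open>u\<close> lies
  between \<open>v\<close> and \<open>\<rho>\<close>, then Y_v and X_\<rho> are independent given
  Y_u, so \<open>x(v,s)\<close> is a convex combination of \<open>x(u,0)\<close> and
  \<open>x(u,1)\<close>. Hence each component is oriented towards \<open>\<rho>\<close>, whatever
  the root. That these coordinates lose nothing rests on the identity Var(Y_a) Cov(f,g) = Cov(f,Y_a)
  Cov(Y_a,g) for f and g separated by \<open>a\<close>: from a correlated pair of leaves across each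
  forest edge it yields nonzero covariances throughout a component, so \<open>x(v,0)\<close> and
  \<open>x(v,1)\<close> differ and no denominator vanishes. All pieces are images of one polytope
  under coordinate permutations and share one dimension \<open>d\<close>. Each chain gives two
  simplices, one for the larger and one for the smaller values. A simplex collapses exactly if its
  prescribed ends coincide, and only this can push \<open>d\<close> below twice the number of
  degree-two nodes; one parameter vector with strictly nested intervals rules it out.\<close>

lemma times_differentiable_on_cong:
  assumes "open U" "\<And>x. x \<in> U \<Longrightarrow> f x = g x"
  shows "times_differentiable_on k U f \<longleftrightarrow> times_differentiable_on k U g"
  using assms(2)
proof (induction k arbitrary: f g)
  case 0
  then show ?case using continuous_on_cong[of U U f g] by simp
next
  case (Suc k)
  have d: "(f has_derivative D) (at x) \<longleftrightarrow> (g has_derivative D) (at x)" if "x \<in> U" for x D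
    using that Suc.prems assms(1)
    by (metis has_derivative_transform_within_open)
  have fd: "frechet_derivative f (at x) = frechet_derivative g (at x)" if "x \<in> U" for x
    unfolding frechet_derivative_def using d[OF that] by simp
  have df: "f differentiable (at x) \<longleftrightarrow> g differentiable (at x)" if "x \<in> U" for x
    unfolding differentiable_def using d[OF that] by simp
  have "times_differentiable_on k U (\<lambda>x. frechet_derivative f (at x) h)
      \<longleftrightarrow> times_differentiable_on k U (\<lambda>x. frechet_derivative g (at x) h)" for h
    by (rule Suc.IH) (simp add: fd)
  then show ?case unfolding times_differentiable_on.simps using df by blast
qed

lemma times_differentiable_on_SucD:
  "times_differentiable_on (Suc k) U f \<Longrightarrow> times_differentiable_on k U f"
proof (induction k arbitrary: f)
  case 0
  then show ?case
    by (auto simp: continuous_at_imp_continuous_on differentiable_imp_continuous_within)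
next
  case (Suc k)
  then show ?case using times_differentiable_on.simps(2) by blast
qed

lemma times_differentiable_on_subset:
  "times_differentiable_on k U f \<Longrightarrow> V \<subseteq> U \<Longrightarrow> times_differentiable_on k V f"
  by (induction k arbitrary: f) (auto intro: continuous_on_subset)

lemma times_differentiable_on_const: "times_differentiable_on k U (\<lambda>x. c)"
  by (induction k arbitrary: c) auto

text \<open>The recursion is phrased with \<open>frechet_derivative\<close>; this rule and the next
  let any explicit derivative \<open>D\<close> take its place, so that the closure properties follow
  by induction on \<open>k\<close> from the usual differentiation rules.\<close>

lemma times_differentiable_on_SucI:
  assumes "open U" "\<And>x. x \<in> U \<Longrightarrow> (f has_derivative D x) (at x)"
    and "\<And>h. times_differentiable_on k U (\<lambda>x. D x h)"
  shows "times_differentiable_on (Suc k) U f"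
proof -
  have "times_differentiable_on k U (\<lambda>x. frechet_derivative f (at x) h)" for h
  proof -
    have "times_differentiable_on k U (\<lambda>x. frechet_derivative f (at x) h)
      \<longleftrightarrow> times_differentiable_on k U (\<lambda>x. D x h)"
      by (rule times_differentiable_on_cong[OF assms(1)])
        (simp flip: frechet_derivative_at[OF assms(2)])
    then show ?thesis using assms(3)[of h] by blast
  qed
  then show ?thesis using assms(2) by (auto simp: differentiable_def)
qed

lemma times_differentiable_on_SucE:
  assumes "times_differentiable_on (Suc k) U f"
  obtains D where "\<And>x. x \<in> U \<Longrightarrow> (f has_derivative D x) (at x)"
    and "\<And>h. times_differentiable_on k U (\<lambda>x. D x h)"
  using assms that[of "\<lambda>x. frechet_derivative f (at x)"] frechet_derivative_works by auto

lemma times_differentiable_on_linear: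
  assumes "open U" "bounded_linear f"
  shows "times_differentiable_on k U f"
proof (cases k)
  case 0
  then show ?thesis using assms by (simp add: linear_continuous_on)
next
  case (Suc m)
  show ?thesis unfolding Suc
    by (rule times_differentiable_on_SucI[OF assms(1) bounded_linear_imp_has_derivative[OF assms(2)]])
      (rule times_differentiable_on_const)
qed

lemma times_differentiable_on_linear_comp:
  assumes "open U" "bounded_linear l" "times_differentiable_on k U f"
  shows "times_differentiable_on k U (\<lambda>x. l (f x))"
  using assms(3)
proof (induction k arbitrary: f)
  case 0
  then show ?case using assms(2) by (simp add: bounded_linear.continuous_on)
next
  case (Suc k)
  from times_differentiable_on_SucE[OF Suc.prems] obtain D where
    D: "\<And>x. x \<in> U \<Longrightarrow> (f has_derivative D x) (at x)"
       "\<And>h. times_differentiable_on k U (\<lambda>x. D x h)" by blast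
  show ?case
    by (rule times_differentiable_on_SucI[OF assms(1) bounded_linear.has_derivative[OF assms(2) D(1)]])
      (auto intro: Suc.IH D(2))
qed

lemma times_differentiable_on_add:
  assumes "open U" "times_differentiable_on k U f" "times_differentiable_on k U g"
  shows "times_differentiable_on k U (\<lambda>x. f x + g x)"
  using assms(2,3)
proof (induction k arbitrary: f g)
  case 0
  then show ?case by (simp add: continuous_on_add)
next
  case (Suc k)
  from times_differentiable_on_SucE[OF Suc.prems(1)] obtain D where
    D: "\<And>x. x \<in> U \<Longrightarrow> (f has_derivative D x) (at x)"
       "\<And>h. times_differentiable_on k U (\<lambda>x. D x h)" by blast
  from times_differentiable_on_SucE[OF Suc.prems(2)] obtain D' where
    D': "\<And>x. x \<in> U \<Longrightarrow> (g has_derivative D' x) (at x)"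
       "\<And>h. times_differentiable_on k U (\<lambda>x. D' x h)" by blast
  show ?case
    by (rule times_differentiable_on_SucI[OF assms(1) has_derivative_add[OF D(1) D'(1)]])
      (auto intro: Suc.IH D(2) D'(2))
qed

lemma times_differentiable_on_bilinear:
  assumes "open U" "bounded_bilinear b" "times_differentiable_on k U f" "times_differentiable_on k U g"
  shows "times_differentiable_on k U (\<lambda>x. b (f x) (g x))"
  using assms(3,4)
proof (induction k arbitrary: f g)
  case 0
  then show ?case using assms(2) by (simp add: bounded_bilinear.continuous_on)
next
  case (Suc k)
  from times_differentiable_on_SucE[OF Suc.prems(1)] obtain D where
    D: "\<And>x. x \<in> U \<Longrightarrow> (f has_derivative D x) (at x)"
       "\<And>h. times_differentiable_on k U (\<lambda>x. D x h)" by blast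
  from times_differentiable_on_SucE[OF Suc.prems(2)] obtain D' where
    D': "\<And>x. x \<in> U \<Longrightarrow> (g has_derivative D' x) (at x)"
       "\<And>h. times_differentiable_on k U (\<lambda>x. D' x h)" by blast
  show ?case
    by (rule times_differentiable_on_SucI[OF assms(1) bounded_bilinear.FDERIV[OF assms(2) D(1) D'(1)]])
      (auto intro!: times_differentiable_on_add assms(1) Suc.IH D(2) D'(2)
        intro: times_differentiable_on_SucD Suc.prems)
qed

lemmas times_differentiable_on_mult =
  times_differentiable_on_bilinear[OF _ bounded_bilinear_mult]

lemma times_differentiable_on_sum:
  assumes "open U" "\<And>i. i \<in> I \<Longrightarrow> times_differentiable_on k U (f i)"
  shows "times_differentiable_on k U (\<lambda>x. \<Sum>i\<in>I. f i x)"
proof (cases "finite I")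
  case True
  then show ?thesis using assms(2)
    by (induction I) (auto intro!: times_differentiable_on_const times_differentiable_on_add assms(1))
qed (simp add: times_differentiable_on_const)

lemma times_differentiable_on_inverse:
  fixes f :: "'a::real_normed_vector \<Rightarrow> real"
  assumes "open U" "times_differentiable_on k U f" "\<And>x. x \<in> U \<Longrightarrow> f x \<noteq> 0"
  shows "times_differentiable_on k U (\<lambda>x. inverse (f x))"
  using assms(2)
proof (induction k)
  case 0
  then show ?case using assms by (auto intro: continuous_on_inverse)
next
  case (Suc k)
  from times_differentiable_on_SucE[OF Suc.prems(1)] obtain D where
    D: "\<And>x. x \<in> U \<Longrightarrow> (f has_derivative D x) (at x)"
       "\<And>h. times_differentiable_on k U (\<lambda>x. D x h)" by blast
  have inv: "times_differentiable_on k U (\<lambda>x. inverse (f x))"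
    using Suc times_differentiable_on_SucD by blast
  have "times_differentiable_on k U (\<lambda>x. - (inverse (f x) * D x h * inverse (f x)))" for h
    by (intro times_differentiable_on_linear_comp[where l = uminus] times_differentiable_on_mult assms(1) inv D(2)
        bounded_linear_minus bounded_linear_ident)
  then show ?case
    using times_differentiable_on_SucI[OF assms(1) Deriv.has_derivative_inverse[OF assms(3) D(1)]]
    by blast
qed

text \<open>In the chain rule the direction \<open>D x h\<close> fed to \<open>D' (f x)\<close>
  varies with \<open>x\<close>, while the induction hypothesis speaks of fixed directions. Expanding
  \<open>D x h\<close> in the standard basis turns the derivative into a finite sum of products to
  which the hypothesis applies.\<close>

lemma times_differentiable_on_compose:
  fixes f :: "'a::real_normed_vector \<Rightarrow> 'b::euclidean_space" and g :: "'b \<Rightarrow> 'c::real_normed_vector"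
  assumes "open U" "open V" "f ` U \<subseteq> V"
    and "times_differentiable_on k U f" "times_differentiable_on k V g"
  shows "times_differentiable_on k U (\<lambda>x. g (f x))"
proof -
  have "times_differentiable_on k U f \<longrightarrow>
    (\<forall>g :: 'b \<Rightarrow> 'c. times_differentiable_on k V g \<longrightarrow> times_differentiable_on k U (g \<circ> f))"
  proof (induction k)
    case 0
    then show ?case using assms(3) by (auto simp: o_def intro: continuous_on_compose2[of V])
  next
    case (Suc k)
    show ?case
    proof (intro impI allI)
      fix g :: "'b \<Rightarrow> 'c"
      assume prems: "times_differentiable_on (Suc k) U f" "times_differentiable_on (Suc k) V g"
      from times_differentiable_on_SucE[OF prems(1)] obtain D where
        D: "\<And>x. x \<in> U \<Longrightarrow> (f has_derivative D x) (at x)"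
           "\<And>h. times_differentiable_on k U (\<lambda>x. D x h)" by blast
      from times_differentiable_on_SucE[OF prems(2)] obtain D' where
        D': "\<And>x. x \<in> V \<Longrightarrow> (g has_derivative D' x) (at x)"
           "\<And>h. times_differentiable_on k V (\<lambda>x. D' x h)" by blast
      have f: "times_differentiable_on k U f" using prems(1) times_differentiable_on_SucD by blast
      have *: "(g \<circ> f) differentiable at x" "frechet_derivative (g \<circ> f) (at x) h =
         (\<Sum>b\<in>Basis. (D x h \<bullet> b) *\<^sub>R D' (f x) b)" if x: "x \<in> U" for x h
      proof -
        have fx: "f x \<in> V" using x assms(3) by auto
        have gd: "((g \<circ> f) has_derivative (\<lambda>h. D' (f x) (D x h))) (at x)"
          using diff_chain_at[OF D(1)[OF x] D'(1)[OF fx]] by (simp add: o_def)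
        have lin: "linear (D' (f x))" using D'(1)[OF fx] has_derivative_linear by blast
        have "D' (f x) (\<Sum>b\<in>Basis. (D x h \<bullet> b) *\<^sub>R b) = (\<Sum>b\<in>Basis. (D x h \<bullet> b) *\<^sub>R D' (f x) b)"
          by (simp only: linear_sum[OF lin] linear_cmul[OF lin])
        then have "D' (f x) (D x h) = (\<Sum>b\<in>Basis. (D x h \<bullet> b) *\<^sub>R D' (f x) b)"
          by (simp only: euclidean_representation)
        then show "frechet_derivative (g \<circ> f) (at x) h =
         (\<Sum>b\<in>Basis. (D x h \<bullet> b) *\<^sub>R D' (f x) b)"
          unfolding frechet_derivative_at[OF gd, symmetric] by simp
        show "(g \<circ> f) differentiable at x" using gd differentiable_def by blast
      qed
      have "times_differentiable_on k U (\<lambda>x. D x h \<bullet> b)" for h b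
        by (rule times_differentiable_on_linear_comp[OF assms(1) bounded_linear_inner_left D(2)])
      moreover have "times_differentiable_on k U (\<lambda>x. D' (f x) b)" for b
        using Suc.IH[rule_format, OF f D'(2)[of b]] by (simp only: o_def)
      ultimately have sm: "times_differentiable_on k U (\<lambda>x. \<Sum>b\<in>Basis. (D x h \<bullet> b) *\<^sub>R D' (f x) b)" for h
        by (intro times_differentiable_on_sum[OF assms(1)]
            times_differentiable_on_bilinear[OF assms(1) bounded_bilinear_scaleR])
      have "times_differentiable_on k U (\<lambda>x. frechet_derivative (g \<circ> f) (at x) h) \<longleftrightarrow>
         times_differentiable_on k U (\<lambda>x. \<Sum>b\<in>Basis. (D x h \<bullet> b) *\<^sub>R D' (f x) b)" for h
        by (rule times_differentiable_on_cong[OF assms(1)]) (rule *(2))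
      then have "times_differentiable_on k U (\<lambda>x. frechet_derivative (g \<circ> f) (at x) h)" for h
        using sm[of h] by blast
      then show "times_differentiable_on (Suc k) U (g \<circ> f)"
            unfolding times_differentiable_on.simps by (intro conjI ballI allI *(1))
    qed
  qed
  from this[rule_format, OF assms(4,5)] show ?thesis by (simp only: o_def)
qed

section \<open>Calculus of smooth functions on open sets\<close>

named_theorems smooth_intros

lemma smooth_on_open_const [smooth_intros]: "smooth_on_open U (\<lambda>x. c)"
  by (simp add: smooth_on_open_def times_differentiable_on_const)

lemma smooth_on_open_linear: "open U \<Longrightarrow> bounded_linear f \<Longrightarrow> smooth_on_open U f"
  by (simp add: smooth_on_open_def times_differentiable_on_linear)

lemma smooth_on_open_nth [smooth_intros]:
  "open U \<Longrightarrow> smooth_on_open U (\<lambda>x::real^'n. x $ i)"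
  by (rule smooth_on_open_linear) (simp_all add: bounded_linear_vec_nth)

lemma smooth_on_open_add [smooth_intros]:
  "open U \<Longrightarrow> smooth_on_open U f \<Longrightarrow> smooth_on_open U g \<Longrightarrow> smooth_on_open U (\<lambda>x. f x + g x)"
  by (simp add: smooth_on_open_def times_differentiable_on_add)

lemma smooth_on_open_mult [smooth_intros]:
  fixes f g :: "'a::real_normed_vector \<Rightarrow> real"
  shows "open U \<Longrightarrow> smooth_on_open U f \<Longrightarrow> smooth_on_open U g \<Longrightarrow> smooth_on_open U (\<lambda>x. f x * g x)"
  by (simp add: smooth_on_open_def times_differentiable_on_mult)

lemma smooth_on_open_minus [smooth_intros]:
  "open U \<Longrightarrow> smooth_on_open U f \<Longrightarrow> smooth_on_open U (\<lambda>x. - f x)"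
  by (simp add: smooth_on_open_def times_differentiable_on_linear_comp[where l = uminus]
      bounded_linear_minus)

lemma smooth_on_open_diff [smooth_intros]:
  "open U \<Longrightarrow> smooth_on_open U f \<Longrightarrow> smooth_on_open U g \<Longrightarrow> smooth_on_open U (\<lambda>x. f x - g x)"
  using smooth_on_open_add[of U f "\<lambda>x. - g x"] smooth_on_open_minus[of U g] by simp

lemma smooth_on_open_divide [smooth_intros]:
  fixes f g :: "'a::real_normed_vector \<Rightarrow> real"
  shows "open U \<Longrightarrow> smooth_on_open U f \<Longrightarrow> smooth_on_open U g \<Longrightarrow> (\<And>x. x \<in> U \<Longrightarrow> g x \<noteq> 0) \<Longrightarrow>
    smooth_on_open U (\<lambda>x. f x / g x)"
  unfolding divide_inverse
  by (simp add: smooth_on_open_def times_differentiable_on_mult times_differentiable_on_inverse)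

lemma smooth_on_open_sum [smooth_intros]:
  "open U \<Longrightarrow> (\<And>i. i \<in> I \<Longrightarrow> smooth_on_open U (f i)) \<Longrightarrow> smooth_on_open U (\<lambda>x. \<Sum>i\<in>I. f i x)"
  by (simp add: smooth_on_open_def times_differentiable_on_sum)

lemma smooth_on_open_prod [smooth_intros]:
  fixes f :: "'i \<Rightarrow> 'a::real_normed_vector \<Rightarrow> real"
  assumes "open U" "\<And>i. i \<in> I \<Longrightarrow> smooth_on_open U (f i)"
  shows "smooth_on_open U (\<lambda>x. \<Prod>i\<in>I. f i x)"
proof (cases "finite I")
  case True
  then show ?thesis using assms(2)
    by (induction I) (auto intro!: smooth_on_open_const smooth_on_open_mult assms(1))
qed (simp add: smooth_on_open_const)

lemma smooth_on_open_vec: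
  fixes f :: "'i::finite \<Rightarrow> 'a::real_normed_vector \<Rightarrow> real"
  assumes "open U" "\<And>i. smooth_on_open U (f i)"
  shows "smooth_on_open U (\<lambda>x. \<chi> i. f i x)"
proof -
  have "(\<chi> i. f i x) = (\<Sum>i\<in>UNIV. f i x *\<^sub>R axis i 1)" for x
    by (simp add: vec_eq_iff axis_def if_distrib cong: if_cong)
  moreover have "smooth_on_open U (\<lambda>x. f i x *\<^sub>R axis i (1::real))" for i
    using assms times_differentiable_on_bilinear[OF _ bounded_bilinear_scaleR]
      times_differentiable_on_const unfolding smooth_on_open_def by blast
  ultimately show ?thesis by (simp add: smooth_on_open_sum assms(1))
qed

lemma smooth_on_open_compose:
  fixes f :: "'a::real_normed_vector \<Rightarrow> 'b::euclidean_space"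
  assumes "open U" "open V" "f ` U \<subseteq> V" "smooth_on_open U f" "smooth_on_open V g"
  shows "smooth_on_open U (\<lambda>x. g (f x))"
  using assms times_differentiable_on_compose unfolding smooth_on_open_def by blast

lemma smooth_on_open_subset: "smooth_on_open U f \<Longrightarrow> V \<subseteq> U \<Longrightarrow> smooth_on_open V f"
  using times_differentiable_on_subset unfolding smooth_on_open_def by blast

lemma smooth_on_open_imp_continuous_on: "smooth_on_open U f \<Longrightarrow> continuous_on U f"
  unfolding smooth_on_open_def by (metis times_differentiable_on.simps(1))

section \<open>Smooth maps on arbitrary subsets, and diffeomorphisms\<close>

lemma smooth_map_onI:
  "open U \<Longrightarrow> X \<subseteq> U \<Longrightarrow> smooth_on_open U f \<Longrightarrow> smooth_map_on X f"
  unfolding smooth_map_on_def by blast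

lemma smooth_map_onE:
  assumes "smooth_map_on X f" "x \<in> X"
  obtains U g where "open U" "x \<in> U" "smooth_on_open U g" "\<And>y. y \<in> U \<Longrightarrow> y \<in> X \<Longrightarrow> g y = f y"
proof -
  have "\<exists>U g. open U \<and> x \<in> U \<and> smooth_on_open U g \<and> (\<forall>y\<in>U \<inter> X. g y = f y)"
    using assms(1) unfolding smooth_map_on_def by (rule bspec) (rule assms(2))
  then obtain U g where "open U" "x \<in> U" "smooth_on_open U g" "\<forall>y\<in>U \<inter> X. g y = f y"
    by (elim exE conjE)
  then show ?thesis using that[of U g] by simp
qed

lemma smooth_map_on_subset:
  assumes "smooth_map_on X f" "Z \<subseteq> X"
  shows "smooth_map_on Z f"
  unfolding smooth_map_on_def
proof
  fix x assume "x \<in> Z"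
  then have "x \<in> X" using assms(2) by auto
  then obtain U g where "open U" "x \<in> U" "smooth_on_open U g" "\<And>y. y \<in> U \<Longrightarrow> y \<in> X \<Longrightarrow> g y = f y"
    using smooth_map_onE[OF assms(1)] by metis
  then show "\<exists>U g. open U \<and> x \<in> U \<and> smooth_on_open U g \<and> (\<forall>y\<in>U \<inter> Z. g y = f y)"
    using assms(2) by (intro exI[of _ U] exI[of _ g]) auto
qed

lemma smooth_map_on_imp_continuous_on:
  assumes "smooth_map_on X f"
  shows "continuous_on X f"
  unfolding continuous_on_eq_continuous_within
proof
  fix x assume x: "x \<in> X"
  then obtain U g where U: "open U" "x \<in> U" "smooth_on_open U g"
    "\<And>y. y \<in> U \<Longrightarrow> y \<in> X \<Longrightarrow> g y = f y"
    using smooth_map_onE[OF assms] by metis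
  have "continuous (at x) g"
    using smooth_on_open_imp_continuous_on[OF U(3)] U(1,2) by (simp add: continuous_on_eq_continuous_at)
  then have "continuous (at x within X) g" by (rule continuous_at_imp_continuous_at_within)
  then have "(g \<longlongrightarrow> g x) (at x within X)" by (simp only: continuous_within)
  moreover have "eventually (\<lambda>y. g y = f y) (at x within X)"
    unfolding eventually_at_topological using U(1,2,4) by (intro exI[of _ U]) auto
  moreover have "g x = f x" using U(2,4) x by auto
  ultimately show "continuous (at x within X) f"
    unfolding continuous_within by (simp add: tendsto_cong)
qed

lemma smooth_map_on_compose:
  assumes f: "smooth_map_on X f" and g: "smooth_map_on Y g" and fX: "f ` X \<subseteq> Y"
  shows "smooth_map_on X (\<lambda>x. g (f x))"
  unfolding smooth_map_on_def
proof
  fix x assume x: "x \<in> X"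
  then obtain U f' where U: "open U" "x \<in> U" "smooth_on_open U f'"
    "\<And>y. y \<in> U \<Longrightarrow> y \<in> X \<Longrightarrow> f' y = f y"
    using smooth_map_onE[OF f] by metis
  have "f x \<in> Y" using x fX by auto
  then obtain V g' where V: "open V" "f x \<in> V" "smooth_on_open V g'"
    "\<And>y. y \<in> V \<Longrightarrow> y \<in> Y \<Longrightarrow> g' y = g y"
    using smooth_map_onE[OF g] by metis
  let ?W = "U \<inter> f' -` V"
  have W: "open ?W" using smooth_on_open_imp_continuous_on[OF U(3)] U(1) V(1)
    by (simp add: continuous_on_open_vimage Int_commute)
  have "smooth_on_open ?W (\<lambda>x. g' (f' x))"
    by (rule smooth_on_open_compose[OF W V(1) _ _ V(3)])
      (auto intro: smooth_on_open_subset[OF U(3)])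
  then show "\<exists>U g'. open U \<and> x \<in> U \<and> smooth_on_open U g' \<and> (\<forall>y\<in>U \<inter> X. g' y = g (f y))"
  proof (intro exI conjI ballI)
    show "x \<in> ?W" using U(2,4) V(2) x by auto
    fix y assume "y \<in> ?W \<inter> X"
    then have "f' y = f y" "f' y \<in> V" "f y \<in> Y" using U(4) fX by auto
    then show "g' (f' y) = g (f y)" using V(4) by auto
  qed (use W in auto)
qed

lemma diffeomorphicI:
  assumes "smooth_map_on X f" "smooth_map_on Y g"
    and "\<And>x. x \<in> X \<Longrightarrow> f x \<in> Y" "\<And>y. y \<in> Y \<Longrightarrow> g y \<in> X"
    and "\<And>x. x \<in> X \<Longrightarrow> g (f x) = x" "\<And>y. y \<in> Y \<Longrightarrow> f (g y) = y"
  shows "diffeomorphic X Y"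
proof -
  have "f ` X = Y" "g ` Y = X" using assms(3-6) by force+
  then show ?thesis unfolding diffeomorphic_def using assms(1,2,5,6) by blast
qed

lemma diffeomorphic_trans:
  assumes "diffeomorphic X Y" "diffeomorphic Y Z"
  shows "diffeomorphic X Z"
proof -
  from assms(1) obtain f g where fg: "smooth_map_on X f" "smooth_map_on Y g" "f ` X = Y" "g ` Y = X"
    "\<forall>x\<in>X. g (f x) = x" "\<forall>y\<in>Y. f (g y) = y" unfolding diffeomorphic_def by blast
  from assms(2) obtain f' g' where fg': "smooth_map_on Y f'" "smooth_map_on Z g'" "f' ` Y = Z"
    "g' ` Z = Y" "\<forall>x\<in>Y. g' (f' x) = x" "\<forall>y\<in>Z. f' (g' y) = y" unfolding diffeomorphic_def by blast
  have im: "f x \<in> Y" if "x \<in> X" for x using fg(3) that by blast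
  have im': "g' z \<in> Y" if "z \<in> Z" for z using fg'(4) that by blast
  show ?thesis
  proof (rule diffeomorphicI)
    show "smooth_map_on X (\<lambda>x. f' (f x))" using fg(3) by (intro smooth_map_on_compose[OF fg(1) fg'(1)]) simp
    show "smooth_map_on Z (\<lambda>x. g (g' x))" using fg'(4) by (intro smooth_map_on_compose[OF fg'(2) fg(2)]) simp
  qed (use im im' fg fg' in blast, use im im' fg fg' in blast, simp_all add: im im' fg(5,6) fg'(5,6))
qed


text \<open>Continuity of \<open>f\<close> makes the preimage of \<open>V\<close> relatively open,
  hence the trace of an ambient open set. This serves to shrink charts.\<close>

lemma diffeomorphic_open_subset:
  assumes fg: "smooth_map_on X f" "smooth_map_on Y g" "f ` X = Y" "g ` Y = X"
    "\<forall>x\<in>X. g (f x) = x" "\<forall>y\<in>Y. f (g y) = y" and "open V"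
  shows "\<exists>U. open U \<and> X \<inter> U = X \<inter> f -` V \<and> diffeomorphic (X \<inter> U) (Y \<inter> V)"
proof -
  have "openin (top_of_set X) (X \<inter> f -` V)"
    using smooth_map_on_imp_continuous_on[OF fg(1)] assms(7) by (rule continuous_openin_preimage_gen)
  then obtain U where U: "open U" "X \<inter> f -` V = X \<inter> U" unfolding openin_open by blast
  have "diffeomorphic (X \<inter> U) (Y \<inter> V)"
    by (rule diffeomorphicI[of _ f _ g])
      (use U(2) fg in \<open>auto intro: smooth_map_on_subset\<close>)
  then show ?thesis using U by blast
qed

section \<open>Transporting and gluing charts with corners\<close>

lemma manifold_with_corners_diffeomorphic:
  fixes X Y :: "'a::euclidean_space set"
  assumes "diffeomorphic X Y" "manifold_with_corners d Y"
  shows "manifold_with_corners d X"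
  unfolding manifold_with_corners_def
proof
  fix x assume x: "x \<in> X"
  from assms(1) obtain f g where fg: "smooth_map_on X f" "smooth_map_on Y g" "f ` X = Y" "g ` Y = X"
    "\<forall>x\<in>X. g (f x) = x" "\<forall>y\<in>Y. f (g y) = y" unfolding diffeomorphic_def by blast
  from x fg(3) have "f x \<in> Y" by blast
  with assms(2) obtain V B and W :: "'a set" where V: "open V" "f x \<in> V" "B \<subseteq> Basis" "card B = d"
    "openin (top_of_set (orthant B)) W" "diffeomorphic (Y \<inter> V) W"
    unfolding manifold_with_corners_def by blast
  from diffeomorphic_open_subset[OF fg V(1)] obtain U where
    U: "open U" "X \<inter> U = X \<inter> f -` V" "diffeomorphic (X \<inter> U) (Y \<inter> V)" by blast
  have "x \<in> U" using U(2) x V(2) by blast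
  then show "\<exists>U B W. open U \<and> x \<in> U \<and> B \<subseteq> Basis \<and> card B = d \<and>
        openin (top_of_set (orthant B :: 'a set)) W \<and> diffeomorphic (X \<inter> U) W"
    using U(1) V(3-5) diffeomorphic_trans[OF U(3) V(6)] by blast
qed

lemma diffeomorphic_sym: "diffeomorphic X Y \<Longrightarrow> diffeomorphic Y X"
  unfolding diffeomorphic_def by blast

text \<open>The other members form a finite family of closed sets, so around a point of
  \<open>P\<close> there is an open set on which the union coincides with \<open>P\<close>; a chart
  of \<open>P\<close> is shrunk to it.\<close>

lemma manifold_with_corners_Union:
  fixes \<P> :: "'a::euclidean_space set set"
  assumes "finite \<P>" "disjoint \<P>" "\<And>P. P \<in> \<P> \<Longrightarrow> closed P"
    and "\<And>P. P \<in> \<P> \<Longrightarrow> manifold_with_corners d P"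
  shows "manifold_with_corners d (\<Union>\<P>)"
  unfolding manifold_with_corners_def
proof
  fix x assume "x \<in> \<Union>\<P>"
  then obtain P where P: "P \<in> \<P>" "x \<in> P" by blast
  let ?O = "- \<Union>(\<P> - {P})"
  have O: "open ?O" using assms(1,3) by (auto intro!: closed_Union)
  have xO: "x \<in> ?O" using P assms(2) unfolding disjoint_def by blast
  obtain U B and W :: "'a set" where U: "open U" "x \<in> U" "B \<subseteq> Basis" "card B = d"
    "openin (top_of_set (orthant B)) W" "diffeomorphic (P \<inter> U) W"
    using assms(4)[OF P(1)] P(2) unfolding manifold_with_corners_def by blast
  \<comment> \<open>The chart is inverted because \<open>diffeomorphic_open_subset\<close> shrinks
    on the target side, whereas the open set to be imposed lies around \<open>x\<close>.\<close>
  from diffeomorphic_sym[OF U(6)] obtain g f where fg: "smooth_map_on W g" "smooth_map_on (P \<inter> U) f"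
    "g ` W = P \<inter> U" "f ` (P \<inter> U) = W" "\<forall>x\<in>W. f (g x) = x" "\<forall>y\<in>P \<inter> U. g (f y) = y"
    unfolding diffeomorphic_def by blast
  from diffeomorphic_open_subset[OF fg O] obtain V where
    V: "open V" "diffeomorphic (W \<inter> V) ((P \<inter> U) \<inter> ?O)" by blast
  have "openin (top_of_set (orthant B)) (W \<inter> V)"
    using U(5) V(1) unfolding openin_open by (metis Int_assoc open_Int)
  moreover have "(P \<inter> U) \<inter> ?O = \<Union>\<P> \<inter> (U \<inter> ?O)" using P by blast
  then have "diffeomorphic (\<Union>\<P> \<inter> (U \<inter> ?O)) (W \<inter> V)"
    using diffeomorphic_sym[OF V(2)] by (simp only:)
  moreover have "open (U \<inter> ?O)" "x \<in> U \<inter> ?O" using U(1,2) O xO by (simp_all only: open_Int IntI)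
  ultimately show "\<exists>U B W. open U \<and> x \<in> U \<and> B \<subseteq> Basis \<and> card B = d \<and>
        openin (top_of_set (orthant B :: 'a set)) W \<and> diffeomorphic (\<Union>\<P> \<inter> U) W"
    using U(3,4) by blast
qed

lemma diffeomorphic_linear_image:
  fixes f :: "'a::euclidean_space \<Rightarrow> 'b::euclidean_space"
  assumes "linear f" "linear g" "\<And>x. g (f x) = x"
  shows "diffeomorphic X (f ` X)"
  by (rule diffeomorphicI[of _ f _ g])
    (use assms in \<open>auto intro!: smooth_map_onI[of UNIV] smooth_on_open_linear
        linear_conv_bounded_linear[THEN iffD1] simp: image_image\<close>)

section \<open>Polyhedra given by chains of inequalities\<close>

text \<open>Coordinates outside \<open>J\<close> are prescribed by \<open>c\<close>. They include
  the ends of the chains, since \<open>dn j\<close> and \<open>up j\<close> may leave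
  \<open>J\<close>.\<close>

definition chain_polytope ::
  "'i::finite set \<Rightarrow> ('i \<Rightarrow> 'i) \<Rightarrow> ('i \<Rightarrow> 'i) \<Rightarrow> real ^ 'i \<Rightarrow> (real ^ 'i) set" where
  "chain_polytope J dn up c =
     {x. (\<forall>i. i \<notin> J \<longrightarrow> x $ i = c $ i) \<and> (\<forall>j\<in>J. x $ dn j \<le> x $ j \<and> x $ j \<le> x $ up j)}"

lemma polyhedron_chain_polytope: "polyhedron (chain_polytope J dn up c)"
proof -
  have "chain_polytope J dn up c = (\<Inter>i\<in>-J. {x. axis i 1 \<bullet> x = c $ i}) \<inter>
     ((\<Inter>j\<in>J. {x. (axis (dn j) 1 - axis j 1) \<bullet> x \<le> 0}) \<inter>
      (\<Inter>j\<in>J. {x. (axis j 1 - axis (up j) 1) \<bullet> x \<le> 0}))"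
    by (auto simp: chain_polytope_def inner_axis' inner_diff_left)
  then show ?thesis
    by (auto intro!: polyhedron_Int polyhedron_Inter polyhedron_hyperplane polyhedron_halfspace_le)
qed

text \<open>A run of equal coordinates that reaches down to the lower end of its chain, outside
  \<open>F\<close>. A chart has room for only one of the two inequalities at each index; it takes
  the lower one on these runs and the upper one elsewhere.\<close>

inductive tight_chain :: "'i set \<Rightarrow> ('i \<Rightarrow> 'i) \<Rightarrow> ('i \<Rightarrow> real) \<Rightarrow> 'i \<Rightarrow> bool" for F dn x where
  "j \<in> F \<Longrightarrow> x (dn j) = x j \<Longrightarrow> dn j \<notin> F \<or> tight_chain F dn x (dn j) \<Longrightarrow> tight_chain F dn x j"

lemma orthant_axis:
  "orthant ((\<lambda>j. axis j 1) ` F) = {y :: real ^ 'i::finite. \<forall>j. if j \<in> F then 0 \<le> y $ j else y $ j = 0}"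
  by (auto simp: orthant_def Basis_vec_def inner_axis axis_eq_axis image_iff split: if_splits)

text \<open>Since \<open>up\<close> and \<open>dn\<close> are inverse to each other inside
  \<open>J\<close>, the indices split into disjoint chains; the rank \<open>rk\<close> excludes
  cycles.\<close>

locale chain =
  fixes J :: "'i::finite set" and dn up :: "'i \<Rightarrow> 'i" and c :: "real ^ 'i" and rk :: "'i \<Rightarrow> nat"
  assumes up_dn: "j \<in> J \<Longrightarrow> dn j \<in> J \<Longrightarrow> up (dn j) = j"
    and dn_up: "j \<in> J \<Longrightarrow> up j \<in> J \<Longrightarrow> dn (up j) = j"
    and rk: "j \<in> J \<Longrightarrow> rk (dn j) < rk j"
begin

abbreviation "Q \<equiv> chain_polytope J dn up c"

definition strict_dn :: "real ^ 'i \<Rightarrow> 'i set" where "strict_dn x = {j \<in> J. x $ dn j < x $ j}"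
definition strict_up :: "real ^ 'i \<Rightarrow> 'i set" where "strict_up x = {j \<in> J. x $ j < x $ up j}"

lemma dn_neq: "j \<in> J \<Longrightarrow> dn j \<noteq> j"
  using rk by fastforce

lemma up_neq: "j \<in> J \<Longrightarrow> up j \<noteq> j"
  using rk dn_up by fastforce

text \<open>The midpoint of two points satisfies strictly every inequality that is strict at one of
  them. A point with the largest number of strict inequalities therefore has all those that are
  strict anywhere on \<open>Q\<close>.\<close>

lemma ex_max_strict:
  assumes "Q \<noteq> {}"
  obtains m where "m \<in> Q" "\<And>x. x \<in> Q \<Longrightarrow> strict_dn x \<subseteq> strict_dn m"
    "\<And>x. x \<in> Q \<Longrightarrow> strict_up x \<subseteq> strict_up m"
proof -
  define n where "n x = card (strict_dn x) + card (strict_up x)" for x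
  have "n x \<le> 2 * CARD('i)" for x
  proof -
    have "card (strict_dn x) \<le> CARD('i)" "card (strict_up x) \<le> CARD('i)" by (auto intro: card_mono)
    then show ?thesis unfolding n_def by simp
  qed
  then have "\<exists>m. m \<in> Q \<and> (\<forall>x. x \<in> Q \<longrightarrow> n x \<le> n m)"
    using assms by (intro ex_has_greatest_nat[where b = "Suc (2 * CARD('i))" and k = "SOME x. x \<in> Q"])
      (auto simp: some_in_eq less_Suc_eq_le)
  then obtain m where m: "m \<in> Q" "\<And>x. x \<in> Q \<Longrightarrow> n x \<le> n m" by blast
  have "strict_dn x \<subseteq> strict_dn m \<and> strict_up x \<subseteq> strict_up m" if x: "x \<in> Q" for x
  proof -
    define y where "y = (1/2) *\<^sub>R (x + m)"
    have y: "y $ i = (x $ i + m $ i) / 2" for i by (simp add: y_def)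
    have yQ: "y \<in> Q" using x m(1) unfolding chain_polytope_def
      by (auto simp: y intro!: divide_right_mono add_mono)
    have le: "x $ dn j \<le> x $ j" "m $ dn j \<le> m $ j" "x $ j \<le> x $ up j" "m $ j \<le> m $ up j"
      if "j \<in> J" for j using that x m(1) unfolding chain_polytope_def by auto
    have s: "strict_dn x \<subseteq> strict_dn y" "strict_dn m \<subseteq> strict_dn y"
      "strict_up x \<subseteq> strict_up y" "strict_up m \<subseteq> strict_up y"
      unfolding strict_dn_def strict_up_def using le by (auto simp: y intro: add_less_le_mono add_le_less_mono)
    then have "card (strict_dn m) \<le> card (strict_dn y)" "card (strict_up m) \<le> card (strict_up y)"
      by (auto intro: card_mono)
    with m(2)[OF yQ] have "card (strict_dn m) = card (strict_dn y)" "card (strict_up m) = card (strict_up y)"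
      unfolding n_def by auto
    then have "strict_dn m = strict_dn y" "strict_up m = strict_up y"
      using card_subset_eq[OF finite s(2)] card_subset_eq[OF finite s(4)] by auto
    then show ?thesis using s by auto
  qed
  then show ?thesis using that m(1) by blast
qed

end

locale chain_max = chain J dn up c rk
  for J :: "'i::finite set" and dn up :: "'i \<Rightarrow> 'i" and c :: "real ^ 'i" and rk :: "'i \<Rightarrow> nat" +
  fixes m :: "real ^ 'i"
  assumes m: "m \<in> chain_polytope J dn up c"
    and max_dn: "x \<in> chain_polytope J dn up c \<Longrightarrow> strict_dn x \<subseteq> strict_dn m"
    and max_up: "x \<in> chain_polytope J dn up c \<Longrightarrow> strict_up x \<subseteq> strict_up m"
begin

lemma m_le: "j \<in> J \<Longrightarrow> m $ dn j \<le> m $ j" "j \<in> J \<Longrightarrow> m $ j \<le> m $ up j" "i \<notin> J \<Longrightarrow> m $ i = c $ i"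
  using m unfolding chain_polytope_def by auto

text \<open>Changing one coordinate affects its own two inequalities only: where a neighbour in
  \<open>J\<close> has an inequality mentioning \<open>j\<close>, it is one of these two, because
  \<open>up\<close> and \<open>dn\<close> are inverse there.\<close>

lemma move_in:
  assumes j: "j \<in> J" and t: "m $ dn j \<le> t" "t \<le> m $ up j"
  shows "(\<chi> i. if i = j then t else m $ i) \<in> Q"
  unfolding chain_polytope_def
proof (intro CollectI conjI ballI allI impI)
  fix k assume k: "k \<in> J"
  show "(\<chi> i. if i = j then t else m $ i) $ dn k \<le> (\<chi> i. if i = j then t else m $ i) $ k"
    using k j t m_le dn_neq[OF j] up_dn[OF k] by auto
  show "(\<chi> i. if i = j then t else m $ i) $ k \<le> (\<chi> i. if i = j then t else m $ i) $ up k"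
    using k j t m_le up_neq[OF j] dn_up[OF k] by auto
qed (use j m_le in auto)

text \<open>If \<open>m\<close> leaves room on one side of coordinate \<open>j\<close>, moving that
  coordinate half way into the room makes the other inequality strict as well, so by maximality it
  was strict already.\<close>

lemma strict_dn_eq_up: "strict_dn m = strict_up m"
proof (intro equalityI subsetI)
  fix j assume "j \<in> strict_dn m"
  then have j: "j \<in> J" "m $ dn j < m $ j" unfolding strict_dn_def by auto
  let ?x = "\<chi> i. if i = j then (m $ dn j + m $ j) / 2 else m $ i"
  have "?x \<in> Q" using j m_le(2)[OF j(1)] by (intro move_in) auto
  moreover have "j \<in> strict_up ?x" using j m_le(2)[OF j(1)] up_neq[OF j(1)] unfolding strict_up_def by auto
  ultimately show "j \<in> strict_up m" using max_up by auto
next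
  fix j assume "j \<in> strict_up m"
  then have j: "j \<in> J" "m $ j < m $ up j" unfolding strict_up_def by auto
  let ?x = "\<chi> i. if i = j then (m $ up j + m $ j) / 2 else m $ i"
  have "?x \<in> Q" using j m_le(1)[OF j(1)] by (intro move_in) auto
  moreover have "j \<in> strict_dn ?x" using j m_le(1)[OF j(1)] dn_neq[OF j(1)] unfolding strict_dn_def by auto
  ultimately show "j \<in> strict_dn m" using max_dn by auto
qed

text \<open>The coordinates that vary on \<open>Q\<close>; all points of \<open>Q\<close> agree with
  \<open>m\<close> elsewhere, and \<open>card F\<close> turns out to be the dimension.\<close>

definition "F = strict_dn m"

lemma F_J: "j \<in> F \<Longrightarrow> j \<in> J" and F_dn: "j \<in> F \<Longrightarrow> m $ dn j < m $ j"
  unfolding F_def strict_dn_def by auto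

lemma F_up: "j \<in> F \<Longrightarrow> m $ j < m $ up j"
  unfolding F_def strict_dn_eq_up strict_up_def by auto

lemma not_F:
  assumes "j \<in> J" "j \<notin> F" "x \<in> Q"
  shows "x $ dn j = x $ j" "x $ up j = x $ j"
proof -
  have "j \<notin> strict_dn x" "j \<notin> strict_up x"
    using max_dn[OF assms(3)] max_up[OF assms(3)] assms(2) unfolding F_def strict_dn_eq_up[symmetric] by auto
  moreover have "x $ dn j \<le> x $ j" "x $ j \<le> x $ up j" using assms(1,3) unfolding chain_polytope_def by auto
  ultimately show "x $ dn j = x $ j" "x $ up j = x $ j"
    using assms(1) unfolding strict_dn_def strict_up_def by auto
qed

lemma not_F_dn: "j \<in> J \<Longrightarrow> j \<notin> F \<Longrightarrow> dn j \<notin> F"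
  using F_up[of "dn j"] F_J[of "dn j"] up_dn not_F(1)[OF _ _ m] by fastforce

lemma not_F_up: "j \<in> J \<Longrightarrow> j \<notin> F \<Longrightarrow> up j \<notin> F"
  using F_dn[of "up j"] F_J[of "up j"] dn_up not_F(2)[OF _ _ m] by fastforce

text \<open>Off \<open>F\<close> every lower inequality is an equality on all of \<open>Q\<close>,
  so the value is inherited step by step from a prescribed coordinate at the bottom.\<close>

lemma const_not_F: "x \<in> Q \<Longrightarrow> i \<notin> F \<Longrightarrow> x $ i = m $ i"
proof (induction i rule: measure_induct_rule[of rk])
  case (less i)
  show ?case
  proof (cases "i \<in> J")
    case True
    then have "x $ dn i = m $ dn i" using less rk not_F_dn by blast
    then show ?thesis using not_F(1)[OF True less.prems(2)] less.prems(1) m by metis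
  next
    case False
    then show ?thesis using less.prems(1) m_le(3) unfolding chain_polytope_def by auto
  qed
qed

lemma Q_iff:
  "x \<in> Q \<longleftrightarrow> (\<forall>i. i \<notin> F \<longrightarrow> x $ i = m $ i) \<and> (\<forall>j\<in>F. x $ dn j \<le> x $ j \<and> x $ j \<le> x $ up j)"
proof
  assume x: "x \<in> Q"
  then show "(\<forall>i. i \<notin> F \<longrightarrow> x $ i = m $ i) \<and> (\<forall>j\<in>F. x $ dn j \<le> x $ j \<and> x $ j \<le> x $ up j)"
    using const_not_F[OF x] F_J unfolding chain_polytope_def by auto
next
  assume *: "(\<forall>i. i \<notin> F \<longrightarrow> x $ i = m $ i) \<and> (\<forall>j\<in>F. x $ dn j \<le> x $ j \<and> x $ j \<le> x $ up j)"
  have "x $ dn j \<le> x $ j \<and> x $ j \<le> x $ up j" if j: "j \<in> J" for j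
  proof (cases "j \<in> F")
    case False
    then show ?thesis using * not_F_dn[OF j False] not_F_up[OF j False] not_F[OF j False m] by auto
  qed (use * in auto)
  moreover have "x $ i = c $ i" if "i \<notin> J" for i
  proof -
    have "i \<notin> F" using that F_J by blast
    then show ?thesis using * that m_le(3) by simp
  qed
  ultimately show "x \<in> Q" unfolding chain_polytope_def by auto
qed

text \<open>Inside the affine space of points that agree with \<open>m\<close> off \<open>F\<close>,
  the strict inequalities define a relatively open set that contains \<open>m\<close> and lies in
  \<open>Q\<close>.\<close>

lemma aff_dim_Q: "aff_dim Q = int (card F)"
proof -
  define V where "V = {x :: real ^ 'i. \<forall>i. i \<notin> F \<longrightarrow> x $ i = 0}"
  define A where "A = (+) m ` V"
  have V: "subspace V" unfolding V_def subspace_def by auto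
  have affA: "affine A" unfolding A_def using V by (simp add: affine_translation[symmetric] subspace_imp_affine)
  have A_iff: "x \<in> A \<longleftrightarrow> (\<forall>i. i \<notin> F \<longrightarrow> x $ i = m $ i)" for x
  proof
    assume "\<forall>i. i \<notin> F \<longrightarrow> x $ i = m $ i"
    then have "x - m \<in> V" unfolding V_def by auto
    then show "x \<in> A" unfolding A_def by (intro image_eqI[of _ _ "x - m"]) auto
  qed (auto simp: A_def V_def)
  have "V = {x. \<forall>i\<in>Basis. i \<notin> (\<lambda>j. axis j 1) ` F \<longrightarrow> x \<bullet> i = 0}"
    by (auto simp: V_def Basis_vec_def inner_axis axis_eq_axis image_iff)
  then have "dim V = card ((\<lambda>j. axis j (1::real)) ` F)"
    by (simp only:, intro dim_substandard) (auto simp: Basis_vec_def)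
  then have dimV: "dim V = card F" by (simp add: card_image inj_on_def axis_eq_axis)
  have dimA: "aff_dim A = int (card F)"
    unfolding A_def aff_dim_translation_eq using aff_dim_subspace[OF V] dimV by simp
  define G where "G = (\<Inter>j\<in>F. {x :: real ^ 'i. x $ dn j < x $ j} \<inter> {x. x $ j < x $ up j})"
  have "open G" unfolding G_def
    by (auto intro!: open_INT open_Int open_Collect_less continuous_intros)
  then have "openin (top_of_set A) (A \<inter> G)" by (simp add: openin_open_Int)
  moreover have "m \<in> A \<inter> G" using F_dn F_up by (auto simp: G_def A_iff)
  ultimately have "aff_dim (A \<inter> G) = aff_dim A"
    using aff_dim_openin affA by blast
  moreover have "A \<inter> G \<subseteq> Q" unfolding G_def by (force simp: Q_iff A_iff)
  moreover have "Q \<subseteq> A" by (auto simp: Q_iff A_iff)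
  ultimately show ?thesis using dimA aff_dim_subset by (metis order_antisym)
qed

text \<open>Near \<open>a\<close> only the inequalities that are tight at \<open>a\<close> count.
  The chart \<open>f\<close> has one coordinate for each free index, namely the slack of its lower
  inequality on runs anchored at a lower end and of its upper inequality otherwise. These slacks are
  independent and cover every tight inequality.\<close>

lemma manifold_Q: "manifold_with_corners (card F) Q"
  unfolding manifold_with_corners_def
proof
  fix a assume a: "a \<in> Q"
  define L where "L = {j. tight_chain F dn (\<lambda>i. a $ i) j}"
  have LF: "j \<in> F" if "j \<in> L" for j using that unfolding L_def by (auto elim: tight_chain.cases)
  have LI: "j \<in> L" if "j \<in> F" "a $ dn j = a $ j" "dn j \<notin> F \<or> dn j \<in> L" for j
    using that tight_chain.intros[of j F "\<lambda>i. a $ i" dn] unfolding L_def by auto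
  \<comment> \<open>\<open>T\<close> is the linear part of the chart; subtracting \<open>b\<close>
    turns the constant coordinates off \<open>F\<close> into the zeros that the orthant
    demands.\<close>
  define T :: "real ^ 'i \<Rightarrow> real ^ 'i" where
    "T h = (\<chi> j. if j \<in> L then h $ j - h $ dn j else if j \<in> F then h $ up j - h $ j else h $ j)" for h
  define b :: "real ^ 'i" where "b = (\<chi> j. if j \<in> F then 0 else m $ j)"
  have linT: "linear T" by (rule linearI) (auto simp: T_def vec_eq_iff algebra_simps)
  have "h = 0" if h: "T h = 0" for h
  proof -
    have T: "(if j \<in> L then h $ j - h $ dn j else if j \<in> F then h $ up j - h $ j else h $ j) = 0" for j
      using h unfolding T_def vec_eq_iff by simp
    have 1: "h $ i = 0" if "i \<notin> F" for i using T[of i] that LF by (auto split: if_splits)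
    have 2: "h $ j = 0" if "tight_chain F dn (\<lambda>i. a $ i) j" for j
      using that
    proof induction
      case (1 j)
      have "j \<in> L" using 1 tight_chain.intros[of j F "\<lambda>i. a $ i" dn] unfolding L_def by blast
      then have "h $ j = h $ dn j" using T[of j] by simp
      then show ?case using 1 \<open>\<And>i. i \<notin> F \<Longrightarrow> h $ i = 0\<close> by auto
    qed
    \<comment> \<open>On \<open>L\<close> zeros spread upwards from the lower ends; on the rest of
      \<open>F\<close> they spread downwards from above, which is why the measure reverses the
      rank.\<close>
    have "h $ j = 0" for j
    proof (induction j rule: measure_induct_rule[of "\<lambda>j. Max (range rk) - rk j"])
      case (less j)
      show ?case
      proof (cases "j \<in> F - L")
        case True
        then have e: "h $ j = h $ up j" using T[of j] by simp
        show ?thesis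
        proof (cases "up j \<in> F")
          case True
          have "dn (up j) = j" using True \<open>j \<in> F - L\<close> dn_up F_J by blast
          then have "rk j < rk (up j)" using rk[OF F_J[OF True]] by simp
          moreover have "rk (up j) \<le> Max (range rk)" by (simp add: Max_ge)
          ultimately have "Max (range rk) - rk (up j) < Max (range rk) - rk j" by linarith
          then show ?thesis using less.IH[of "up j"] e by simp
        qed (use e 1 in simp)
      qed (use 1 2 L_def in auto)
    qed
    then show ?thesis by (simp add: vec_eq_iff)
  qed
  then have "inj T" using linear_injective_0[OF linT] by blast
  then obtain T' where T': "linear T'" "\<And>x. T' (T x) = x" "\<And>x. T (T' x) = x"
    using linear_injective_isomorphism[OF linT] by blast
  define f where "f x = T x - b" for x
  define g where "g y = T' (y + b)" for y
  have gf: "g (f x) = x" and fg: "f (g y) = y" for x y unfolding f_def g_def by (simp_all add: T')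
  define U :: "(real ^ 'i) set" where "U = (\<Inter>j\<in>{j \<in> F. a $ dn j < a $ j}. {x. x $ dn j < x $ j}) \<inter>
      (\<Inter>j\<in>{j \<in> F. a $ j < a $ up j}. {x. x $ j < x $ up j})"
  have U: "open U" unfolding U_def
    by (auto intro!: open_INT open_Int open_Collect_less continuous_intros)
  have aU: "a \<in> U" unfolding U_def by auto
  define B :: "(real ^ 'i) set" where "B = (\<lambda>j. axis j 1) ` F"
  have B: "B \<subseteq> Basis" "card B = card F"
    unfolding B_def by (auto simp: Basis_vec_def card_image inj_on_def axis_eq_axis)
  \<comment> \<open>An anchored run carries the value of its lower end, which is strictly below
    \<open>m\<close> at \<open>j\<close>. So it cannot be tight against an upper end outside
    \<open>F\<close>, which settles the last case of \<open>key\<close>.\<close>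
  have low: "a $ j < m $ j" if "tight_chain F dn (\<lambda>i. a $ i) j" for j
    using that
  proof induction
    case (1 j)
    have "a $ dn j \<le> m $ dn j" using 1 const_not_F[OF a, of "dn j"] by auto
    then show ?case using 1 F_dn[of j] by simp
  qed
  have aQ: "a $ dn j \<le> a $ j" "a $ j \<le> a $ up j" if "j \<in> F" for j using a that unfolding Q_iff by auto
  \<comment> \<open>Inequalities strict at \<open>a\<close> hold throughout \<open>U\<close>. A
    tight one that is not the chosen inequality of \<open>j\<close> is the chosen one of a
    neighbour: the upper one of \<open>dn j\<close>, or the lower one of
    \<open>up j\<close>.\<close>
  have key: "x \<in> Q \<longleftrightarrow> f x \<in> orthant B" if x: "x \<in> U" for x
  proof
    assume "x \<in> Q"
    then show "f x \<in> orthant B"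
      unfolding B_def orthant_axis Q_iff using LF by (auto simp: f_def T_def b_def)
  next
    assume o: "f x \<in> orthant B"
    have f: "if j \<in> F then 0 \<le> f x $ j else f x $ j = 0" for j
      using o unfolding B_def orthant_axis by blast
    have fL: "x $ dn j \<le> x $ j" if "j \<in> L" for j
      using f[of j] that LF[OF that] by (simp add: f_def T_def b_def)
    have fF: "x $ j \<le> x $ up j" if "j \<in> F" "j \<notin> L" for j
      using f[of j] that by (simp add: f_def T_def b_def)
    have xU: "a $ dn j < a $ j \<Longrightarrow> x $ dn j < x $ j" "a $ j < a $ up j \<Longrightarrow> x $ j < x $ up j"
      if "j \<in> F" for j using x that unfolding U_def by auto
    have "x $ i = m $ i" if "i \<notin> F" for i
      using f[of i] that LF[of i] by (auto simp: f_def T_def b_def split: if_splits)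
    moreover have "x $ dn j \<le> x $ j" if j: "j \<in> F" for j
    proof (cases "j \<in> L \<or> a $ dn j < a $ j")
      case False
      then have "a $ dn j = a $ j" using aQ(1)[OF j] by simp
      then have d: "dn j \<in> F" "dn j \<notin> L" using LI[OF j] False by auto
      then have "up (dn j) = j" using up_dn F_J j by blast
      then show ?thesis using fF[OF d] by simp
    qed (use fL xU(1)[OF j] in force)
    moreover have "x $ j \<le> x $ up j" if j: "j \<in> F" for j
    proof (cases "j \<notin> L \<or> a $ j < a $ up j")
      case False
      then have e: "a $ up j = a $ j" using aQ(2)[OF j] by simp
      show ?thesis
      proof (cases "up j \<in> F")
        case True
        have d: "dn (up j) = j" using True j dn_up F_J by blast
        then have "up j \<in> L" using LI[OF True] e False by simp
        then show ?thesis using fL d by metis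
      next
        case False
        then have "a $ up j = m $ up j" using const_not_F[OF a] by blast
        moreover have "a $ j < m $ j" using low \<open>\<not> (j \<notin> L \<or> a $ j < a $ up j)\<close> unfolding L_def by blast
        ultimately show ?thesis using e F_up[OF j] by simp
      qed
    qed (use fF[OF j] xU(2)[OF j] in force)
    ultimately show "x \<in> Q" unfolding Q_iff by auto
  qed
  define W where "W = orthant B \<inter> g -` U"
  have linT': "bounded_linear T'" "bounded_linear T" using T'(1) linT by (simp_all add: linear_conv_bounded_linear)
  have smf: "smooth_on_open UNIV f"
    unfolding f_def using linT'(2) by (intro smooth_on_open_diff smooth_on_open_const smooth_on_open_linear) auto
  have g_alt: "g = (\<lambda>y. T' y + T' b)" unfolding g_def using linear_add[OF T'(1)] by auto
  have smg: "smooth_on_open UNIV g"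
    unfolding g_alt using linT'(1) by (intro smooth_on_open_add smooth_on_open_const smooth_on_open_linear) auto
  have "open (g -` U)"
    using U smooth_on_open_imp_continuous_on[OF smg] by (simp add: continuous_on_open_vimage)
  then have "openin (top_of_set (orthant B)) W" unfolding W_def by (simp add: openin_open_Int)
  moreover have "diffeomorphic (Q \<inter> U) W"
  proof (rule diffeomorphicI[of _ f _ g])
    show "smooth_map_on (Q \<inter> U) f" "smooth_map_on W g" by (rule smooth_map_onI[OF open_UNIV], auto intro: smf smg)+
    show "f x \<in> W" if "x \<in> Q \<inter> U" for x using that key[of x] gf[of x] unfolding W_def by auto
    show "g y \<in> Q \<inter> U" if "y \<in> W" for y using that key[of "g y"] fg[of y] unfolding W_def by auto
  qed (auto simp: gf fg)
  ultimately show "\<exists>U B W. open U \<and> a \<in> U \<and> B \<subseteq> Basis \<and> card B = card F \<and>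
     openin (top_of_set (orthant B :: (real ^ 'i) set)) W \<and> diffeomorphic (Q \<inter> U) W"
    using U aU B by blast
qed

end

theorem (in chain) chain_polytope_manifold:
  assumes "Q \<noteq> {}"
  obtains d where "aff_dim Q = int d" "manifold_with_corners d Q" "d \<le> card J"
    "\<And>x. x \<in> Q \<Longrightarrow> \<forall>j\<in>J. x $ dn j < x $ j \<Longrightarrow> d = card J"
proof -
  obtain m where mx: "m \<in> Q" "\<And>x. x \<in> Q \<Longrightarrow> strict_dn x \<subseteq> strict_dn m"
    "\<And>x. x \<in> Q \<Longrightarrow> strict_up x \<subseteq> strict_up m" using ex_max_strict[OF assms] by metis
  interpret chain_max J dn up c rk m by unfold_locales (use mx in auto)
  have "F \<subseteq> J" using F_J by auto
  moreover have "J \<subseteq> F" if "x \<in> Q" "\<forall>j\<in>J. x $ dn j < x $ j" for x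
    using mx(2)[OF that(1)] that(2) unfolding F_def strict_dn_def by auto
  ultimately show ?thesis
    using that[OF aff_dim_Q manifold_Q] by (metis card_mono finite subset_antisym)
qed

section \<open>Rooted trees and forests\<close>

locale rtree =
  fixes E :: "('v::finite \<times> 'v) set" and r :: 'v
  assumes tree: "rooted_tree E r"
begin

definition desc :: "'v \<Rightarrow> 'v set" where "desc v = {w. (v, w) \<in> E\<^sup>*}"

definition adj :: "'v \<Rightarrow> 'v \<Rightarrow> bool" where "adj a b \<longleftrightarrow> (a, b) \<in> E \<or> (b, a) \<in> E"

text \<open>For adjacent nodes this is the component of \<open>b\<close> after deletion of the edge
  between \<open>a\<close> and \<open>b\<close>, whichever way that edge is directed. It allows the
  tree to be treated as unrooted.\<close>

definition side :: "'v \<Rightarrow> 'v \<Rightarrow> 'v set" where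
  "side a b = (if (a, b) \<in> E then desc b else - desc a)"

lemma root_no_parent: "(u, r) \<notin> E"
  using tree unfolding rooted_tree_def by blast

lemma reachable: "(r, v) \<in> E\<^sup>*"
  using tree unfolding rooted_tree_def by blast

lemma parent_unique: "(u, v) \<in> E \<Longrightarrow> (u', v) \<in> E \<Longrightarrow> u = u'"
  using tree root_no_parent unfolding rooted_tree_def by metis

lemma pa_edge: "v \<noteq> r \<Longrightarrow> (pa E v, v) \<in> E"
  using tree unfolding rooted_tree_def pa_def by (metis theI')

lemma pa_eq: "(u, v) \<in> E \<Longrightarrow> pa E v = u"
  unfolding pa_def using parent_unique by blast

lemma edge_not_root: "(u, v) \<in> E \<Longrightarrow> v \<noteq> r"
  using root_no_parent by blast

lemma no_cycle: "(v, v) \<notin> E\<^sup>+"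
  using reachable[of v]
proof (induction rule: rtrancl_induct)
  case base
  show ?case using root_no_parent tranclD2 by metis
next
  case (step y z)
  show ?case
  proof
    assume "(z, z) \<in> E\<^sup>+"
    then have "(z, y) \<in> E\<^sup>*" using step(2) parent_unique tranclD2 by metis
    then have "(y, y) \<in> E\<^sup>+" using step(2) by (metis rtrancl_into_trancl2)
    then show False using step by blast
  qed
qed

lemma edge_asym: "(a, b) \<in> E \<Longrightarrow> (b, a) \<notin> E"
  using no_cycle[of a] by (meson r_into_trancl' trancl_into_trancl)

lemma adj_sym: "adj a b \<longleftrightarrow> adj b a"
  unfolding adj_def by blast

lemma adj_neq: "adj a b \<Longrightarrow> a \<noteq> b"
  using edge_asym unfolding adj_def by blast

lemma desc_self [simp]: "v \<in> desc v"
  unfolding desc_def by simp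

lemma desc_child: "a \<in> desc v \<Longrightarrow> (a, b) \<in> E \<Longrightarrow> b \<in> desc v"
  unfolding desc_def by (simp add: rtrancl.rtrancl_into_rtrancl)

lemma desc_parent: "b \<in> desc v \<Longrightarrow> b \<noteq> v \<Longrightarrow> (a, b) \<in> E \<Longrightarrow> a \<in> desc v"
  unfolding desc_def using parent_unique by (metis mem_Collect_eq rtranclE)

lemma desc_trans: "b \<in> desc a \<Longrightarrow> desc b \<subseteq> desc a"
  unfolding desc_def by auto

lemma parent_notin_desc: "(u, v) \<in> E \<Longrightarrow> u \<notin> desc v"
  unfolding desc_def using no_cycle[of u] by (auto dest: rtrancl_into_trancl2)

lemma desc_comparable: "x \<in> desc a \<Longrightarrow> x \<in> desc c \<Longrightarrow> a \<in> desc c \<or> c \<in> desc a"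
proof -
  assume "x \<in> desc a" and c: "x \<in> desc c"
  then have "(a, x) \<in> E\<^sup>*" unfolding desc_def by simp
  then show ?thesis using c
  proof (induction rule: rtrancl_induct)
    case (step y z)
    then show ?case using desc_parent[of z c y] desc_child[of y a z] unfolding desc_def
      by (metis mem_Collect_eq)
  qed simp
qed

lemma side_end: "adj a b \<Longrightarrow> b \<in> side a b" and side_start: "adj a b \<Longrightarrow> a \<notin> side a b"
  and side_swap: "adj a b \<Longrightarrow> side b a = - side a b"
  unfolding side_def adj_def using parent_notin_desc edge_asym by auto

lemma side_cross:
  assumes "adj a b" "adj c d" "c \<notin> side a b" "d \<in> side a b"
  shows "c = a \<and> d = b"
proof (cases "(a, b) \<in> E")
  case True
  then show ?thesis using assms desc_child desc_parent parent_unique unfolding side_def adj_def by metis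
next
  case False
  then have "(b, a) \<in> E" using assms(1) adj_def by blast
  then show ?thesis using False assms desc_child desc_parent parent_unique unfolding side_def adj_def
    by (metis ComplD ComplI)
qed

text \<open>Continuing a walk without turning back leaves ever fewer nodes ahead; this is the
  termination measure for walks in the forest.\<close>

lemma side_mono:
  assumes "adj a b" "adj b c" "c \<noteq> a"
  shows "side b c \<subset> side a b"
proof -
  have "side b c \<subseteq> side a b"
  proof (cases "(a, b) \<in> E")
    case True
    then have "(b, c) \<in> E" using assms parent_unique unfolding adj_def by blast
    then show ?thesis unfolding side_def using True desc_trans desc_child[OF desc_self] by simp
  next
    case False
    then have ba: "(b, a) \<in> E" using assms(1) adj_def by blast
    show ?thesis
    proof (cases "(b, c) \<in> E")
      case True
      have "desc c \<inter> desc a = {}"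
      proof (rule ccontr)
        assume "desc c \<inter> desc a \<noteq> {}"
        then have "a \<in> desc c \<or> c \<in> desc a" using desc_comparable by blast
        then have "b \<in> desc c \<or> b \<in> desc a" using desc_parent ba True assms(3) by metis
        then show False using parent_notin_desc ba True by blast
      qed
      then show ?thesis unfolding side_def using False True by auto
    next
      case F: False
      then show ?thesis unfolding side_def using False desc_trans[OF desc_child[OF desc_self ba]] by auto
    qed
  qed
  then show ?thesis using side_end[OF assms(1)] side_start[OF assms(2)] by blast
qed

lemma side_exists: "w \<noteq> v \<Longrightarrow> \<exists>u. adj v u \<and> w \<in> side v u"
proof (cases "w \<in> desc v")
  case True
  assume "w \<noteq> v"
  then obtain c where "(v, c) \<in> E" "w \<in> desc c"
    using True unfolding desc_def by (metis converse_rtranclE mem_Collect_eq)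
  then show ?thesis unfolding adj_def side_def by auto
next
  case False
  then have "v \<noteq> r" using reachable unfolding desc_def by auto
  from pa_edge[OF this] have "(v, pa E v) \<notin> E" "adj v (pa E v)" using edge_asym adj_def by auto
  then show ?thesis using False unfolding side_def by (intro exI[of _ "pa E v"]) auto
qed

lemma side_unique:
  "adj v u \<Longrightarrow> adj v u' \<Longrightarrow> w \<in> side v u \<Longrightarrow> w \<in> side v u' \<Longrightarrow> u = u'"
  using side_mono[of u v u'] side_swap[of v u] adj_sym by blast

lemma edge_cross:
  assumes "(u, v) \<in> E" "adj c d" "(c \<in> desc v) \<noteq> (d \<in> desc v)"
  shows "{c, d} = {u, v}"
  using assms(2,3) desc_child[of _ v] desc_parent[of _ v] parent_unique[OF assms(1)]
  unfolding adj_def by (metis doubleton_eq_iff)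

text \<open>The edge into \<open>v\<close> is the only one across which membership in
  \<open>desc v\<close> changes, and a path with distinct nodes traverses it just once.\<close>

lemma path_edges_separate:
  assumes uv: "(u, v) \<in> path_edges E a b"
  shows "(a \<in> desc v) \<noteq> (b \<in> desc v)"
proof -
  from uv obtain xs k where xs: "is_path E a xs b" and k: "Suc k < length xs"
    "{xs ! k, xs ! Suc k} = {u, v}" and E: "(u, v) \<in> E" unfolding path_edges_def by auto
  have d: "distinct xs" and ne: "xs \<noteq> []" and ab: "a = xs ! 0" "b = xs ! (length xs - 1)"
    using xs unfolding is_path_def by (auto simp: hd_conv_nth last_conv_nth)
  have adj: "adj (xs ! m) (xs ! Suc m)" if "Suc m < length xs" for m
    using xs that unfolding is_path_def adj_def by (auto simp: successively_conv_nth)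
  have same: "xs ! m \<in> desc v \<longleftrightarrow> xs ! Suc m \<in> desc v" if m: "Suc m < length xs" "m \<noteq> k" for m
  proof (rule ccontr)
    assume "\<not> ?thesis"
    then have "{xs ! m, xs ! Suc m} = {xs ! k, xs ! Suc k}"
      using edge_cross[OF E adj[OF m(1)]] k by auto
    then have "(m = k \<or> m = Suc k) \<and> (Suc m = k \<or> Suc m = Suc k)"
      using d m k nth_eq_iff_index_eq[OF d] by (auto simp: doubleton_eq_iff)
    then show False using m(2) by auto
  qed
  have 1: "m \<le> k \<Longrightarrow> xs ! m \<in> desc v \<longleftrightarrow> a \<in> desc v" for m
  proof (induction m)
    case (Suc m)
    then show ?case using same[of m] k by auto
  qed (simp add: ab)
  have 2: "Suc k + m < length xs \<Longrightarrow> xs ! (Suc k + m) \<in> desc v \<longleftrightarrow> xs ! Suc k \<in> desc v" for m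
  proof (induction m)
    case (Suc m)
    then show ?case using same[of "Suc k + m"] by auto
  qed simp
  have "b \<in> desc v \<longleftrightarrow> xs ! Suc k \<in> desc v"
  proof -
    have "Suc k + (length xs - 1 - Suc k) = length xs - 1" using k(1) by simp
    then show ?thesis using 2[of "length xs - 1 - Suc k"] k(1) unfolding ab(2) by simp
  qed
  moreover have "(xs ! k \<in> desc v) \<noteq> (xs ! Suc k \<in> desc v)"
  proof -
    have "(xs ! k = u \<and> xs ! Suc k = v) \<or> (xs ! k = v \<and> xs ! Suc k = u)"
      using k(2) by (simp only: doubleton_eq_iff)
    then show ?thesis using parent_notin_desc[OF E] by auto
  qed
  ultimately show ?thesis using 1[of k] by auto
qed

lemma ex_path: "\<exists>xs. is_path E a xs b"
proof -
  have "(a, r) \<in> (E \<union> E\<inverse>)\<^sup>*" "(r, b) \<in> (E \<union> E\<inverse>)\<^sup>*"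
    using rtrancl_converseI[OF reachable[of a]] reachable[of b]
    by (meson rtrancl_mono Un_upper1 Un_upper2 subsetD)+
  then have "(a, b) \<in> (E \<union> E\<inverse>)\<^sup>*" by simp
  then show ?thesis
  proof (induction rule: rtrancl_induct)
    case base
    show ?case by (rule exI[of _ "[a]"]) (simp add: is_path_def)
  next
    case (step y z)
    then obtain xs where xs: "is_path E a xs y" by blast
    show ?case
    proof (cases "z \<in> set xs")
      case True
      then obtain ys zs where "xs = ys @ z # zs" by (meson split_list)
      then have "is_path E a (ys @ [z]) z"
        using xs unfolding is_path_def by (auto simp: successively_append_iff hd_append)
      then show ?thesis by blast
    next
      case False
      then have "is_path E a (xs @ [z]) z"
        using xs step(2) unfolding is_path_def by (auto simp: successively_append_iff)
      then show ?thesis by blast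
    qed
  qed
qed

text \<open>Membership in \<open>desc v\<close> differs at the two ends of a path, so it changes at
  some step, and by \<open>edge_cross\<close> that step is the given edge.\<close>

lemma separate_path_edges:
  assumes E: "(u, v) \<in> E" and ab: "(a \<in> desc v) \<noteq> (b \<in> desc v)"
  shows "(u, v) \<in> path_edges E a b"
proof -
  obtain xs where xs: "is_path E a xs b" using ex_path by blast
  have ab': "a = xs ! 0" "b = xs ! (length xs - 1)" "xs \<noteq> []"
    using xs unfolding is_path_def by (auto simp: hd_conv_nth last_conv_nth)
  have adj: "adj (xs ! m) (xs ! Suc m)" if "Suc m < length xs" for m
    using xs that unfolding is_path_def adj_def by (auto simp: successively_conv_nth)
  have "\<exists>k. Suc k < length xs \<and> (xs ! k \<in> desc v) \<noteq> (xs ! Suc k \<in> desc v)"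
  proof (rule ccontr)
    assume *: "\<not> ?thesis"
    have "m < length xs \<Longrightarrow> xs ! m \<in> desc v \<longleftrightarrow> a \<in> desc v" for m
    proof (induction m)
      case (Suc m)
      then show ?case using * by auto
    qed (simp add: ab')
    from this[of "length xs - 1"] show False using ab ab' by auto
  qed
  then obtain k where k: "Suc k < length xs" "(xs ! k \<in> desc v) \<noteq> (xs ! Suc k \<in> desc v)" by blast
  show ?thesis
    using edge_cross[OF E adj[OF k(1)] k(2)] E xs k(1) unfolding path_edges_def by blast
qed

end

section \<open>Components of the forest and their orientation towards a chosen leaf\<close>

locale tree_forest = rtree E r for E :: "('v::finite \<times> 'v) set" and r :: 'v +
  fixes F :: "('v \<times> 'v) set" and leaf :: "'n::finite \<Rightarrow> 'v"
  assumes F_E: "F \<subseteq> E"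
    and inj_leaf: "inj leaf"
    and deg_leaf: "node_degree F (leaf i) \<le> 1"
    and deg_inner: "v \<notin> range leaf \<Longrightarrow> 2 \<le> node_degree F v"
begin

definition fadj :: "'v \<Rightarrow> 'v \<Rightarrow> bool" where "fadj a b \<longleftrightarrow> (a, b) \<in> F \<or> (b, a) \<in> F"

abbreviation conn :: "('v \<times> 'v) set" where "conn \<equiv> (F \<union> F\<inverse>)\<^sup>*"

definition inc_edge :: "'v \<Rightarrow> 'v \<Rightarrow> 'v \<times> 'v" where
  "inc_edge v u = (if (u, v) \<in> F then (u, v) else (v, u))"

lemma fadj_adj: "fadj a b \<Longrightarrow> adj a b"
  using F_E unfolding fadj_def adj_def by blast

lemma fadj_sym: "fadj a b \<longleftrightarrow> fadj b a"
  unfolding fadj_def by blast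

lemma conn_sym: "(a, b) \<in> conn \<longleftrightarrow> (b, a) \<in> conn"
proof -
  have "sym (F \<union> F\<inverse>)" by (auto simp: sym_def)
  then show ?thesis using sym_rtrancl[of "F \<union> F\<inverse>"] by (meson symD)
qed

lemma fadj_conn: "fadj a b \<Longrightarrow> (a, b) \<in> conn"
  unfolding fadj_def by (auto intro: r_into_rtrancl)

lemma inc_edge_inc: "inc_edge v ` {u. fadj v u} = {e \<in> F. v = fst e \<or> v = snd e}"
  "inj_on (inc_edge v) {u. fadj v u}"
proof -
  show "inc_edge v ` {u. fadj v u} = {e \<in> F. v = fst e \<or> v = snd e}"
  proof (intro equalityI subsetI)
    fix e assume e: "e \<in> {e \<in> F. v = fst e \<or> v = snd e}"
    obtain a b where ab: "e = (a, b)" by fastforce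
    then have "(b, a) \<notin> F" using e F_E edge_asym by blast
    then show "e \<in> inc_edge v ` {u. fadj v u}"
      using e ab by (auto simp: inc_edge_def fadj_def image_iff)
  qed (auto simp: inc_edge_def fadj_def)
  show "inj_on (inc_edge v) {u. fadj v u}"
    by (auto simp: inj_on_def inc_edge_def fadj_def split: if_splits)
qed

lemma node_degree_F: "node_degree F v = card {u. fadj v u}"
  unfolding node_degree_def using inc_edge_inc[of v] card_image by metis

text \<open>A walk in the forest that changes sides must step across the edge between
  \<open>a\<close> and \<open>b\<close> itself, so this edge belongs to the forest.\<close>

lemma conn_cross:
  assumes "adj a b" "(x, y) \<in> conn" "x \<notin> side a b" "y \<in> side a b"
  shows "fadj a b"
  using assms(2,3,4)
proof (induction rule: rtrancl_induct)
  case (step y z)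
  show ?case
  proof (cases "y \<in> side a b")
    case False
    have "fadj y z" using step(2) unfolding fadj_def by auto
    then show ?thesis using side_cross[OF assms(1) fadj_adj[of y z] False step.prems(2)] by auto
  qed (use step in auto)
qed simp

text \<open>An inner node has at least two forest neighbours, so the walk can always go on without
  turning back; as the sides shrink, it ends at a leaf.\<close>

lemma leaf_beyond: "fadj a b \<Longrightarrow> \<exists>i. leaf i \<in> side a b \<and> (b, leaf i) \<in> conn"
proof (induction "card (side a b)" arbitrary: a b rule: less_induct)
  case less
  show ?case
  proof (cases "b \<in> range leaf")
    case True
    then show ?thesis using side_end[OF fadj_adj[OF less.prems]] by auto
  next
    case False
    have "\<exists>c. fadj b c \<and> c \<noteq> a"
    proof (rule ccontr)
      assume "\<not> ?thesis"
      then have "{u. fadj b u} \<subseteq> {a}" by auto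
      then have "card {u. fadj b u} \<le> 1" using card_mono[of "{a}" "{u. fadj b u}"] by simp
      then show False using deg_inner[OF False] node_degree_F by simp
    qed
    then obtain c where c: "fadj b c" "c \<noteq> a" by blast
    have s: "side b c \<subset> side a b" using side_mono fadj_adj less.prems c by blast
    then have "card (side b c) < card (side a b)" by (simp add: psubset_card_mono)
    then obtain i where "leaf i \<in> side b c" "(c, leaf i) \<in> conn" using less.hyps c(1) by blast
    then show ?thesis using s fadj_conn[OF c(1)] by (metis psubsetD rtrancl_trans)
  qed
qed

lemma ex_leaf: "\<exists>i. (v, leaf i) \<in> conn"
proof (cases "v \<in> range leaf")
  case False
  then have "{u. fadj v u} \<noteq> {}" using deg_inner[of v] unfolding node_degree_F by (intro notI) simp
  then obtain u where u: "fadj v u" by auto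
  then show ?thesis using leaf_beyond[OF u] fadj_conn[OF u] by (meson rtrancl_trans)
qed auto

definition rep :: "'v \<Rightarrow> 'n" where "rep v = (SOME i. (v, leaf i) \<in> conn)"

abbreviation "rho v \<equiv> leaf (rep v)"

lemma rho_conn: "(v, rho v) \<in> conn"
  unfolding rep_def using ex_leaf[of v] by (rule someI_ex)

lemma rep_eq: "(u, v) \<in> conn \<Longrightarrow> rep u = rep v"
  unfolding rep_def using conn_sym by (metis rtrancl_trans)

lemma rep_fadj: "fadj u v \<Longrightarrow> rep u = rep v"
  using rep_eq fadj_conn by blast

text \<open>\<open>u\<close> is the next node on the way from \<open>v\<close> to its representative
  leaf. This orients each component towards that leaf, independently of the root.\<close>

definition near :: "'v \<Rightarrow> 'v \<Rightarrow> bool" where "near v u \<longleftrightarrow> fadj v u \<and> rho v \<in> side v u"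

lemma near_ex: "rho v \<noteq> v \<Longrightarrow> \<exists>u. near v u"
  unfolding near_def using side_exists conn_cross[OF _ rho_conn] side_start by metis

lemma near_unique: "near v u \<Longrightarrow> near v u' \<Longrightarrow> u = u'"
  unfolding near_def using side_unique fadj_adj by metis

text \<open>Both ends of a forest edge have the same representative leaf, and it lies on exactly one
  side of the edge.\<close>

lemma near_iff: "fadj a b \<Longrightarrow> near b a \<longleftrightarrow> \<not> near a b"
  unfolding near_def using side_swap[OF fadj_adj] rep_fadj fadj_sym by (metis ComplD ComplI)

lemma near_fadj: "near a b \<Longrightarrow> fadj a b"
  unfolding near_def by blast

lemma near_rho: "near v u \<Longrightarrow> rho v \<noteq> v"
  unfolding near_def using side_start fadj_adj by metis

lemma inner_rho: "v \<notin> range leaf \<Longrightarrow> rho v \<noteq> v"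
  by (metis rangeI)

definition nn :: "'v \<Rightarrow> 'v" where "nn v = (THE u. near v u)"
text \<open>Meant for degree-two nodes, where exactly one neighbour points away from the
  representative leaf.\<close>

definition fn :: "'v \<Rightarrow> 'v" where "fn v = (THE u. fadj v u \<and> \<not> near v u)"
definition deg2 :: "'v set" where "deg2 = {v. node_degree F v = 2}"

lemma deg2_inner: "v \<in> deg2 \<Longrightarrow> v \<notin> range leaf"
  unfolding deg2_def using deg_leaf by (auto simp: numeral_2_eq_2) (metis Suc_n_not_le_n)

lemma nn_eq: "near v u \<Longrightarrow> nn v = u"
  unfolding nn_def using near_unique by blast

lemma deg2_nbrs:
  assumes v: "v \<in> deg2"
  shows "near v (nn v)" "near (fn v) v" "nn v \<noteq> fn v" "{u. fadj v u} = {nn v, fn v}"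
proof -
  obtain u where u: "near v u" using near_ex inner_rho deg2_inner v by blast
  then have nu: "nn v = u" by (rule nn_eq)
  have "card {u. fadj v u} = 2" using v node_degree_F unfolding deg2_def by simp
  then obtain x y where xy: "{u. fadj v u} = {x, y}" "x \<noteq> y" by (meson card_2_iff)
  have "u \<in> {x, y}" using u near_fadj xy by blast
  then obtain w where w: "{u. fadj v u} = {u, w}" "w \<noteq> u" using xy by blast
  have nw: "\<not> near v w" using near_unique u w by blast
  have nbr: "fadj v x \<longleftrightarrow> x = u \<or> x = w" for x using w(1) by (simp add: set_eq_iff)
  then have fw: "fn v = w" unfolding fn_def using u nw by (intro the_equality) auto
  have "near w v" using near_iff[of v w] nbr nw by simp
  then show "near v (nn v)" "near (fn v) v" "nn v \<noteq> fn v" "{u. fadj v u} = {nn v, fn v}"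
    using nu fw u w by simp_all
qed

lemma fn_eq: "v \<in> deg2 \<Longrightarrow> near w v \<Longrightarrow> fn v = w"
  using deg2_nbrs[of v] near_iff near_fadj fadj_sym nn_eq
  by (metis insertE mem_Collect_eq singletonD)

lemma branch_nbrs:
  assumes "v \<notin> range leaf" "v \<notin> deg2"
  obtains w1 w2 where "near w1 v" "near w2 v" "w1 \<noteq> w2"
proof -
  have c: "3 \<le> card {u. fadj v u}"
    using deg_inner[OF assms(1)] assms(2) unfolding deg2_def node_degree_F by auto
  obtain u where u: "near v u" using near_ex inner_rho assms(1) by blast
  have "2 \<le> card ({u. fadj v u} - {u})" using c near_fadj[OF u] by (simp add: card_Diff_singleton)
  then obtain S where "S \<subseteq> {u. fadj v u} - {u}" "card S = 2" by (meson obtain_subset_with_card_n)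
  then obtain w1 w2 where w: "w1 \<noteq> w2" "w1 \<in> {u. fadj v u} - {u}" "w2 \<in> {u. fadj v u} - {u}"
    by (auto simp: card_2_iff)
  then show ?thesis using that near_iff near_unique u by (metis DiffE insertI1 mem_Collect_eq)
qed

text \<open>The number of nodes cut off from the representative leaf at \<open>v\<close>. The leaf
  itself receives \<open>CARD('v)\<close>, which exceeds the size of any proper side.\<close>

definition height :: "'v \<Rightarrow> nat" where
  "height v = (if rho v = v then CARD('v) else card (side (nn v) v))"

lemma height_near:
  assumes "near v u"
  shows "height v < height u"
proof -
  have hv: "height v = card (side u v)" unfolding height_def using near_rho nn_eq assms by auto
  have uv: "adj u v" using assms near_fadj fadj_adj adj_sym by blast
  show ?thesis
  proof (cases "rho u = u")
    case True
    have "side u v \<subset> UNIV" using side_start[OF uv] by blast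
    then have "card (side u v) < CARD('v)" by (simp add: psubset_card_mono)
    then show ?thesis using hv True unfolding height_def by simp
  next
    case False
    then obtain u' where u': "near u u'" using near_ex by blast
    have "u' \<noteq> v" using near_iff assms u' near_fadj by metis
    then have "side u v \<subset> side u' u"
      using side_mono[of u' u v] uv near_fadj[OF u'] fadj_adj adj_sym by blast
    then have "card (side u v) < card (side u' u)" by (simp add: psubset_card_mono)
    then show ?thesis using hv False nn_eq[OF u'] unfolding height_def by simp
  qed
qed

end

section \<open>The law of all variables\<close>

definition depends_on :: "'v set \<Rightarrow> (('v \<Rightarrow> bool) \<Rightarrow> real) \<Rightarrow> bool" where
  "depends_on A f \<longleftrightarrow> (\<forall>\<alpha> \<alpha>'. (\<forall>w\<in>A. \<alpha> w = \<alpha>' w) \<longrightarrow> f \<alpha> = f \<alpha>')"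

lemma depends_onD: "depends_on A f \<Longrightarrow> (\<And>w. w \<in> A \<Longrightarrow> \<alpha> w = \<alpha>' w) \<Longrightarrow> f \<alpha> = f \<alpha>'"
  unfolding depends_on_def by blast

lemma depends_on_mono: "depends_on A f \<Longrightarrow> A \<subseteq> B \<Longrightarrow> depends_on B f"
  unfolding depends_on_def by blast

lemma depends_on_const: "depends_on A (\<lambda>\<alpha>. c)"
  unfolding depends_on_def by simp

lemma depends_on_mult: "depends_on A f \<Longrightarrow> depends_on A g \<Longrightarrow> depends_on A (\<lambda>\<alpha>. f \<alpha> * g \<alpha>)"
  unfolding depends_on_def by metis

lemma depends_on_diff: "depends_on A f \<Longrightarrow> depends_on A g \<Longrightarrow> depends_on A (\<lambda>\<alpha>. f \<alpha> - g \<alpha>)"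
  unfolding depends_on_def by metis

lemma depends_on_prod: "(\<And>i. i \<in> I \<Longrightarrow> depends_on A (f i)) \<Longrightarrow> depends_on A (\<lambda>\<alpha>. \<Prod>i\<in>I. f i \<alpha>)"
  unfolding depends_on_def by (auto intro!: prod.cong)

text \<open>Sums out a single variable without splitting the space of configurations as a product;
  the price is that every configuration is counted twice.\<close>

lemma sum_flip:
  fixes H :: "('v::finite \<Rightarrow> bool) \<Rightarrow> real"
  shows "(\<Sum>\<alpha>\<in>UNIV. \<Sum>t\<in>UNIV. H (\<alpha>(v := t))) = 2 * (\<Sum>\<alpha>\<in>UNIV. H \<alpha>)"
proof -
  have "(\<Sum>t\<in>UNIV. H (\<alpha>(v := t))) = H \<alpha> + H (\<alpha>(v := \<not> \<alpha> v))" for \<alpha>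
    by (cases "\<alpha> v") (auto simp: UNIV_bool fun_upd_idem)
  moreover have "(\<Sum>\<alpha>\<in>UNIV. H (\<alpha>(v := \<not> \<alpha> v))) = (\<Sum>\<alpha>\<in>UNIV. H \<alpha>)"
    by (rule sum.reindex_bij_witness[of _ "\<lambda>\<alpha>. \<alpha>(v := \<not> \<alpha> v)" "\<lambda>\<alpha>. \<alpha>(v := \<not> \<alpha> v)"]) auto
  ultimately show ?thesis by (simp add: sum.distrib)
qed

text \<open>Exchanging the coordinates in \<open>S\<close> between two configurations that agree at \<open>a\<close> is an involution.\<close>

lemma sum_exchange:
  fixes \<Phi> \<Psi> f g :: "('v::finite \<Rightarrow> bool) \<Rightarrow> real"
  assumes "a \<notin> S" and \<Phi>: "depends_on (insert a S) \<Phi>" and \<Psi>: "depends_on (- S) \<Psi>"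
    and f: "depends_on (- S) f" and g: "depends_on (insert a S) g"
  shows "(\<Sum>\<alpha> | \<alpha> a = s. f \<alpha> * g \<alpha> * (\<Phi> \<alpha> * \<Psi> \<alpha>)) * (\<Sum>\<alpha> | \<alpha> a = s. \<Phi> \<alpha> * \<Psi> \<alpha>) =
    (\<Sum>\<alpha> | \<alpha> a = s. f \<alpha> * (\<Phi> \<alpha> * \<Psi> \<alpha>)) * (\<Sum>\<alpha> | \<alpha> a = s. g \<alpha> * (\<Phi> \<alpha> * \<Psi> \<alpha>))"
proof -
  define h where "h = (\<lambda>(\<alpha>, \<alpha>'). ((\<lambda>w. if w \<in> S then \<alpha>' w else \<alpha> w), (\<lambda>w. if w \<in> S then \<alpha> w else \<alpha>' w :: bool)))"
  have hh: "h (h x) = x" for x unfolding h_def by (auto split: prod.split)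
  let ?A = "{\<alpha> :: 'v \<Rightarrow> bool. \<alpha> a = s} \<times> {\<alpha> :: 'v \<Rightarrow> bool. \<alpha> a = s}"
  have hA: "h x \<in> ?A" if "x \<in> ?A" for x using that assms(1) unfolding h_def by auto
  show ?thesis unfolding sum_product sum.cartesian_product
  proof (rule sum.reindex_bij_witness[of _ h h])
    fix x assume x: "x \<in> ?A"
    obtain \<alpha> \<alpha>' where xe: "x = (\<alpha>, \<alpha>')" by fastforce
    define \<beta> \<beta>' where "\<beta> = fst (h x)" and "\<beta>' = snd (h x)"
    have e: "\<beta> w = (if w \<in> S then \<alpha>' w else \<alpha> w)" "\<beta>' w = (if w \<in> S then \<alpha> w else \<alpha>' w)" for w
      unfolding \<beta>_def \<beta>'_def h_def xe by auto
    have a: "\<alpha> a = \<alpha>' a" using x xe by auto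
    have "f \<beta> = f \<alpha>" "\<Psi> \<beta> = \<Psi> \<alpha>" "\<Psi> \<beta>' = \<Psi> \<alpha>'"
      by (rule depends_onD[OF f] depends_onD[OF \<Psi>]; simp add: e)+
    moreover have "g \<beta>' = g \<alpha>" "\<Phi> \<beta>' = \<Phi> \<alpha>" "\<Phi> \<beta> = \<Phi> \<alpha>'"
      by (rule depends_onD[OF g] depends_onD[OF \<Phi>]; auto simp: e a)+
    moreover have "h x = (\<beta>, \<beta>')" unfolding \<beta>_def \<beta>'_def by simp
    ultimately show "(case h x of (i, j) \<Rightarrow> f i * (\<Phi> i * \<Psi> i) * (g j * (\<Phi> j * \<Psi> j))) =
         (case x of (i, j) \<Rightarrow> f i * g i * (\<Phi> i * \<Psi> i) * (\<Phi> j * \<Psi> j))"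
      unfolding xe by simp
  qed (use hh hA in auto)
qed

section \<open>Expectations, conditional independence and covariances under the tree law\<close>

context rtree
begin

definition factor :: "'v param \<Rightarrow> 'v \<Rightarrow> ('v \<Rightarrow> bool) \<Rightarrow> bool \<Rightarrow> real" where
  "factor \<theta> v \<alpha> = cond_prob \<theta> v (if v = r then False else \<alpha> (pa E v))"

definition law :: "'v param \<Rightarrow> ('v \<Rightarrow> bool) \<Rightarrow> real" where
  "law \<theta> \<alpha> = (\<Prod>v\<in>UNIV. factor \<theta> v \<alpha> (\<alpha> v))"

text \<open>Defined for every real vector \<open>\<theta>\<close>, even where \<open>law\<close>
  takes negative values. The basic identities are polynomial in \<open>\<theta>\<close>, and
  smoothness has to be available on an open set.\<close>

definition ex :: "'v param \<Rightarrow> (('v \<Rightarrow> bool) \<Rightarrow> real) \<Rightarrow> real" where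
  "ex \<theta> f = (\<Sum>\<alpha>\<in>UNIV. f \<alpha> * law \<theta> \<alpha>)"

definition ind :: "'v \<Rightarrow> bool \<Rightarrow> ('v \<Rightarrow> bool) \<Rightarrow> real" where
  "ind v s \<alpha> = of_bool (\<alpha> v = s)"

abbreviation pr :: "'v param \<Rightarrow> 'v \<Rightarrow> bool \<Rightarrow> real" where
  "pr \<theta> v s \<equiv> ex \<theta> (ind v s)"

definition cv :: "'v param \<Rightarrow> (('v \<Rightarrow> bool) \<Rightarrow> real) \<Rightarrow> (('v \<Rightarrow> bool) \<Rightarrow> real) \<Rightarrow> real" where
  "cv \<theta> f g = ex \<theta> (\<lambda>\<alpha>. f \<alpha> * g \<alpha>) - ex \<theta> f * ex \<theta> g"

lemma f_T_law: "f_T E r leaf \<theta> \<beta> = (\<Sum>\<alpha> | \<alpha> \<circ> leaf = \<beta>. law \<theta> \<alpha>)"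
  unfolding f_T_def law_def factor_def ..

lemma depends_on_factor:
  "v \<in> A \<Longrightarrow> (v \<noteq> r \<Longrightarrow> pa E v \<in> A) \<Longrightarrow> depends_on A (\<lambda>\<alpha>. factor \<theta> v \<alpha> (\<alpha> v))"
  unfolding depends_on_def factor_def by auto

lemma depends_on_ind: "v \<in> A \<Longrightarrow> depends_on A (ind v s)"
  unfolding depends_on_def ind_def by auto

lemma ex_add: "ex \<theta> (\<lambda>\<alpha>. f \<alpha> + g \<alpha>) = ex \<theta> f + ex \<theta> g"
  unfolding ex_def by (simp add: distrib_right sum.distrib)

lemma ex_diff: "ex \<theta> (\<lambda>\<alpha>. f \<alpha> - g \<alpha>) = ex \<theta> f - ex \<theta> g"
  unfolding ex_def by (simp add: left_diff_distrib sum_subtractf)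

lemma ex_cmult: "ex \<theta> (\<lambda>\<alpha>. c * f \<alpha>) = c * ex \<theta> f"
  unfolding ex_def by (simp add: sum_distrib_left mult.assoc)

lemma ex_split: "ex \<theta> f = ex \<theta> (\<lambda>\<alpha>. f \<alpha> * ind v True \<alpha>) + ex \<theta> (\<lambda>\<alpha>. f \<alpha> * ind v False \<alpha>)"
  unfolding ex_add[symmetric] by (rule arg_cong[of _ _ "ex \<theta>"]) (auto simp: ind_def)

lemma ex_ind: "ex \<theta> (\<lambda>\<alpha>. f \<alpha> * ind v s \<alpha>) = (\<Sum>\<alpha> | \<alpha> v = s. f \<alpha> * law \<theta> \<alpha>)"
  unfolding ex_def ind_def by (rule sum.mono_neutral_cong_right) auto

lemma factor_sum: "factor \<theta> v \<alpha> True + factor \<theta> v \<alpha> False = 1"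
  unfolding factor_def cond_prob_def by simp

lemma law_split:
  assumes "adj a b"
  obtains \<Phi> \<Psi> where "law \<theta> = (\<lambda>\<alpha>. \<Phi> \<alpha> * \<Psi> \<alpha>)"
    "depends_on (insert a (side a b)) \<Phi>" "depends_on (- side a b) \<Psi>"
proof -
  \<comment> \<open>The factor belonging to the edge sits at its child. If the child is
    \<open>b\<close>, it already lies in the side; if it is \<open>a\<close>, it has to be
    added.\<close>
  define M where "M = (if (a, b) \<in> E then side a b else insert a (side a b))"
  have 1: "v \<in> insert a (side a b) \<and> (v \<noteq> r \<longrightarrow> pa E v \<in> insert a (side a b))" if "v \<in> M" for v
  proof (cases "(a, b) \<in> E")
    case True
    then show ?thesis using that pa_eq[OF True] desc_parent[OF _ _ pa_edge] unfolding M_def side_def by auto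
  next
    case False
    then have "(b, a) \<in> E" using assms adj_def by auto
    then show ?thesis using that False pa_eq[of b a] desc_child[OF _ pa_edge] parent_notin_desc
      unfolding M_def side_def by auto
  qed
  have 2: "v \<in> - side a b \<and> (v \<noteq> r \<longrightarrow> pa E v \<in> - side a b)" if "v \<notin> M" for v
  proof (cases "(a, b) \<in> E")
    case True
    then show ?thesis using that desc_child[OF _ pa_edge] unfolding M_def side_def by auto
  next
    case False
    then show ?thesis using that desc_parent[OF _ _ pa_edge] unfolding M_def side_def by auto
  qed
  show ?thesis
  proof (rule that)
    show "law \<theta> = (\<lambda>\<alpha>. (\<Prod>v\<in>M. factor \<theta> v \<alpha> (\<alpha> v)) * (\<Prod>v\<in>-M. factor \<theta> v \<alpha> (\<alpha> v)))"
      unfolding law_def by (simp add: prod.union_disjoint[symmetric] fun_eq_iff)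
  qed (use 1 2 in \<open>auto intro!: depends_on_prod depends_on_factor\<close>)
qed

text \<open>The two sides are conditionally independent given Y_a, because the law splits into two
  functions that share only this variable. Clearing denominators covers the case of a vanishing
  probability as well.\<close>

lemma cond_indep:
  assumes ab: "adj a b" and f: "depends_on (- side a b) f" and g: "depends_on (insert a (side a b)) g"
  shows "ex \<theta> (\<lambda>\<alpha>. f \<alpha> * g \<alpha> * ind a s \<alpha>) * pr \<theta> a s =
    ex \<theta> (\<lambda>\<alpha>. f \<alpha> * ind a s \<alpha>) * ex \<theta> (\<lambda>\<alpha>. g \<alpha> * ind a s \<alpha>)"
proof -
  obtain \<Phi> \<Psi> where *: "law \<theta> = (\<lambda>\<alpha>. \<Phi> \<alpha> * \<Psi> \<alpha>)"
    "depends_on (insert a (side a b)) \<Phi>" "depends_on (- side a b) \<Psi>" using law_split[OF ab] .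
  have pr: "pr \<theta> a s = (\<Sum>\<alpha> | \<alpha> a = s. \<Phi> \<alpha> * \<Psi> \<alpha>)"
    using ex_ind[of \<theta> "\<lambda>\<alpha>. 1" a s] by (simp add: *(1))
  show ?thesis using sum_exchange[OF side_start[OF ab] *(2,3) f g, of s]
    unfolding ex_ind pr by (simp add: *(1))
qed

text \<open>The factors of a set closed under children sum to one. The sum on the right still runs
  over all configurations and counts each coordinate in \<open>D\<close> twice, whence the power of
  2.\<close>

lemma ex_closed:
  assumes "\<And>x y. x \<in> D \<Longrightarrow> (x, y) \<in> E \<Longrightarrow> y \<in> D" "depends_on (- D) f"
  shows "2 ^ card D * ex \<theta> f = (\<Sum>\<alpha>\<in>UNIV. f \<alpha> * (\<Prod>w\<in>-D. factor \<theta> w \<alpha> (\<alpha> w)))"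
  using assms
proof (induction "card D" arbitrary: D rule: less_induct)
  case less
  show ?case
  proof (cases "D = {}")
    case True
    then show ?thesis by (simp add: ex_def law_def)
  next
    case False
    have "wf E" using finite_acyclic_wf[of E] no_cycle unfolding acyclic_def by simp
    \<comment> \<open>A topmost node of \<open>D\<close>: without it the set is still closed under
      children, and of the factors then left over only its own involves it.\<close>
    then obtain w where w: "w \<in> D" "\<And>y. (y, w) \<in> E \<Longrightarrow> y \<notin> D" using False wfE_min' by metis
    define D' where "D' = D - {w}"
    have cD: "card D = Suc (card D')" unfolding D'_def using card.remove[OF finite w(1)] .
    have IH: "2 ^ card D' * ex \<theta> f = (\<Sum>\<alpha>\<in>UNIV. f \<alpha> * (\<Prod>w\<in>-D'. factor \<theta> w \<alpha> (\<alpha> w)))"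
    proof (rule less.hyps)
      show "y \<in> D'" if "x \<in> D'" "(x, y) \<in> E" for x y
        using that w(2)[of x] less.prems(1)[of x y] unfolding D'_def by auto
      show "depends_on (- D') f" using less.prems(2) by (rule depends_on_mono) (auto simp: D'_def)
    qed (use cD in simp)
    define H where "H \<alpha> = f \<alpha> * (\<Prod>w\<in>-D. factor \<theta> w \<alpha> (\<alpha> w))" for \<alpha>
    have H: "depends_on (- D) H" unfolding H_def
      by (intro depends_on_mult less.prems(2) depends_on_prod depends_on_factor)
        (use less.prems(1) pa_edge in blast)+
    have upd: "H (\<alpha>(w := t)) = H \<alpha>" for \<alpha> t using w(1) by (intro depends_onD[OF H]) auto
    have fu: "factor \<theta> w (\<alpha>(w := t)) = factor \<theta> w \<alpha>" for \<alpha> t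
      unfolding factor_def using w pa_edge[of w] by auto
    have "- D' = insert w (- D)" using w(1) unfolding D'_def by auto
    then have "f \<alpha> * (\<Prod>w\<in>-D'. factor \<theta> w \<alpha> (\<alpha> w)) = H \<alpha> * factor \<theta> w \<alpha> (\<alpha> w)" for \<alpha>
      using w(1) by (simp add: H_def mult.assoc mult.left_commute)
    with IH have "2 ^ card D' * ex \<theta> f = (\<Sum>\<alpha>\<in>UNIV. H \<alpha> * factor \<theta> w \<alpha> (\<alpha> w))" by simp
    then have "2 ^ card D * ex \<theta> f = 2 * (\<Sum>\<alpha>\<in>UNIV. H \<alpha> * factor \<theta> w \<alpha> (\<alpha> w))" using cD by simp
    also have "\<dots> = (\<Sum>\<alpha>\<in>UNIV. \<Sum>t\<in>UNIV. H \<alpha> * factor \<theta> w \<alpha> t)"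
      unfolding sum_flip[of _ w, symmetric] by (simp add: upd fu)
    also have "\<dots> = (\<Sum>\<alpha>\<in>UNIV. H \<alpha>)"
      using factor_sum[of \<theta> w] by (simp add: UNIV_bool add.commute flip: distrib_left)
    finally show ?thesis unfolding H_def .
  qed
qed

lemma ex_one: "ex \<theta> (\<lambda>\<alpha>. 1) = 1"
  using ex_closed[of UNIV "\<lambda>\<alpha>. 1" \<theta>] by (simp add: depends_on_const card_fun)

lemma ex_const: "ex \<theta> (\<lambda>\<alpha>. c) = c"
  using ex_cmult[of \<theta> c "\<lambda>\<alpha>. 1"] ex_one by simp

lemma pr_sum: "pr \<theta> v True + pr \<theta> v False = 1"
  using ex_split[of \<theta> "\<lambda>\<alpha>. 1" v] ex_one by simp

text \<open>The local Markov property: given everything outside \<open>desc v\<close>, the law of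
  Y_v is its factor. Both sides come from \<open>ex_closed\<close>, applied to the proper
  descendants of \<open>v\<close> and to all of \<open>desc v\<close>.\<close>

lemma ex_local:
  assumes f: "depends_on (- desc v) f"
  shows "ex \<theta> (\<lambda>\<alpha>. f \<alpha> * ind v t \<alpha>) = ex \<theta> (\<lambda>\<alpha>. f \<alpha> * factor \<theta> v \<alpha> t)"
proof -
  define D where "D = desc v - {v}"
  have cl: "y \<in> desc v" if "x \<in> desc v" "(x, y) \<in> E" for x y using desc_child that by blast
  have clD: "y \<in> D" if "x \<in> D" "(x, y) \<in> E" for x y
    using cl that parent_notin_desc[OF that(2)] unfolding D_def by auto
  have card: "card (desc v) = Suc (card D)" unfolding D_def using card.remove[OF finite desc_self] .
  define P where "P \<alpha> = f \<alpha> * (\<Prod>w\<in>-desc v. factor \<theta> w \<alpha> (\<alpha> w))" for \<alpha>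
  have P: "depends_on (- desc v) P" unfolding P_def
    by (intro depends_on_mult f depends_on_prod depends_on_factor) (use cl pa_edge in blast)+
  have upd: "P (\<alpha>(v := s)) = P \<alpha>" for \<alpha> s by (intro depends_onD[OF P]) auto
  have pv: "v \<noteq> r \<Longrightarrow> pa E v \<noteq> v \<and> pa E v \<notin> desc v"
    using parent_notin_desc[OF pa_edge, of v] desc_self[of v] by metis
  have fu: "factor \<theta> v (\<alpha>(v := s)) = factor \<theta> v \<alpha>" for \<alpha> s
    unfolding factor_def using pv by auto
  have "-D = insert v (- desc v)" unfolding D_def by auto
  then have *: "f \<alpha> * ind v t \<alpha> * (\<Prod>w\<in>-D. factor \<theta> w \<alpha> (\<alpha> w)) = P \<alpha> * (ind v t \<alpha> * factor \<theta> v \<alpha> (\<alpha> v))" for \<alpha>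
    by (simp add: P_def mult.assoc mult.left_commute)
  have "2 ^ card D * ex \<theta> (\<lambda>\<alpha>. f \<alpha> * ind v t \<alpha>) = (\<Sum>\<alpha>\<in>UNIV. P \<alpha> * (ind v t \<alpha> * factor \<theta> v \<alpha> (\<alpha> v)))"
    unfolding *[symmetric]
    by (rule ex_closed[OF clD]) (auto intro!: depends_on_mult depends_on_mono[OF f] depends_on_ind simp: D_def)
  then have "2 ^ card (desc v) * ex \<theta> (\<lambda>\<alpha>. f \<alpha> * ind v t \<alpha>) = 2 * (\<Sum>\<alpha>\<in>UNIV. P \<alpha> * (ind v t \<alpha> * factor \<theta> v \<alpha> (\<alpha> v)))"
    using card by simp
  also have "\<dots> = (\<Sum>\<alpha>\<in>UNIV. P \<alpha> * factor \<theta> v \<alpha> t)"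
    unfolding sum_flip[of _ v, symmetric]
    by (intro sum.cong refl) (cases t; simp add: upd fu ind_def UNIV_bool)
  also have "\<dots> = (\<Sum>\<alpha>\<in>UNIV. (f \<alpha> * factor \<theta> v \<alpha> t) * (\<Prod>w\<in>-desc v. factor \<theta> w \<alpha> (\<alpha> w)))"
    unfolding P_def by (simp add: mult_ac)
  also have "\<dots> = 2 ^ card (desc v) * ex \<theta> (\<lambda>\<alpha>. f \<alpha> * factor \<theta> v \<alpha> t)"
  proof (rule ex_closed[OF cl, symmetric])
    show "depends_on (- desc v) (\<lambda>\<alpha>. f \<alpha> * factor \<theta> v \<alpha> t)"
      by (intro depends_on_mult f) (use pv in \<open>auto simp: depends_on_def factor_def\<close>)
  qed
  finally show ?thesis by simp
qed

lemma pr_root: "pr \<theta> r True = \<theta> $ (r, False)"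
  using ex_local[of r "\<lambda>\<alpha>. 1" \<theta> True] by (simp add: depends_on_const factor_def cond_prob_def ex_const)

lemma pr_edge:
  assumes "(u, v) \<in> E"
  shows "ex \<theta> (\<lambda>\<alpha>. ind u i \<alpha> * ind v True \<alpha>) = pr \<theta> u i * \<theta> $ (v, i)"
proof -
  have "ex \<theta> (\<lambda>\<alpha>. ind u i \<alpha> * ind v True \<alpha>) = ex \<theta> (\<lambda>\<alpha>. ind u i \<alpha> * factor \<theta> v \<alpha> True)"
    by (rule ex_local) (use parent_notin_desc[OF assms] in \<open>simp add: depends_on_ind\<close>)
  also have "(\<lambda>\<alpha>. ind u i \<alpha> * factor \<theta> v \<alpha> True) = (\<lambda>\<alpha>. \<theta> $ (v, i) * ind u i \<alpha>)"
  proof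
    fix \<alpha> show "ind u i \<alpha> * factor \<theta> v \<alpha> True = \<theta> $ (v, i) * ind u i \<alpha>"
      using edge_not_root[OF assms] pa_eq[OF assms]
      by (cases "\<alpha> u = i") (simp_all add: factor_def cond_prob_def ind_def)
  qed
  finally show ?thesis by (simp add: ex_cmult)
qed

lemma law_nonneg: "\<theta> \<in> Theta r \<Longrightarrow> 0 \<le> law \<theta> \<alpha>"
  unfolding law_def factor_def cond_prob_def Theta_def by (auto intro!: prod_nonneg)

lemma ex_nonneg: "\<theta> \<in> Theta r \<Longrightarrow> (\<And>\<alpha>. 0 \<le> f \<alpha>) \<Longrightarrow> 0 \<le> ex \<theta> f"
  unfolding ex_def by (intro sum_nonneg mult_nonneg_nonneg law_nonneg) auto

lemma pr_zero:
  assumes "\<theta> \<in> Theta r" "pr \<theta> a s = 0"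
  shows "ex \<theta> (\<lambda>\<alpha>. f \<alpha> * ind a s \<alpha>) = 0"
proof -
  have "\<forall>\<alpha>\<in>UNIV. ind a s \<alpha> * law \<theta> \<alpha> = 0"
    using assms(2) unfolding ex_def
    by (subst (asm) sum_nonneg_eq_0_iff) (auto simp: ind_def law_nonneg[OF assms(1)])
  then show ?thesis unfolding ex_def mult.assoc by (intro sum.neutral) auto
qed

lemma cv_sym: "cv \<theta> f g = cv \<theta> g f"
  unfolding cv_def by (simp add: mult.commute)

text \<open>The product in front is the variance of Y_a. Any conditional mean given a binary
  variable is affine in it, so by conditional independence covariances multiply along
  \<open>a\<close>, up to this variance.\<close>

lemma cv_sep:
  assumes ab: "adj a b" and f: "depends_on (- side a b) f" and g: "depends_on (insert a (side a b)) g"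
    and nz: "pr \<theta> a True \<noteq> 0" "pr \<theta> a False \<noteq> 0"
  shows "pr \<theta> a True * pr \<theta> a False * cv \<theta> f g = cv \<theta> f (ind a True) * cv \<theta> (ind a True) g"
proof -
  define p1 p0 f1 f0 g1 g0 where "p1 = pr \<theta> a True" "p0 = pr \<theta> a False"
    "f1 = ex \<theta> (\<lambda>\<alpha>. f \<alpha> * ind a True \<alpha>)" "f0 = ex \<theta> (\<lambda>\<alpha>. f \<alpha> * ind a False \<alpha>)"
    "g1 = ex \<theta> (\<lambda>\<alpha>. g \<alpha> * ind a True \<alpha>)" "g0 = ex \<theta> (\<lambda>\<alpha>. g \<alpha> * ind a False \<alpha>)"
  note defs = this
  have p0: "p0 = 1 - p1" using pr_sum[of \<theta> a] defs by simp
  have nz': "p1 \<noteq> 0" "1 - p1 \<noteq> 0" using nz p0 defs by auto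
  have e1: "ex \<theta> (\<lambda>\<alpha>. f \<alpha> * g \<alpha> * ind a True \<alpha>) = f1 * g1 / p1"
    using cond_indep[OF ab f g, of \<theta> True] nz unfolding defs by (simp add: field_simps)
  have e0: "ex \<theta> (\<lambda>\<alpha>. f \<alpha> * g \<alpha> * ind a False \<alpha>) = f0 * g0 / (1 - p1)"
    using cond_indep[OF ab f g, of \<theta> False] nz unfolding p0[symmetric] unfolding defs by (simp add: field_simps)
  have ef: "ex \<theta> f = f1 + f0" "ex \<theta> g = g1 + g0" using ex_split defs by auto
  have efg: "ex \<theta> (\<lambda>\<alpha>. f \<alpha> * g \<alpha>) = f1 * g1 / p1 + f0 * g0 / (1 - p1)"
    using ex_split[of \<theta> "\<lambda>\<alpha>. f \<alpha> * g \<alpha>" a] e1 e0 by simp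
  have "cv \<theta> f (ind a True) = f1 - (f1 + f0) * p1" "cv \<theta> (ind a True) g = g1 - p1 * (g1 + g0)"
    unfolding cv_def ef using defs by (simp_all add: mult.commute)
  moreover have "cv \<theta> f g = f1 * g1 / p1 + f0 * g0 / (1 - p1) - (f1 + f0) * (g1 + g0)"
    unfolding cv_def efg ef ..
  moreover have "p1 * (1 - p1) * (x / p1 + y / (1 - p1) - z) = (1 - p1) * x + p1 * y - p1 * (1 - p1) * z" for x y z
  proof -
    have "p1 * (1 - p1) * (x / p1) = (1 - p1) * x" "p1 * (1 - p1) * (y / (1 - p1)) = p1 * y"
      using nz' by (simp_all only: field_simps times_divide_eq_right nonzero_mult_div_cancel_left) (auto simp: field_simps nz')
    then show ?thesis by (simp only: distrib_left right_diff_distrib)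
  qed
  moreover have "(1 - p1) * (f1 * g1) + p1 * (f0 * g0) - p1 * (1 - p1) * ((f1 + f0) * (g1 + g0)) =
      (f1 - (f1 + f0) * p1) * (g1 - p1 * (g1 + g0))"
    by algebra
  ultimately show ?thesis using defs p0 by simp
qed

text \<open>If Y_a is almost surely constant, conditional independence given Y_a is plain
  independence.\<close>

lemma cv_degenerate:
  assumes \<theta>: "\<theta> \<in> Theta r" and ab: "adj a b"
    and f: "depends_on (- side a b) f" and g: "depends_on (insert a (side a b)) g"
    and z: "pr \<theta> a s = 0"
  shows "cv \<theta> f g = 0"
proof -
  have 1: "pr \<theta> a (\<not> s) = 1" using pr_sum[of \<theta> a] z by (cases s) auto
  have "ex \<theta> h = ex \<theta> (\<lambda>\<alpha>. h \<alpha> * ind a (\<not> s) \<alpha>)" for h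
    using ex_split[of \<theta> h a] pr_zero[OF \<theta> z, of h] by (cases s) auto
  then show ?thesis using cond_indep[OF ab f g, of \<theta> "\<not> s"] 1 unfolding cv_def by simp
qed

lemma cv_sep_nonzero:
  assumes "\<theta> \<in> Theta r" "adj a b" "depends_on (- side a b) f" "depends_on (insert a (side a b)) g"
    and "cv \<theta> f g \<noteq> 0"
  shows "pr \<theta> a s \<noteq> 0" "cv \<theta> f (ind a True) \<noteq> 0" "cv \<theta> (ind a True) g \<noteq> 0"
proof -
  show nz: "pr \<theta> a s \<noteq> 0" for s using cv_degenerate assms by blast
  show "cv \<theta> f (ind a True) \<noteq> 0" "cv \<theta> (ind a True) g \<noteq> 0"
    using cv_sep[OF assms(2-4) nz nz] nz assms(5) by auto
qed

end

section \<open>Coordinates on the fiber\<close>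

locale tree_fiber = tree_forest E r "forest_edges E leaf p" leaf
  for E :: "('v::finite \<times> 'v) set" and r :: 'v and leaf :: "'n::finite \<Rightarrow> 'v" and p :: "('n \<Rightarrow> bool) pmf" +
  assumes nondeg: "leaf_mean p i * (1 - leaf_mean p i) \<noteq> 0"
begin

abbreviation "F \<equiv> forest_edges E leaf p"
abbreviation "fib \<equiv> fiber E r leaf p"
abbreviation "X i \<equiv> ind (leaf i) True"

lemma fib_Theta: "\<theta> \<in> fib \<Longrightarrow> \<theta> \<in> Theta r"
  unfolding fiber_def by simp

lemma fib_expectation:
  assumes "\<theta> \<in> fib"
  shows "ex \<theta> (\<lambda>\<alpha>. h (\<alpha> \<circ> leaf)) = measure_pmf.expectation p h"
proof -
  have "ex \<theta> (\<lambda>\<alpha>. h (\<alpha> \<circ> leaf)) = (\<Sum>\<beta>\<in>UNIV. \<Sum>\<alpha> | \<alpha> \<in> UNIV \<and> \<alpha> \<circ> leaf = \<beta>. h (\<alpha> \<circ> leaf) * law \<theta> \<alpha>)"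
    unfolding ex_def by (subst sum.group) auto
  also have "\<dots> = (\<Sum>\<beta>\<in>UNIV. h \<beta> * f_T E r leaf \<theta> \<beta>)"
    unfolding f_T_law sum_distrib_left by (intro sum.cong refl) auto
  also have "\<dots> = (\<Sum>\<beta>\<in>UNIV. h \<beta> * pmf p \<beta>)"
    using assms unfolding fiber_def by simp
  also have "\<dots> = measure_pmf.expectation p h"
    by (rule integral_measure_pmf_real[symmetric]) auto
  finally show ?thesis .
qed

lemma fib_mean: "\<theta> \<in> fib \<Longrightarrow> pr \<theta> (leaf i) True = leaf_mean p i"
  using fib_expectation[of \<theta> "\<lambda>x. of_bool (x i)"] unfolding leaf_mean_def ind_def[abs_def] by simp

lemma fib_cov:
  assumes "\<theta> \<in> fib"
  shows "cv \<theta> (X i) (X j) = leaf_cov p i j"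
proof -
  let ?i = "leaf_mean p i" and ?j = "leaf_mean p j"
  have "leaf_cov p i j = ex \<theta> (\<lambda>\<alpha>. (X i \<alpha> - ?i) * (X j \<alpha> - ?j))"
    using fib_expectation[OF assms, of "\<lambda>x. (of_bool (x i) - ?i) * (of_bool (x j) - ?j)"]
    unfolding leaf_cov_def ind_def by simp
  also have "(\<lambda>\<alpha>. (X i \<alpha> - ?i) * (X j \<alpha> - ?j)) = (\<lambda>\<alpha>. X i \<alpha> * X j \<alpha> - ?j * X i \<alpha> - ?i * X j \<alpha> + ?i * ?j)"
    by (auto simp: algebra_simps)
  also have "ex \<theta> \<dots> = ex \<theta> (\<lambda>\<alpha>. X i \<alpha> * X j \<alpha>) - ?j * ?i - ?i * ?j + ?i * ?j"
    unfolding ex_add ex_diff ex_cmult ex_const fib_mean[OF assms] ..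
  finally show ?thesis unfolding cv_def fib_mean[OF assms] by simp
qed

lemma pr_leaf: "\<theta> \<in> fib \<Longrightarrow> pr \<theta> (leaf i) s \<noteq> 0"
  using fib_mean[of \<theta> i] nondeg[of i] pr_sum[of \<theta> "leaf i"] by (cases s) auto

text \<open>A forest edge separates some pair of correlated leaves. Factoring their covariance at
  \<open>u\<close>, and then the covariance with Y_u at \<open>v\<close>, shows that no factor can
  vanish.\<close>

lemma forest_edge_cov:
  assumes \<theta>: "\<theta> \<in> fib" and uv: "(u, v) \<in> F"
  shows "pr \<theta> u s \<noteq> 0" "pr \<theta> v s \<noteq> 0" "cv \<theta> (ind u True) (ind v True) \<noteq> 0"
proof -
  have E: "(u, v) \<in> E" using uv F_E by blast
  from uv obtain i j where ij: "(u, v) \<in> path_edges E (leaf i) (leaf j)" "leaf_cov p i j \<noteq> 0"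
    unfolding forest_edges_def isolated_edges_def by auto
  have "\<exists>i j. leaf i \<in> desc v \<and> leaf j \<notin> desc v \<and> cv \<theta> (X j) (X i) \<noteq> 0"
    using path_edges_separate[OF ij(1)] ij(2) fib_cov[OF \<theta>] cv_sym by metis
  then obtain i j where ij: "leaf i \<in> desc v" "leaf j \<notin> desc v" "cv \<theta> (X j) (X i) \<noteq> 0" by blast
  have s: "side u v = desc v" "side v u = - desc v" using E edge_asym unfolding side_def by auto
  have a: "adj u v" "adj v u" using E unfolding adj_def by auto
  note 1 = cv_sep_nonzero[OF fib_Theta[OF \<theta>] a(1), of "X j" "X i", unfolded s, OF _ _ ij(3)]
  show "pr \<theta> u s \<noteq> 0" by (rule 1) (use ij in \<open>auto intro!: depends_on_ind\<close>)
  have "cv \<theta> (X i) (ind u True) \<noteq> 0"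
    unfolding cv_sym[of \<theta> "X i"] by (rule 1) (use ij in \<open>auto intro!: depends_on_ind\<close>)
  note 2 = cv_sep_nonzero[OF fib_Theta[OF \<theta>] a(2), of "X i" "ind u True", unfolded s, OF _ _ this]
  show "pr \<theta> v s \<noteq> 0"
    by (rule 2) (use ij parent_notin_desc[OF E] in \<open>auto intro!: depends_on_ind\<close>)
  show "cv \<theta> (ind u True) (ind v True) \<noteq> 0" unfolding cv_sym[of \<theta> "ind u True"]
    by (rule 2) (use ij parent_notin_desc[OF E] in \<open>auto intro!: depends_on_ind\<close>)
qed

lemma fadj_cov:
  assumes "\<theta> \<in> fib" "fadj a b"
  shows "cv \<theta> (ind a True) (ind b True) \<noteq> 0"
  using assms(2) forest_edge_cov(3)[OF assms(1)] cv_sym unfolding fadj_def by metis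

lemma pr_neq_0:
  assumes \<theta>: "\<theta> \<in> fib"
  shows "pr \<theta> v s \<noteq> 0"
proof (cases "v \<in> range leaf")
  case True
  then show ?thesis using pr_leaf[OF \<theta>] by auto
next
  case False
  then obtain u where "near v u" using near_ex inner_rho by blast
  then have "(u, v) \<in> F \<or> (v, u) \<in> F" using near_fadj unfolding fadj_def by blast
  then show ?thesis using forest_edge_cov[OF \<theta>] by blast
qed

lemma pr_pos: "\<theta> \<in> fib \<Longrightarrow> 0 < pr \<theta> v s"
  using pr_neq_0[of \<theta> v s] ex_nonneg[OF fib_Theta, of \<theta> "ind v s"] by (auto simp: ind_def less_le)

lemma fib_cv_sep:
  assumes "\<theta> \<in> fib" "adj a b" "depends_on (- side a b) f" "depends_on (insert a (side a b)) g"
  shows "pr \<theta> a True * pr \<theta> a False * cv \<theta> f g = cv \<theta> f (ind a True) * cv \<theta> (ind a True) g"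
  using cv_sep assms pr_neq_0 by blast

lemma pr_False: "pr \<theta> v False = 1 - pr \<theta> v True"
  using pr_sum[of \<theta> v] by linarith

lemma conn_cov:
  assumes \<theta>: "\<theta> \<in> fib" and "(a, v) \<in> conn"
  shows "cv \<theta> (ind a True) (ind v True) \<noteq> 0"
  using assms(2)
proof (induction rule: rtrancl_induct)
  case base
  have "(\<lambda>\<alpha>. ind a True \<alpha> * ind a True \<alpha>) = ind a True" by (auto simp: ind_def)
  then have "cv \<theta> (ind a True) (ind a True) = pr \<theta> a True * pr \<theta> a False"
    unfolding cv_def pr_False by (simp add: algebra_simps)
  then show ?case using pr_neq_0[OF \<theta>] by simp
next
  case (step y z)
  have yz: "fadj y z" using step(2) unfolding fadj_def by auto
  then have ad: "adj y z" "adj z y" using fadj_adj adj_sym by auto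
  note nz = pr_neq_0[OF \<theta>] fadj_cov[OF \<theta> yz] step.IH
  \<comment> \<open>The walk may run back and forth. If \<open>a\<close> lies on the far side of the
    step, the factorization is taken at \<open>z\<close> and read backwards: its left-hand side is
    known to be nonzero.\<close>
  show ?case
  proof (cases "a \<in> side y z")
    case False
    have "pr \<theta> y True * pr \<theta> y False * cv \<theta> (ind a True) (ind z True) =
        cv \<theta> (ind a True) (ind y True) * cv \<theta> (ind y True) (ind z True)"
      by (rule fib_cv_sep[OF \<theta> ad(1)]) (use False side_end[OF ad(1)] in \<open>auto intro!: depends_on_ind\<close>)
    then show ?thesis using nz by auto
  next
    case True
    have "pr \<theta> z True * pr \<theta> z False * cv \<theta> (ind a True) (ind y True) =
        cv \<theta> (ind a True) (ind z True) * cv \<theta> (ind z True) (ind y True)"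
      by (rule fib_cv_sep[OF \<theta> ad(2)])
        (use True side_end[OF ad(2)] side_swap[OF ad(1)] in \<open>auto intro!: depends_on_ind\<close>)
    then show ?thesis using nz by auto
  qed
qed

text \<open>The representative leaves of \<open>u\<close> and \<open>v\<close> lie on their own
  sides of the isolated edge, so their covariance vanishes. It factors through \<open>u\<close> and
  \<open>v\<close> with nonzero outer factors, and hence the middle one is zero.\<close>

lemma isolated_cov:
  assumes \<theta>: "\<theta> \<in> fib" and uv: "(u, v) \<in> E" "(u, v) \<notin> F"
  shows "cv \<theta> (ind u True) (ind v True) = 0"
proof -
  have s: "side u v = desc v" "side v u = - desc v" using uv(1) edge_asym unfolding side_def by auto
  have a: "adj u v" "adj v u" using uv(1) unfolding adj_def by auto
  have nf: "\<not> fadj u v" "\<not> fadj v u" using uv F_E edge_asym unfolding fadj_def by auto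
  have u: "rho u \<notin> desc v" using conn_cross[OF a(1) rho_conn] nf side_start[OF a(1)] unfolding s by blast
  have v: "rho v \<in> desc v" using conn_cross[OF a(2) rho_conn] nf side_start[OF a(2)] unfolding s by blast
  have "(u, v) \<in> path_edges E (rho u) (rho v)" using separate_path_edges[OF uv(1)] u v by blast
  moreover have "(u, v) \<in> isolated_edges E leaf p" using uv unfolding forest_edges_def by blast
  moreover have "rep u \<noteq> rep v" using u v by auto
  ultimately have "leaf_cov p (rep u) (rep v) = 0" unfolding isolated_edges_def by blast
  then have z: "cv \<theta> (X (rep u)) (X (rep v)) = 0" using fib_cov[OF \<theta>] by simp
  have "pr \<theta> u True * pr \<theta> u False * cv \<theta> (X (rep u)) (X (rep v)) =
      cv \<theta> (X (rep u)) (ind u True) * cv \<theta> (ind u True) (X (rep v))"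
    by (rule fib_cv_sep[OF \<theta> a(1)]) (use u v s in \<open>auto intro!: depends_on_ind\<close>)
  moreover have "cv \<theta> (X (rep u)) (ind u True) \<noteq> 0" "cv \<theta> (X (rep v)) (ind v True) \<noteq> 0"
    using conn_cov[OF \<theta>] rho_conn conn_sym by blast+
  moreover have "pr \<theta> v True * pr \<theta> v False * cv \<theta> (X (rep v)) (ind u True) =
      cv \<theta> (X (rep v)) (ind v True) * cv \<theta> (ind v True) (ind u True)"
    by (rule fib_cv_sep[OF \<theta> a(2)])
      (use u v s parent_notin_desc[OF uv(1)] in \<open>auto intro!: depends_on_ind\<close>)
  ultimately show ?thesis using z cv_sym by (metis mult_eq_0_iff)
qed

definition lam :: "'v \<Rightarrow> real" where "lam v = leaf_mean p (rep v)"

text \<open>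
  The coordinates of the fiber: the conditional probabilities of \<open>X\<^bsub>rep v\<^esub> = 1\<close> given
  \<open>Y\<^sub>v = s\<close>, where \<open>rep v\<close> is one chosen leaf for each component of the forest.
\<close>

definition Xi :: "'v param \<Rightarrow> 'v param" where
  "Xi \<theta> = (\<chi> j. ex \<theta> (\<lambda>\<alpha>. X (rep (fst j)) \<alpha> * ind (fst j) (snd j) \<alpha>) / pr \<theta> (fst j) (snd j))"

text \<open>Centring at the mean of the representative leaf gives the two values at a node weighted
  mean zero, hence opposite signs.\<close>

definition z :: "'v param \<Rightarrow> 'v \<Rightarrow> bool \<Rightarrow> real" where "z x v s = x $ (v, s) - lam v"

definition marg :: "'v param \<Rightarrow> 'v \<Rightarrow> bool \<Rightarrow> real" where
  "marg x v s = (if s then - z x v False else z x v True) / (z x v True - z x v False)"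

text \<open>
  \<open>marg\<close> expresses \<open>P(Y\<^sub>v = s)\<close> in these coordinates, and \<open>kern\<close> the quotient of
  \<open>P(Y\<^sub>a = s, Y\<^sub>b = t)\<close> by the product of the marginals, for an edge of the forest.
\<close>

definition kern :: "'v param \<Rightarrow> 'v \<Rightarrow> bool \<Rightarrow> 'v \<Rightarrow> bool \<Rightarrow> real" where
  "kern x a s b t =
     (if near b a then 1 - z x b t / z x a (\<not> s) else 1 - z x a s / z x b (\<not> t))"

text \<open>The candidate inverse of \<open>Xi\<close>. On a forest edge the entry is the joint
  probability divided by the marginal of the parent, which has cancelled against the normalization
  of \<open>kern\<close>.\<close>

definition Psi :: "'v param \<Rightarrow> 'v param" where
  "Psi x = (\<chi> j. if fst j = r then (if snd j then 0 else marg x r True)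
     else if (pa E (fst j), fst j) \<in> F
     then marg x (fst j) True * kern x (pa E (fst j)) (snd j) (fst j) True
     else marg x (fst j) True)"

lemma kern_sym: "fadj a b \<Longrightarrow> kern x a s b t = kern x b t a s"
  unfolding kern_def using near_iff by auto

section \<open>Recovering marginals, joint laws and parameters from the coordinates\<close>

lemma z_Xi_pr:
  assumes \<theta>: "\<theta> \<in> fib"
  shows "z (Xi \<theta>) v s * pr \<theta> v s = ex \<theta> (\<lambda>\<alpha>. (X (rep v) \<alpha> - lam v) * ind v s \<alpha>)"
proof -
  have "(\<lambda>\<alpha>. (X (rep v) \<alpha> - lam v) * ind v s \<alpha>) = (\<lambda>\<alpha>. X (rep v) \<alpha> * ind v s \<alpha> - lam v * ind v s \<alpha>)"
    by (auto simp: algebra_simps)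
  then have "ex \<theta> (\<lambda>\<alpha>. (X (rep v) \<alpha> - lam v) * ind v s \<alpha>) =
      ex \<theta> (\<lambda>\<alpha>. X (rep v) \<alpha> * ind v s \<alpha>) - lam v * pr \<theta> v s"
    by (simp only: ex_diff ex_cmult)
  then show ?thesis using pr_neq_0[OF \<theta>, of v s]
    by (simp add: z_def Xi_def left_diff_distrib)
qed

lemma z_Xi_mean:
  assumes \<theta>: "\<theta> \<in> fib"
  shows "z (Xi \<theta>) v True * pr \<theta> v True + z (Xi \<theta>) v False * pr \<theta> v False = 0"
  unfolding z_Xi_pr[OF \<theta>] ex_split[symmetric]
  using ex_diff[of \<theta> "X (rep v)" "\<lambda>\<alpha>. lam v"] fib_mean[OF \<theta>] by (simp add: ex_const lam_def)

text \<open>Equal values would make Y_v uncorrelated with the representative leaf of its own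
  component.\<close>

lemma z_Xi_neq:
  assumes \<theta>: "\<theta> \<in> fib"
  shows "z (Xi \<theta>) v True \<noteq> z (Xi \<theta>) v False"
proof
  assume eq: "z (Xi \<theta>) v True = z (Xi \<theta>) v False"
  then have "z (Xi \<theta>) v True * (pr \<theta> v True + pr \<theta> v False) = 0"
    using z_Xi_mean[OF \<theta>, of v] by (simp add: distrib_left)
  then have "z (Xi \<theta>) v True = 0" using pr_sum by simp
  then have "ex \<theta> (\<lambda>\<alpha>. (X (rep v) \<alpha> - lam v) * ind v True \<alpha>) = 0" using z_Xi_pr[OF \<theta>, of v True] by simp
  then have "ex \<theta> (\<lambda>\<alpha>. X (rep v) \<alpha> * ind v True \<alpha>) - lam v * pr \<theta> v True = 0"
    unfolding ex_cmult[symmetric] ex_diff[symmetric] by (simp add: algebra_simps)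
  then have "cv \<theta> (X (rep v)) (ind v True) = 0" unfolding cv_def fib_mean[OF \<theta>] lam_def by simp
  then show False using conn_cov[OF \<theta>] rho_conn conn_sym by blast
qed

lemma z_Xi_sign:
  assumes \<theta>: "\<theta> \<in> fib"
  shows "z (Xi \<theta>) v True * z (Xi \<theta>) v False < 0"
proof -
  let ?a = "z (Xi \<theta>) v True" and ?b = "z (Xi \<theta>) v False"
  note p = pr_pos[OF \<theta>, of v True] pr_pos[OF \<theta>, of v False]
  have e: "?a * pr \<theta> v True = - (?b * pr \<theta> v False)" using z_Xi_mean[OF \<theta>, of v] by linarith
  have "?b \<noteq> 0" using e z_Xi_neq[OF \<theta>, of v] p by auto
  have "(?a * ?b) * pr \<theta> v True = - (?b * ?b * pr \<theta> v False)"
  proof -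
    have "(?a * ?b) * pr \<theta> v True = ?b * (?a * pr \<theta> v True)" by simp
    then show ?thesis unfolding e by simp
  qed
  moreover have "0 < ?b * ?b * pr \<theta> v False" using p(2) \<open>?b \<noteq> 0\<close> by (auto simp: zero_less_mult_iff)
  ultimately have "(?a * ?b) * pr \<theta> v True < 0" by linarith
  then show ?thesis using p(1) by (simp add: mult_less_0_iff)
qed

lemma marg_Xi:
  assumes \<theta>: "\<theta> \<in> fib"
  shows "marg (Xi \<theta>) v s = pr \<theta> v s"
proof -
  let ?a = "z (Xi \<theta>) v True" and ?b = "z (Xi \<theta>) v False"
  have "?a * pr \<theta> v True + ?b * (1 - pr \<theta> v True) = 0"
    using z_Xi_mean[OF \<theta>, of v] unfolding pr_False .
  then have "pr \<theta> v True * (?a - ?b) = - ?b" by (simp add: algebra_simps)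
  then have 1: "pr \<theta> v True = - ?b / (?a - ?b)" using z_Xi_neq[OF \<theta>, of v] by (simp add: field_simps)
  have "pr \<theta> v False = 1 - pr \<theta> v True" by (rule pr_False)
  also have "\<dots> = ?a / (?a - ?b)" unfolding 1 using z_Xi_neq[OF \<theta>, of v] by (simp add: field_simps)
  finally show ?thesis using 1 unfolding marg_def by (cases s) auto
qed

text \<open>Since \<open>u\<close> separates \<open>v\<close> from the representative leaf, Y_v
  influences the conditional mean of that leaf only through Y_u. Divided by
  \<open>pr \<theta> v t\<close>, the identity exhibits the value at \<open>v\<close> as a convex
  combination of the values at \<open>u\<close>.\<close>

lemma z_Xi_near:
  assumes \<theta>: "\<theta> \<in> fib" and vu: "near v u"
  shows "z (Xi \<theta>) v t * pr \<theta> v t =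
     z (Xi \<theta>) u True * ex \<theta> (\<lambda>\<alpha>. ind v t \<alpha> * ind u True \<alpha>) +
     z (Xi \<theta>) u False * ex \<theta> (\<lambda>\<alpha>. ind v t \<alpha> * ind u False \<alpha>)"
proof -
  have a: "adj u v" using vu near_fadj fadj_adj adj_sym by blast
  have rep: "rep u = rep v" "lam u = lam v" using rep_fadj near_fadj[OF vu] unfolding lam_def by auto
  have rho: "rho v \<in> - side u v" using vu side_swap[OF a] unfolding near_def by blast
  let ?f = "\<lambda>\<alpha>. X (rep v) \<alpha> - lam v"
  have f: "depends_on (- side u v) ?f"
    using rho by (intro depends_on_diff depends_on_ind depends_on_const) auto
  have g: "depends_on (insert u (side u v)) (ind v t)" using side_end[OF a] by (intro depends_on_ind) simp
  have "ex \<theta> (\<lambda>\<alpha>. ?f \<alpha> * ind v t \<alpha> * ind u s \<alpha>) =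
    z (Xi \<theta>) u s * ex \<theta> (\<lambda>\<alpha>. ind v t \<alpha> * ind u s \<alpha>)" for s
  proof -
    have "ex \<theta> (\<lambda>\<alpha>. ?f \<alpha> * ind v t \<alpha> * ind u s \<alpha>) * pr \<theta> u s =
        (z (Xi \<theta>) u s * pr \<theta> u s) * ex \<theta> (\<lambda>\<alpha>. ind v t \<alpha> * ind u s \<alpha>)"
      using cond_indep[OF a f g, of \<theta> s] z_Xi_pr[OF \<theta>, of u s] rep by simp
    then show ?thesis using pr_neq_0[OF \<theta>, of u s] by simp
  qed
  then show ?thesis unfolding z_Xi_pr[OF \<theta>] using ex_split[of \<theta> "\<lambda>\<alpha>. ?f \<alpha> * ind v t \<alpha>" u] by simp
qed

text \<open>For fixed \<open>t\<close> the two joint probabilities satisfy two linear equations: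
  their sum is the marginal at \<open>v\<close>, and their sum weighted by the values at
  \<open>u\<close> is given by \<open>z_Xi_near\<close>. The values at \<open>u\<close> differ, so
  the system can be solved.\<close>

lemma joint_near:
  assumes \<theta>: "\<theta> \<in> fib" and vu: "near v u"
  shows "ex \<theta> (\<lambda>\<alpha>. ind v t \<alpha> * ind u s \<alpha>) = pr \<theta> v t * pr \<theta> u s * (1 - z (Xi \<theta>) v t / z (Xi \<theta>) u (\<not> s))"
proof -
  define q where "q s = ex \<theta> (\<lambda>\<alpha>. ind v t \<alpha> * ind u s \<alpha>)" for s
  define a b where "a = z (Xi \<theta>) u True" and "b = z (Xi \<theta>) u False"
  have q: "q True + q False = pr \<theta> v t" unfolding q_def using ex_split[of \<theta> "ind v t" u] by simp
  have ab: "a \<noteq> b" "a \<noteq> 0" "b \<noteq> 0" using z_Xi_neq[OF \<theta>, of u] z_Xi_sign[OF \<theta>, of u] unfolding a_def b_def by auto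
  have m: "pr \<theta> u True = - b / (a - b)" "pr \<theta> u False = a / (a - b)"
    using marg_Xi[OF \<theta>, of u True] marg_Xi[OF \<theta>, of u False] unfolding marg_def a_def b_def by simp_all
  have zq: "z (Xi \<theta>) v t * (q True + q False) = a * q True + b * q False"
    unfolding q using z_Xi_near[OF \<theta> vu, of t] unfolding q_def a_def b_def .
  let ?P = "q True + q False" and ?z = "z (Xi \<theta>) v t"
  have "q True * (a - b) = ?P * (?z - b)" "q False * (a - b) = ?P * (a - ?z)"
    using zq by (simp_all add: algebra_simps)
  then have "q True = ?P * (?z - b) / (a - b)" "q False = ?P * (a - ?z) / (a - b)"
    using ab(1) by (simp_all add: field_simps)
  moreover have "(?z - b) / (a - b) = - b / (a - b) * (1 - ?z / b)" "(a - ?z) / (a - b) = a / (a - b) * (1 - ?z / a)"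
    using ab by (simp_all add: field_simps)
  ultimately have "q True = ?P * (- b / (a - b) * (1 - ?z / b))" "q False = ?P * (a / (a - b) * (1 - ?z / a))"
    by (simp_all only: times_divide_eq_right[symmetric])
  then show ?thesis unfolding q_def[symmetric] q[symmetric] using m
    by (cases s) (simp_all add: mult.assoc flip: a_def b_def)
qed

lemma joint_fadj:
  assumes \<theta>: "\<theta> \<in> fib" and "fadj u v"
  shows "ex \<theta> (\<lambda>\<alpha>. ind u s \<alpha> * ind v t \<alpha>) = pr \<theta> u s * pr \<theta> v t * kern (Xi \<theta>) u s v t"
proof (cases "near v u")
  case True
  then show ?thesis using joint_near[OF \<theta> True, of t s] unfolding kern_def by (simp add: mult_ac)
next
  case False
  then have "near u v" using near_iff assms(2) by blast
  then show ?thesis using joint_near[OF \<theta>, of u v s t] False unfolding kern_def by simp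
qed

lemma Psi_Xi:
  assumes \<theta>: "\<theta> \<in> fib"
  shows "Psi (Xi \<theta>) = \<theta>"
proof -
  have "Psi (Xi \<theta>) $ (v, i) = \<theta> $ (v, i)" for v i
  proof (cases "v = r")
    case True
    then show ?thesis using pr_root[of \<theta>] marg_Xi[OF \<theta>] fib_Theta[OF \<theta>]
      unfolding Psi_def Theta_def by (cases i) auto
  next
    case False
    define u where "u = pa E v"
    have E: "(u, v) \<in> E" unfolding u_def using pa_edge[OF False] .
    have e: "ex \<theta> (\<lambda>\<alpha>. ind u i \<alpha> * ind v True \<alpha>) = pr \<theta> u i * \<theta> $ (v, i)" by (rule pr_edge[OF E])
    show ?thesis
    proof (cases "(u, v) \<in> F")
      case True
      then have "ex \<theta> (\<lambda>\<alpha>. ind u i \<alpha> * ind v True \<alpha>) = pr \<theta> u i * pr \<theta> v True * kern (Xi \<theta>) u i v True"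
        by (intro joint_fadj[OF \<theta>]) (simp add: fadj_def)
      then show ?thesis using e pr_neq_0[OF \<theta>, of u i] False True marg_Xi[OF \<theta>, of v True]
        unfolding Psi_def u_def by simp
    next
      case F: False
      have c: "ex \<theta> (\<lambda>\<alpha>. ind u True \<alpha> * ind v True \<alpha>) = pr \<theta> u True * pr \<theta> v True"
        using isolated_cov[OF \<theta> E F] unfolding cv_def by simp
      have "ex \<theta> (\<lambda>\<alpha>. ind u i \<alpha> * ind v True \<alpha>) = pr \<theta> u i * pr \<theta> v True"
      proof (cases i)
        case False
        have "pr \<theta> v True = ex \<theta> (\<lambda>\<alpha>. ind u True \<alpha> * ind v True \<alpha>) + ex \<theta> (\<lambda>\<alpha>. ind u False \<alpha> * ind v True \<alpha>)"
          using ex_split[of \<theta> "ind v True" u] by (simp add: mult.commute)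
        then have "ex \<theta> (\<lambda>\<alpha>. ind u False \<alpha> * ind v True \<alpha>) = (1 - pr \<theta> u True) * pr \<theta> v True"
          using c by (simp add: algebra_simps)
        then show ?thesis using False pr_sum[of \<theta> u] by (simp add: eq_diff_eq[symmetric] add.commute)
      qed (use c in simp)
      then show ?thesis using e pr_neq_0[OF \<theta>, of u i] False F marg_Xi[OF \<theta>, of v True]
        unfolding Psi_def u_def by simp
    qed
  qed
  then show ?thesis by (simp add: vec_eq_iff)
qed

end

section \<open>Leaf marginals in the new coordinates\<close>

context tree_fiber
begin

definition admissible :: "'v param \<Rightarrow> bool" where
  "admissible x \<longleftrightarrow> (\<forall>v. z x v True * z x v False < 0)"

lemma admissible_Xi: "\<theta> \<in> fib \<Longrightarrow> admissible (Xi \<theta>)"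
  unfolding admissible_def using z_Xi_sign by blast

lemma admissible_neq:
  assumes "admissible x"
  shows "z x v s \<noteq> 0" "z x v True \<noteq> z x v False"
proof -
  have "z x v True * z x v False < 0" using assms unfolding admissible_def by blast
  then show "z x v s \<noteq> 0" "z x v True \<noteq> z x v False"
    by (cases s; auto simp: mult_less_0_iff)+
qed

lemma marg_pos:
  assumes "admissible x"
  shows "0 < marg x v s"
proof -
  have "z x v True * z x v False < 0" using assms unfolding admissible_def by blast
  then show ?thesis unfolding marg_def
    by (auto simp: mult_less_0_iff zero_less_divide_iff)
qed

lemma marg_sum:
  assumes "admissible x"
  shows "marg x v True + marg x v False = 1"
  unfolding marg_def using admissible_neq(2)[OF assms, of v] by (simp add: diff_divide_distrib[symmetric])

lemma marg_z:
  shows "marg x v True * z x v True + marg x v False * z x v False = 0"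
  unfolding marg_def by (simp add: field_simps)

lemma marg_inv_z:
  assumes "admissible x"
  shows "marg x v True / z x v False + marg x v False / z x v True = 0"
  unfolding marg_def using admissible_neq[OF assms, of v] admissible_neq(1)[OF assms, of v True] by simp

text \<open>The deviation of \<open>kern\<close> from 1 averages to zero over the states of
  \<open>b\<close>. This is \<open>marg_z\<close> if the values at \<open>b\<close> stand in the
  numerator, and \<open>marg_inv_z\<close> if they stand in the denominator.\<close>

lemma kern_norm:
  assumes x: "admissible x" and ab: "fadj a b"
  shows "marg x b True * kern x a s b True + marg x b False * kern x a s b False = 1"
proof (cases "near b a")
  case True
  have "marg x b True * (1 - z x b True / k) + marg x b False * (1 - z x b False / k) =
    (marg x b True + marg x b False) - (marg x b True * z x b True + marg x b False * z x b False) / k" for k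
    by (simp add: algebra_simps add_divide_distrib)
  then show ?thesis using True unfolding kern_def marg_sum[OF x] marg_z by simp
next
  case False
  have "marg x b True * (1 - k / z x b False) + marg x b False * (1 - k / z x b True) =
    (marg x b True + marg x b False) - k * (marg x b True / z x b False + marg x b False / z x b True)" for k
    by (simp add: algebra_simps)
  then show ?thesis using False unfolding kern_def marg_sum[OF x] marg_inv_z[OF x] by simp
qed

text \<open>The law as marginals times edge densities. This form does not refer to the root, so any
  node can be summed out in the same way.\<close>

definition qlaw :: "'v param \<Rightarrow> ('v \<Rightarrow> bool) \<Rightarrow> real" where
  "qlaw x \<alpha> = (\<Prod>v\<in>UNIV. marg x v (\<alpha> v)) *
     (\<Prod>e\<in>F. kern x (fst e) (\<alpha> (fst e)) (snd e) (\<alpha> (snd e)))"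

lemma factor_Psi:
  assumes x: "admissible x"
  shows "factor (Psi x) v \<alpha> t = marg x v t *
    (if v \<noteq> r \<and> (pa E v, v) \<in> F then kern x (pa E v) (\<alpha> (pa E v)) v t else 1)"
proof (cases "v \<noteq> r \<and> (pa E v, v) \<in> F")
  case True
  then have "fadj (pa E v) v" unfolding fadj_def by blast
  from kern_norm[OF x this, of "\<alpha> (pa E v)"] True show ?thesis
    unfolding factor_def cond_prob_def Psi_def by (cases t) auto
next
  case False
  then show ?thesis using marg_sum[OF x, of v] unfolding factor_def cond_prob_def Psi_def
    by (cases t) auto
qed

lemma law_Psi:
  assumes x: "admissible x"
  shows "law (Psi x) \<alpha> = qlaw x \<alpha>"
proof -
  let ?K = "\<lambda>e. kern x (fst e) (\<alpha> (fst e)) (snd e) (\<alpha> (snd e))"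
  let ?V = "{v. v \<noteq> r \<and> (pa E v, v) \<in> F}"
  have "(\<Prod>v\<in>UNIV. if v \<noteq> r \<and> (pa E v, v) \<in> F then kern x (pa E v) (\<alpha> (pa E v)) v (\<alpha> v) else 1) =
     (\<Prod>v\<in>?V. kern x (pa E v) (\<alpha> (pa E v)) v (\<alpha> v))"
    by (rule prod.mono_neutral_cong_right) auto
  also have "\<dots> = prod ?K F"
  proof (rule prod.reindex_bij_witness[of _ snd "\<lambda>v. (pa E v, v)"])
    show "(pa E (snd e), snd e) = e" "snd e \<in> ?V" if "e \<in> F" for e
    proof -
      have "(fst e, snd e) \<in> E" using that F_E by auto
      then show "(pa E (snd e), snd e) = e" using pa_eq by (metis prod.collapse)
      then show "snd e \<in> ?V" using that edge_not_root[OF \<open>(fst e, snd e) \<in> E\<close>] by simp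
    qed
  qed auto
  finally show ?thesis unfolding law_def qlaw_def factor_Psi[OF x] prod.distrib by simp
qed

definition rest :: "'v \<Rightarrow> 'v param \<Rightarrow> ('v \<Rightarrow> bool) \<Rightarrow> real" where
  "rest v x \<alpha> = (\<Prod>w\<in>UNIV - {v}. marg x w (\<alpha> w)) *
     (\<Prod>e\<in>F - {e \<in> F. v = fst e \<or> v = snd e}. kern x (fst e) (\<alpha> (fst e)) (snd e) (\<alpha> (snd e)))"

lemma qlaw_upd:
  "qlaw x (\<alpha>(v := t)) = rest v x \<alpha> * (marg x v t * (\<Prod>u | fadj v u. kern x v t u (\<alpha> u)))"
proof -
  let ?\<beta> = "\<alpha>(v := t)"
  let ?K = "\<lambda>\<alpha> e. kern x (fst e) (\<alpha> (fst e)) (snd e) (\<alpha> (snd e))"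
  let ?I = "{e \<in> F. v = fst e \<or> v = snd e}"
  have "(\<Prod>w\<in>UNIV. marg x w (?\<beta> w)) = marg x v t * (\<Prod>w\<in>UNIV - {v}. marg x w (?\<beta> w))"
    by (subst prod.remove[of _ v]) auto
  also have "(\<Prod>w\<in>UNIV - {v}. marg x w (?\<beta> w)) = (\<Prod>w\<in>UNIV - {v}. marg x w (\<alpha> w))"
    by (rule prod.cong) auto
  finally have 1: "(\<Prod>w\<in>UNIV. marg x w (?\<beta> w)) = marg x v t * (\<Prod>w\<in>UNIV - {v}. marg x w (\<alpha> w))" .
  have "prod (?K ?\<beta>) F = prod (?K ?\<beta>) (F - ?I) * prod (?K ?\<beta>) ?I"
    by (rule prod.subset_diff) auto
  moreover have "prod (?K ?\<beta>) (F - ?I) = prod (?K \<alpha>) (F - ?I)" by (rule prod.cong) auto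
  moreover have "prod (?K ?\<beta>) ?I = (\<Prod>u | fadj v u. kern x v t u (\<alpha> u))"
    unfolding inc_edge_inc(1)[symmetric]
  proof (subst prod.reindex[OF inc_edge_inc(2)], rule prod.cong[OF refl])
    fix u assume "u \<in> {u. fadj v u}"
    then have u: "fadj v u" by simp
    then have "u \<noteq> v" using adj_neq fadj_adj by blast
    then show "(?K ?\<beta> \<circ> inc_edge v) u = kern x v t u (\<alpha> u)"
      using kern_sym[OF u] by (auto simp: inc_edge_def)
  qed
  ultimately show ?thesis unfolding qlaw_def rest_def 1 by simp
qed

text \<open>The right-hand side is the \<open>kern\<close> of a fictitious edge joining the two
  neighbours of \<open>v\<close>; the values at \<open>v\<close> have cancelled. This is why the
  coordinates at a degree-two node are free.\<close>

lemma sum_deg2: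
  assumes x: "admissible x" and v: "v \<in> deg2"
  shows "(\<Sum>t\<in>UNIV. marg x v t * (\<Prod>u | fadj v u. kern x v t u (\<alpha> u))) =
    1 - z x (fn v) (\<alpha> (fn v)) / z x (nn v) (\<not> \<alpha> (nn v))"
proof -
  note n = deg2_nbrs[OF v]
  define A B where "A = 1 / z x (nn v) (\<not> \<alpha> (nn v))" and "B = z x (fn v) (\<alpha> (fn v))"
  have nn: "\<not> near (nn v) v" using n(1) near_iff near_fadj by blast
  have p: "(\<Prod>u | fadj v u. kern x v t u (\<alpha> u)) = (1 - z x v t * A) * (1 - B / z x v (\<not> t))" for t
    unfolding n(4) using n(2,3) nn by (simp add: kern_def A_def B_def)
  define a and b where "a = z x v True" and "b = z x v False"
  have ab: "a \<noteq> 0" "b \<noteq> 0" "a \<noteq> b" using admissible_neq[OF x, of v] admissible_neq(1)[OF x, of v True]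
    unfolding a_def b_def by auto
  have "- b / (a - b) * ((1 - a * A) * (1 - B / b)) + a / (a - b) * ((1 - b * A) * (1 - B / a)) =
     (- ((1 - a * A) * (b - B)) + (1 - b * A) * (a - B)) / (a - b)"
  proof -
    have "b * (1 - B / b) = b - B" "a * (1 - B / a) = a - B" using ab by (simp_all add: right_diff_distrib)
    moreover have "- b / (a - b) * ((1 - a * A) * (1 - B / b)) = - ((1 - a * A) * (b * (1 - B / b))) / (a - b)"
      "a / (a - b) * ((1 - b * A) * (1 - B / a)) = (1 - b * A) * (a * (1 - B / a)) / (a - b)" by simp_all
    ultimately show ?thesis by (simp only: add_divide_distrib)
  qed
  also have "- ((1 - a * A) * (b - B)) + (1 - b * A) * (a - B) = (a - b) * (1 - B * A)" by algebra
  finally have "- b / (a - b) * ((1 - a * A) * (1 - B / b)) + a / (a - b) * ((1 - b * A) * (1 - B / a)) = 1 - B * A"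
    using ab by simp
  then show ?thesis unfolding p UNIV_bool
    by (simp add: marg_def add.commute flip: a_def b_def) (simp add: A_def B_def)
qed

definition leaf_sum :: "'v param \<Rightarrow> ('n \<Rightarrow> bool) \<Rightarrow> real" where
  "leaf_sum x \<beta> = (\<Sum>\<alpha>\<in>UNIV. of_bool (\<alpha> \<circ> leaf = \<beta>) * qlaw x \<alpha>)"

lemma f_T_Psi:
  assumes "admissible x"
  shows "f_T E r leaf (Psi x) \<beta> = leaf_sum x \<beta>"
  unfolding f_T_law leaf_sum_def law_Psi[OF assms]
  by (rule sum.mono_neutral_cong_left) auto

text \<open>Since \<open>v\<close> is not observed, only the sum over its two states matters. At
  degree two this sum does not involve the values at \<open>v\<close>; at other nodes exchanging
  them merely permutes the two summands.\<close>

lemma leaf_sum_step: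
  assumes x: "admissible x" and y: "admissible y" and v: "v \<notin> range leaf"
    and off: "\<And>w s. w \<noteq> v \<Longrightarrow> x $ (w, s) = y $ (w, s)"
    and at: "v \<in> deg2 \<or> (\<forall>s. x $ (v, s) = y $ (v, \<not> s))"
  shows "leaf_sum x \<beta> = leaf_sum y \<beta>"
proof -
  have zo: "z x w = z y w" "marg x w = marg y w" if "w \<noteq> v" for w
    using off[OF that] unfolding z_def[abs_def] marg_def[abs_def] by auto
  have ko: "kern x a s b t = kern y a s b t" if "a \<noteq> v" "b \<noteq> v" for a b s t
    using zo that unfolding kern_def by auto
  have rest: "rest v x \<alpha> = rest v y \<alpha>" for \<alpha>
    unfolding rest_def using zo ko by (auto intro!: arg_cong2[of _ _ _ _ "(*)"] prod.cong)
  have eq: "(\<Sum>t\<in>UNIV. qlaw x (\<alpha>(v := t))) = (\<Sum>t\<in>UNIV. qlaw y (\<alpha>(v := t)))" for \<alpha>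
  proof (cases "v \<in> deg2")
    case True
    have "nn v \<noteq> v" "fn v \<noteq> v" using deg2_nbrs[OF True] near_fadj fadj_adj adj_neq by metis+
    then show ?thesis unfolding qlaw_upd sum_distrib_left[symmetric] sum_deg2[OF x True] sum_deg2[OF y True]
      using zo rest by simp
  next
    case False
    then have sw: "z x v s = z y v (\<not> s)" for s using at unfolding z_def by auto
    have "marg x v t = marg y v (\<not> t)" for t
    proof -
      have "- p / (q - p) = p / (p - q)" for p q :: real
        by (metis minus_diff_eq minus_divide_divide)
      moreover have "q / (q - p) = - q / (p - q)" for p q :: real
        by (metis minus_diff_eq minus_divide_divide minus_minus)
      ultimately show ?thesis unfolding marg_def sw by (cases t) auto
    qed
    moreover have "kern x v t u s = kern y v (\<not> t) u s" if "u \<noteq> v" for u t s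
      using zo[OF that] sw unfolding kern_def by auto
    then have "(\<Prod>u | fadj v u. kern x v t u (\<alpha> u)) = (\<Prod>u | fadj v u. kern y v (\<not> t) u (\<alpha> u))" for t
      using adj_neq[OF fadj_adj] by (intro prod.cong refl) (metis mem_Collect_eq)
    ultimately have "qlaw x (\<alpha>(v := t)) = qlaw y (\<alpha>(v := \<not> t))" for t
      unfolding qlaw_upd rest by simp
    then show ?thesis by (simp add: UNIV_bool add.commute)
  qed
  have ind: "(\<alpha>(v := t)) \<circ> leaf = \<alpha> \<circ> leaf" for \<alpha> t using v by (auto simp: fun_eq_iff)
  have "2 * leaf_sum x \<beta> = 2 * leaf_sum y \<beta>"
    unfolding leaf_sum_def sum_flip[of _ v, symmetric] ind sum_distrib_left[symmetric] eq ..
  then show ?thesis by simp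
qed

lemma leaf_sum_eq:
  assumes x: "admissible x" and y: "admissible y"
    and lf: "\<And>v s. v \<in> range leaf \<Longrightarrow> x $ (v, s) = y $ (v, s)"
    and inner: "\<And>v. v \<notin> range leaf \<Longrightarrow> v \<notin> deg2 \<Longrightarrow>
      (\<forall>s. x $ (v, s) = y $ (v, s)) \<or> (\<forall>s. x $ (v, s) = y $ (v, \<not> s))"
  shows "leaf_sum x \<beta> = leaf_sum y \<beta>"
proof -
  \<comment> \<open>The nodes pass from \<open>y\<close> to \<open>x\<close> one at a time. The
    intermediate vectors stay admissible because admissibility is a condition on each node
    separately.\<close>
  define m where "m S = (\<chi> j. if fst j \<in> S then x $ j else y $ j)" for S
  have adm: "admissible (m S)" for S
    using x y unfolding admissible_def z_def m_def by auto
  have "leaf_sum (m S) \<beta> = leaf_sum y \<beta>" if "finite S" for S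
    using that
  proof (induction S rule: finite_induct)
    case empty
    have "m {} = y" by (simp add: m_def vec_eq_iff)
    then show ?case by simp
  next
    case (insert v S)
    have off: "m (insert v S) $ (w, s) = m S $ (w, s)" if "w \<noteq> v" for w s
      using that by (simp add: m_def)
    have at: "m (insert v S) $ (v, s) = x $ (v, s)" "m S $ (v, s) = y $ (v, s)" for s
      using insert by (simp_all add: m_def)
    show ?case
    proof (cases "\<forall>s. x $ (v, s) = y $ (v, s)")
      case True
      then have "m (insert v S) $ (w, s) = m S $ (w, s)" for w s using off at by (cases "w = v") auto
      then have "m (insert v S) = m S" by (simp add: vec_eq_iff)
      then show ?thesis using insert by simp
    next
      case False
      then have v: "v \<notin> range leaf" using lf by blast
      have "v \<in> deg2 \<or> (\<forall>s. m (insert v S) $ (v, s) = m S $ (v, \<not> s))"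
        using inner[OF v] False at by auto
      then show ?thesis using leaf_sum_step[OF adm adm v off] insert.IH by simp
    qed
  qed
  from this[of UNIV] show ?thesis by (simp add: m_def)
qed

text \<open>The parameters determine the marginals from the root downwards and then the kernels on
  forest edges. A kernel fixes a ratio of values at adjacent nodes, and the common values at the
  representative leaf fix the scale of the whole component.\<close>

lemma Psi_inj:
  assumes x: "admissible x" and y: "admissible y" and eq: "Psi x = Psi y"
    and lf: "\<And>v s. v \<in> range leaf \<Longrightarrow> x $ (v, s) = y $ (v, s)"
  shows "x = y"
proof -
  have mF: "marg w v False = 1 - marg w v True" if "admissible w" for w v
    using marg_sum[OF that, of v] by simp
  have mE: "marg w u True * Psi w $ (v, True) + marg w u False * Psi w $ (v, False) = marg w v True"
    if w: "admissible w" and uv: "(u, v) \<in> E" for w u v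
  proof (cases "(u, v) \<in> F")
    case True
    then have "fadj v u" unfolding fadj_def by blast
    then have "marg w u True * kern w u True v True + marg w u False * kern w u False v True = 1"
      using kern_norm[OF w, of v u True] kern_sym[of v u] by simp
    then have "marg w v True * (marg w u True * kern w u True v True + marg w u False * kern w u False v True) = marg w v True"
      by simp
    then show ?thesis using True edge_not_root[OF uv] pa_eq[OF uv] unfolding Psi_def
      by (simp add: algebra_simps)
  next
    case False
    have "marg w u True * marg w v True + marg w u False * marg w v True = marg w v True"
      using marg_sum[OF w, of u] by (simp flip: distrib_right)
    then show ?thesis using False edge_not_root[OF uv] pa_eq[OF uv] unfolding Psi_def by simp
  qed
  have mT: "marg x v True = marg y v True" for v
    using reachable[of v]
  proof (induction rule: rtrancl_induct)
    case base
    have "Psi x $ (r, False) = Psi y $ (r, False)" using eq by simp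
    then show ?case unfolding Psi_def by simp
  next
    case (step u v)
    then show ?case using mE[OF x step(2)] mE[OF y step(2)] unfolding mF[OF x] mF[OF y] eq by simp
  qed
  then have m: "marg x v s = marg y v s" for v s using mF[OF x] mF[OF y] by (cases s) auto
  have kF: "kern x u s v t = kern y u s v t" if uv: "(u, v) \<in> F" for u v s t
  proof -
    have E: "(u, v) \<in> E" using uv F_E by blast
    have fa: "fadj u v" using uv unfolding fadj_def by blast
    have "Psi x $ (v, s) = Psi y $ (v, s)" using eq by simp
    then have T: "kern x u s v True = kern y u s v True"
      using uv edge_not_root[OF E] pa_eq[OF E] m marg_pos[OF y, of v True] unfolding Psi_def by simp
    have "marg x v False * kern x u s v False = marg y v False * kern y u s v False"
      using kern_norm[OF x fa, of s] kern_norm[OF y fa, of s] unfolding T m by linarith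
    then have "kern x u s v False = kern y u s v False" using m marg_pos[OF y, of v False] by simp
    with T show ?thesis by (cases t) auto
  qed
  have k: "kern x a s b t = kern y a s b t" if "fadj a b" for a b s t
    using that kF[of a b] kF[of b a] kern_sym[OF that] unfolding fadj_def by metis
  have "\<forall>s. z x v s = z y v s" for v
  proof -
    have "(rho v, v) \<in> conn" using rho_conn conn_sym by blast
    then show ?thesis
    proof (induction rule: rtrancl_induct)
      case base
      show ?case using lf[of "rho v"] unfolding z_def by simp
    next
      case (step a b)
      have ab: "fadj a b" using step(2) unfolding fadj_def by auto
      show ?case
      proof
        fix s
        show "z x b s = z y b s"
        proof (cases "near b a")
          case True
          then have "z x b s / z x a True = z y b s / z y a True"
            using k[OF ab, of False s] unfolding kern_def by simp
          then show ?thesis using step.IH admissible_neq(1)[OF y, of a True] by simp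
        next
          case False
          then have "z x a True / z x b s = z y a True / z y b s"
            using k[OF ab, of True "\<not> s"] unfolding kern_def by simp
          then show ?thesis
            using step.IH admissible_neq(1)[OF y, of a True] admissible_neq(1)[OF y, of b s]
              admissible_neq(1)[OF x, of b s] by (simp add: frac_eq_eq)
        qed
      qed
    qed
  qed
  then show ?thesis by (auto simp: vec_eq_iff z_def)
qed

section \<open>Coordinates determined by \<open>p\<close>, exactly or up to exchanging
  states\<close>

lemma Xi_leaf:
  assumes "\<theta> \<in> fib" "\<theta>' \<in> fib"
  shows "Xi \<theta> $ (leaf i, s) = Xi \<theta>' $ (leaf i, s)"
proof -
  let ?h = "\<lambda>x. of_bool (x (rep (leaf i))) * of_bool (x i = s) :: real"
  have 1: "ex \<theta> (\<lambda>\<alpha>. X (rep (leaf i)) \<alpha> * ind (leaf i) s \<alpha>) = measure_pmf.expectation p ?h" if "\<theta> \<in> fib" for \<theta>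
    using fib_expectation[OF that, of ?h] unfolding ind_def by simp
  have 2: "pr \<theta> (leaf i) s = measure_pmf.expectation p (\<lambda>x. of_bool (x i = s))" if "\<theta> \<in> fib" for \<theta>
    using fib_expectation[OF that, of "\<lambda>x. of_bool (x i = s)"] unfolding ind_def[abs_def] by simp
  show ?thesis unfolding Xi_def using 1[OF assms(1)] 1[OF assms(2)] 2[OF assms(1)] 2[OF assms(2)] by simp
qed

text \<open>
  For three leaves in different branches at \<open>v\<close>, the centred second and third moments determine
  the sum and the product of the two values of \<open>z\<close> at \<open>v\<close>.
\<close>

lemma branch_values:
  assumes v: "v \<notin> range leaf" "v \<notin> deg2"
  obtains S P where "\<And>\<theta>. \<theta> \<in> fib \<Longrightarrow> z (Xi \<theta>) v True + z (Xi \<theta>) v False = S \<and>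
     z (Xi \<theta>) v True * z (Xi \<theta>) v False = P"
proof -
  obtain w1 w2 where w: "near w1 v" "near w2 v" "w1 \<noteq> w2" using branch_nbrs[OF v] .
  have fa: "fadj v w1" "fadj v w2" using w near_fadj fadj_sym by blast+
  note ad = fadj_adj[OF fa(1)] fadj_adj[OF fa(2)]
  obtain i where i: "leaf i \<in> side v w1" "(w1, leaf i) \<in> conn" using leaf_beyond[OF fa(1)] by blast
  obtain j where j: "leaf j \<in> side v w2" "(w2, leaf j) \<in> conn" using leaf_beyond[OF fa(2)] by blast
  have ji: "leaf j \<notin> side v w1" using side_unique[OF ad _ j(1)] w(3) by blast
  have rho: "rho v \<notin> side v w1" "rho v \<notin> side v w2"
    using near_iff[OF fa(1)] near_iff[OF fa(2)] w fa unfolding near_def by auto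
  have con: "(rho v, leaf i) \<in> conn" "(rho v, leaf j) \<in> conn"
    using i(2) j(2) fadj_conn[OF fa(1)] fadj_conn[OF fa(2)] rho_conn[of v] conn_sym by (meson rtrancl_trans)+
  define l where "l k = leaf_mean p k" for k
  let ?R = "\<lambda>\<alpha>. X (rep v) \<alpha> - l (rep v)" and ?I = "\<lambda>\<alpha>. X i \<alpha> - l i" and ?J = "\<lambda>\<alpha>. X j \<alpha> - l j"
  let ?hR = "\<lambda>x. of_bool (x (rep v)) - l (rep v)" and ?hI = "\<lambda>x. of_bool (x i) - l i"
    and ?hJ = "\<lambda>x. of_bool (x j) - l j"
  define MRI where "MRI = measure_pmf.expectation p (\<lambda>x. ?hR x * ?hI x)"
  define MRJ where "MRJ = measure_pmf.expectation p (\<lambda>x. ?hR x * ?hJ x)"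
  define MJI where "MJI = measure_pmf.expectation p (\<lambda>x. ?hJ x * ?hI x)"
  define M3 where "M3 = measure_pmf.expectation p (\<lambda>x. (?hR x * ?hJ x) * ?hI x)"
  have "z (Xi \<theta>) v True + z (Xi \<theta>) v False = M3 / MJI \<and> z (Xi \<theta>) v True * z (Xi \<theta>) v False = - (MRI * MRJ / MJI)"
    if \<theta>: "\<theta> \<in> fib" for \<theta>
  proof -
    define c where "c f s = ex \<theta> (\<lambda>\<alpha>. f \<alpha> * ind v s \<alpha>)" for f s
    define q where "q s = pr \<theta> v s" for s
    have qnz: "q s \<noteq> 0" for s unfolding q_def by (rule pr_neq_0[OF \<theta>])
    have cen: "c (\<lambda>\<alpha>. X k \<alpha> - l k) True + c (\<lambda>\<alpha>. X k \<alpha> - l k) False = 0" for k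
      unfolding c_def ex_split[symmetric] using ex_diff[of \<theta> "X k" "\<lambda>\<alpha>. l k"] fib_mean[OF \<theta>]
      by (simp add: ex_const l_def)
    have dR: "depends_on (- side v w1) ?R" "depends_on (- side v w2) ?R"
      using rho by (auto intro!: depends_on_diff depends_on_ind depends_on_const)
    have dJ: "depends_on (- side v w1) ?J" "depends_on (insert v (side v w2)) ?J"
      using ji j by (auto intro!: depends_on_diff depends_on_ind depends_on_const)
    have dI: "depends_on (insert v (side v w1)) ?I"
      using i by (auto intro!: depends_on_diff depends_on_ind depends_on_const)
    have sep: "c (\<lambda>\<alpha>. f \<alpha> * g \<alpha>) s = c f s * c g s / q s"
      if "adj v w" "depends_on (- side v w) f" "depends_on (insert v (side v w)) g" for f g w s
      using cond_indep[OF that, of \<theta> s] qnz[of s] unfolding c_def q_def by (simp add: field_simps)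
    have exc: "ex \<theta> f = c f True + c f False" for f unfolding c_def by (rule ex_split)
    have RI: "MRI = c ?R True * c ?I True / q True + c ?R False * c ?I False / q False"
      unfolding MRI_def fib_expectation[OF \<theta>, symmetric] sep[OF ad(1) dR(1) dI, symmetric] exc[symmetric]
      by (simp add: ind_def)
    have RJ: "MRJ = c ?R True * c ?J True / q True + c ?R False * c ?J False / q False"
      unfolding MRJ_def fib_expectation[OF \<theta>, symmetric] sep[OF ad(2) dR(2) dJ(2), symmetric] exc[symmetric]
      by (simp add: ind_def)
    have JI: "MJI = c ?J True * c ?I True / q True + c ?J False * c ?I False / q False"
      unfolding MJI_def fib_expectation[OF \<theta>, symmetric] sep[OF ad(1) dJ(1) dI, symmetric] exc[symmetric]
      by (simp add: ind_def)
    have RJI: "M3 = c (\<lambda>\<alpha>. ?R \<alpha> * ?J \<alpha>) True * c ?I True / q True + c (\<lambda>\<alpha>. ?R \<alpha> * ?J \<alpha>) False * c ?I False / q False"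
      unfolding M3_def fib_expectation[OF \<theta>, symmetric]
        sep[OF ad(1) depends_on_mult[OF dR(1) dJ(1)] dI, symmetric] exc[symmetric]
      by (simp add: ind_def)
    define a and b where "a = z (Xi \<theta>) v True" and "b = z (Xi \<theta>) v False"
    have cR: "c ?R True = a * q True" "c ?R False = b * q False"
      unfolding a_def b_def q_def z_Xi_pr[OF \<theta>] c_def l_def lam_def by simp_all
    \<comment> \<open>A centred leaf has opposite partial expectations on the two states of Y_v, so
      one unknown number per leaf remains. These numbers cancel in both quotients of
      moments.\<close>
    define k1 and k2 where "k1 = c ?I True" and "k2 = c ?J True"
    have cI: "c ?I True = k1" "c ?I False = - k1" and cJ: "c ?J True = k2" "c ?J False = - k2"
      using cen[of i] cen[of j] unfolding k1_def k2_def by simp_all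
    have M: "MRI = (a - b) * k1" "MRJ = (a - b) * k2"
      unfolding RI RJ cR cI cJ using qnz by (simp_all add: algebra_simps)
    have M': "MJI = k1 * k2 * (1 / q True + 1 / q False)" "M3 = k1 * k2 * (a / q True + b / q False)"
      unfolding JI RJI sep[OF ad(2) dR(2) dJ(2)] cR cI cJ using qnz by (simp_all add: algebra_simps)
    have qa: "q True = - b / (a - b)" "q False = a / (a - b)"
      using marg_Xi[OF \<theta>, of v True] marg_Xi[OF \<theta>, of v False] unfolding q_def marg_def a_def b_def by simp_all
    have ab: "a \<noteq> b" "a \<noteq> 0" "b \<noteq> 0"
      using admissible_neq[OF admissible_Xi[OF \<theta>], of v] admissible_neq(1)[OF admissible_Xi[OF \<theta>], of v True]
      unfolding a_def b_def by auto
    have "1 / q True + 1 / q False = - ((a - b) ^ 2 / (a * b))"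
      "a / q True + b / q False = - ((a - b) ^ 2 / (a * b)) * (a + b)"
      unfolding qa using ab by (simp_all add: field_simps power2_eq_square)
    then have M'': "MJI = - (k1 * k2 * (a - b) ^ 2 / (a * b))" "M3 = MJI * (a + b)"
      unfolding M' by simp_all
    have "MRI = leaf_cov p (rep v) i" "MRJ = leaf_cov p (rep v) j"
      unfolding MRI_def MRJ_def leaf_cov_def l_def by simp_all
    then have "MRI \<noteq> 0" "MRJ \<noteq> 0" using conn_cov[OF \<theta> con(1)] conn_cov[OF \<theta> con(2)] fib_cov[OF \<theta>] by auto
    then have k: "k1 \<noteq> 0" "k2 \<noteq> 0" unfolding M by auto
    then have "MJI \<noteq> 0" unfolding M'' using ab by simp
    moreover have "MRI * MRJ = - (a * b) * MJI" unfolding M M''(1) using ab by (simp add: power2_eq_square)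
    ultimately show ?thesis using M''(2) unfolding a_def[symmetric] b_def[symmetric] by simp
  qed
  then show ?thesis using that by blast
qed

lemma Xi_branch:
  assumes "\<theta> \<in> fib" "\<theta>' \<in> fib" and v: "v \<notin> range leaf" "v \<notin> deg2"
  shows "(\<forall>s. Xi \<theta> $ (v, s) = Xi \<theta>' $ (v, s)) \<or> (\<forall>s. Xi \<theta> $ (v, s) = Xi \<theta>' $ (v, \<not> s))"
proof -
  obtain S P where SP: "\<And>\<theta>. \<theta> \<in> fib \<Longrightarrow> z (Xi \<theta>) v True + z (Xi \<theta>) v False = S \<and>
     z (Xi \<theta>) v True * z (Xi \<theta>) v False = P" using branch_values[OF v] by blast
  define a b a' b' where "a = z (Xi \<theta>) v True" "b = z (Xi \<theta>) v False"
    "a' = z (Xi \<theta>') v True" "b' = z (Xi \<theta>') v False"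
  note d = this
  have s: "a + b = a' + b'" "a * b = a' * b'" using SP[OF assms(1)] SP[OF assms(2)] unfolding d by auto
  \<comment> \<open>Both pairs are the roots of one quadratic polynomial.\<close>
  then have "(a - a') * (a - b') = 0" by algebra
  then have "(a = a' \<and> b = b') \<or> (a = b' \<and> b = a')" using s(1) by auto
  then show ?thesis
  proof
    assume "a = a' \<and> b = b'"
    then have "Xi \<theta> $ (v, s) = Xi \<theta>' $ (v, s)" for s unfolding d z_def by (cases s) auto
    then show ?thesis by blast
  next
    assume "a = b' \<and> b = a'"
    then have "Xi \<theta> $ (v, s) = Xi \<theta>' $ (v, \<not> s)" for s unfolding d z_def by (cases s) auto
    then show ?thesis by blast
  qed
qed

end

section \<open>The fiber as a union of polyhedra\<close>

lemma card_fixed_on: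
  fixes g :: "'v::finite \<Rightarrow> bool"
  shows "card {\<sigma>. \<forall>v\<in>R. \<sigma> v = g v} = 2 ^ (CARD('v) - card R)"
proof -
  have "bij_betw (\<lambda>\<sigma>. {v \<in> - R. \<sigma> v}) {\<sigma>. \<forall>v\<in>R. \<sigma> v = g v} (Pow (- R))"
    by (rule bij_betwI[where g = "\<lambda>A v. if v \<in> R then g v else v \<in> A"]) (auto simp: fun_eq_iff)
  then have "card {\<sigma>. \<forall>v\<in>R. \<sigma> v = g v} = 2 ^ card (- R)"
    by (simp add: bij_betw_same_card card_Pow)
  then show ?thesis by (simp add: Compl_eq_Diff_UNIV card_Diff_subset)
qed

section \<open>Smoothness of the coordinate changes, and labellings of the states\<close>

context rtree
begin

lemma smooth_ex: "smooth_on_open UNIV (\<lambda>\<theta>. ex \<theta> f)"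
proof -
  have "smooth_on_open UNIV (\<lambda>\<theta> :: 'v param. factor \<theta> v \<alpha> t)" for v \<alpha> t
    unfolding factor_def cond_prob_def by (cases t) (auto intro!: smooth_intros)
  then show ?thesis unfolding ex_def law_def by (intro smooth_intros open_UNIV)
qed

end

context tree_fiber
begin

lemma smooth_Xi: "smooth_map_on fib Xi"
proof (rule smooth_map_onI)
  let ?U = "\<Inter>v\<in>UNIV. \<Inter>s\<in>UNIV. {\<theta>. pr \<theta> v s \<noteq> 0}"
  have "continuous_on UNIV (\<lambda>\<theta>. pr \<theta> v s)" for v s
    using smooth_on_open_imp_continuous_on smooth_ex by blast
  then show U: "open ?U" by (intro open_INT open_Collect_neq finite continuous_on_const ballI) auto
  show "fib \<subseteq> ?U" using pr_neq_0 by auto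
  have 1: "smooth_on_open ?U (\<lambda>\<theta>. ex \<theta> f)" for f
    using smooth_on_open_subset[OF smooth_ex subset_UNIV] .
  show "smooth_on_open ?U Xi"
    unfolding Xi_def[abs_def] by (intro smooth_on_open_vec U smooth_on_open_divide 1) auto
qed

lemma smooth_z: "open U \<Longrightarrow> smooth_on_open U (\<lambda>x. z x v s)"
  unfolding z_def by (intro smooth_intros)

lemma open_admissible: "open {x. admissible x}"
proof -
  have "continuous_on UNIV (\<lambda>x. z x v s)" for v s
    using smooth_on_open_imp_continuous_on smooth_z open_UNIV by blast
  then have "open (\<Inter>v\<in>UNIV. {x. z x v True * z x v False < 0})"
    by (intro open_INT open_Collect_less finite continuous_on_const continuous_on_mult ballI) auto
  moreover have "{x. admissible x} = (\<Inter>v\<in>UNIV. {x. z x v True * z x v False < 0})"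
    unfolding admissible_def by auto
  ultimately show ?thesis by simp
qed

lemma smooth_Psi: "smooth_on_open {x. admissible x} Psi"
proof -
  let ?U = "{x. admissible x}"
  note U = open_admissible
  have m: "smooth_on_open ?U (\<lambda>x. marg x v s)" for v s
    unfolding marg_def using admissible_neq(2)
    by (cases s) (auto intro!: smooth_on_open_divide smooth_on_open_minus smooth_on_open_diff smooth_z U)
  have k: "smooth_on_open ?U (\<lambda>x. kern x a s b t)" for a s b t
    unfolding kern_def using admissible_neq(1)
    by (cases "near b a")
      (auto intro!: smooth_on_open_divide smooth_on_open_const smooth_on_open_diff smooth_z U)
  have "smooth_on_open ?U (\<lambda>x. if fst j = r then (if snd j then 0 else marg x r True)
     else if (pa E (fst j), fst j) \<in> F
     then marg x (fst j) True * kern x (pa E (fst j)) (snd j) (fst j) True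
     else marg x (fst j) True)" for j
    by (cases "fst j = r"; cases "snd j"; cases "(pa E (fst j), fst j) \<in> F")
      (simp_all add: smooth_on_open_const m smooth_on_open_mult[OF U m k])
  then show ?thesis unfolding Psi_def[abs_def] by (intro smooth_on_open_vec U)
qed

text \<open>
  \<open>srt\<close> forgets which state of an inner node is called \<open>1\<close>: it puts the larger of the two values
  at a node into the coordinate \<open>True\<close>.  The lost information is \<open>sgn\<close>, and \<open>relabel\<close> restores it.
\<close>

definition srt :: "'v param \<Rightarrow> 'v param" where
  "srt x = (\<chi> j. if snd j then max (x $ (fst j, True)) (x $ (fst j, False))
     else min (x $ (fst j, True)) (x $ (fst j, False)))"

definition sgn :: "'v param \<Rightarrow> 'v \<Rightarrow> bool" where
  "sgn x v \<longleftrightarrow> x $ (v, False) < x $ (v, True)"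

definition relabel :: "('v \<Rightarrow> bool) \<Rightarrow> 'v param \<Rightarrow> 'v param" where
  "relabel \<sigma> y = (\<chi> j. y $ (fst j, snd j = \<sigma> (fst j)))"

lemma srt_nth: "srt x $ (v, True) = max (x $ (v, True)) (x $ (v, False))"
  "srt x $ (v, False) = min (x $ (v, True)) (x $ (v, False))"
  unfolding srt_def by simp_all

lemma relabel_nth: "relabel \<sigma> y $ (v, s) = y $ (v, s = \<sigma> v)"
  unfolding relabel_def by simp

lemma relabel_relabel: "relabel \<sigma> (relabel \<sigma> y) = y"
  by (auto simp: vec_eq_iff relabel_nth intro!: arg_cong[of _ _ "($) y"])

lemma linear_relabel: "linear (relabel \<sigma>)"
  by (rule linearI) (auto simp: relabel_def vec_eq_iff)

lemma relabel_srt: "relabel (sgn x) (srt x) = x"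
proof -
  have "relabel (sgn x) (srt x) $ (v, s) = x $ (v, s)" for v s
    unfolding relabel_nth sgn_def
    by (cases "x $ (v, False) < x $ (v, True)"; cases s) (simp_all add: srt_nth max_def min_def)
  then show ?thesis by (simp add: vec_eq_iff)
qed

lemma joint_nonneg: "\<theta> \<in> fib \<Longrightarrow> 0 \<le> ex \<theta> (\<lambda>\<alpha>. ind w t \<alpha> * ind v s \<alpha>)"
  by (rule ex_nonneg[OF fib_Theta]) (auto simp: ind_def)

text \<open>By \<open>z_Xi_near\<close> the values at the farther node \<open>w\<close> are weighted
  means of those at \<open>v\<close>, so they lie between them, and strictly so when all weights are
  positive.\<close>

lemma Xi_hull:
  assumes \<theta>: "\<theta> \<in> fib" and wv: "near w v"
  shows "srt (Xi \<theta>) $ (w, True) \<le> srt (Xi \<theta>) $ (v, True)" (is ?A)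
    and "srt (Xi \<theta>) $ (v, False) \<le> srt (Xi \<theta>) $ (w, False)" (is ?B)
    and "(\<And>t s. 0 < ex \<theta> (\<lambda>\<alpha>. ind w t \<alpha> * ind v s \<alpha>)) \<Longrightarrow>
      srt (Xi \<theta>) $ (w, True) < srt (Xi \<theta>) $ (v, True) \<and>
      srt (Xi \<theta>) $ (v, False) < srt (Xi \<theta>) $ (w, False)"
proof -
  let ?z = "z (Xi \<theta>)"
  define q where "q t s = ex \<theta> (\<lambda>\<alpha>. ind w t \<alpha> * ind v s \<alpha>)" for t s
  define M m where "M = max (?z v True) (?z v False)" and "m = min (?z v True) (?z v False)"
  have lam: "lam w = lam v" using rep_fadj near_fadj[OF wv] unfolding lam_def by simp
  have q: "pr \<theta> w t = q t True + q t False" for t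
    unfolding q_def using ex_split[of \<theta> "ind w t" v] by simp
  have zq: "?z w t * (q t True + q t False) = ?z v True * q t True + ?z v False * q t False" for t
    using z_Xi_near[OF \<theta> wv, of t] unfolding q q_def .
  have pos: "0 < q t True + q t False" for t unfolding q[symmetric] by (rule pr_pos[OF \<theta>])
  have q0: "0 \<le> q t s" for t s unfolding q_def by (rule joint_nonneg[OF \<theta>])
  have "?z w t * (q t True + q t False) \<le> M * (q t True + q t False)" for t
    unfolding zq unfolding distrib_left by (intro add_mono mult_right_mono q0) (auto simp: M_def)
  then have leM: "?z w t \<le> M" for t using pos by simp
  have "m * (q t True + q t False) \<le> ?z w t * (q t True + q t False)" for t
    unfolding zq unfolding distrib_left by (intro add_mono mult_right_mono q0) (auto simp: m_def)
  then have lem: "m \<le> ?z w t" for t using pos by simp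
  have Mm: "M = srt (Xi \<theta>) $ (v, True) - lam v" "m = srt (Xi \<theta>) $ (v, False) - lam v"
    unfolding M_def m_def z_def srt_nth by auto
  show ?A using leM[of True] leM[of False] unfolding Mm z_def lam srt_nth by auto
  show ?B using lem[of True] lem[of False] unfolding Mm z_def lam srt_nth by auto
  assume str: "\<And>t s. 0 < ex \<theta> (\<lambda>\<alpha>. ind w t \<alpha> * ind v s \<alpha>)"
  have q1: "0 < q t s" for t s unfolding q_def by (rule str)
  have ne: "?z v True \<noteq> ?z v False" by (rule z_Xi_neq[OF \<theta>])
  have "?z w t * (q t True + q t False) < M * (q t True + q t False) \<and>
     m * (q t True + q t False) < ?z w t * (q t True + q t False)" for t
  proof (cases "?z v True < ?z v False")
    case True
    then show ?thesis unfolding zq unfolding distrib_left M_def m_def using q1[of t True] q1[of t False] by simp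
  next
    case False
    then have "?z v False < ?z v True" using ne by simp
    then show ?thesis unfolding zq unfolding distrib_left M_def m_def using q1[of t True] q1[of t False] by simp
  qed
  then have "?z w t < M \<and> m < ?z w t" for t using pos by simp
  from this[of True] this[of False]
  show "srt (Xi \<theta>) $ (w, True) < srt (Xi \<theta>) $ (v, True) \<and>
      srt (Xi \<theta>) $ (v, False) < srt (Xi \<theta>) $ (w, False)"
    unfolding Mm z_def lam srt_nth by auto
qed

lemma joint_pos:
  assumes \<theta>: "\<theta> \<in> fib" and wv: "near w v" "v \<in> deg2 \<or> w \<in> deg2"
    and str: "\<forall>(u, v)\<in>F. node_degree F u = 2 \<or> node_degree F v = 2 \<longrightarrow>
        (\<forall>i. 0 < \<theta> $ (v, i) \<and> \<theta> $ (v, i) < 1)"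
  shows "0 < ex \<theta> (\<lambda>\<alpha>. ind w t \<alpha> * ind v s \<alpha>)"
proof -
  have *: "0 < ex \<theta> (\<lambda>\<alpha>. ind a i \<alpha> * ind b j \<alpha>)" if ab: "(a, b) \<in> F" "a \<in> deg2 \<or> b \<in> deg2" for a b i j
  proof -
    have E: "(a, b) \<in> E" using ab F_E by blast
    have th: "0 < \<theta> $ (b, i)" "\<theta> $ (b, i) < 1" using str ab unfolding deg2_def by blast+
    have T: "ex \<theta> (\<lambda>\<alpha>. ind a i \<alpha> * ind b True \<alpha>) = pr \<theta> a i * \<theta> $ (b, i)" by (rule pr_edge[OF E])
    have "ex \<theta> (\<lambda>\<alpha>. ind a i \<alpha> * ind b False \<alpha>) = pr \<theta> a i * (1 - \<theta> $ (b, i))"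
      using ex_split[of \<theta> "ind a i" b] T by (simp add: algebra_simps)
    then show ?thesis using T th pr_pos[OF \<theta>, of a i] by (cases j) simp_all
  qed
  have "(w, v) \<in> F \<or> (v, w) \<in> F" using near_fadj[OF wv(1)] unfolding fadj_def by blast
  then show ?thesis using *[of w v t s] *[of v w s t] wv(2) by (auto simp: mult.commute)
qed

end

section \<open>The chain polytope attached to a point of the fiber\<close>

locale based_fiber = tree_fiber E r leaf p
  for E :: "('v::finite \<times> 'v) set" and r :: 'v and leaf :: "'n::finite \<Rightarrow> 'v" and p :: "('n \<Rightarrow> bool) pmf" +
  fixes \<theta>0 :: "'v param"
  assumes base: "\<theta>0 \<in> fiber E r leaf p"
begin

abbreviation "x0 \<equiv> Xi \<theta>0"
abbreviation "y0 \<equiv> srt x0"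

definition "J = deg2 \<times> (UNIV :: bool set)"
text \<open>Towards the representative leaf the intervals widen: upper ends increase and lower ends
  decrease. Therefore \<open>nn\<close> and \<open>fn\<close> exchange roles between the two states,
  and \<open>rk\<close> is reversed for \<open>False\<close>.\<close>

definition "up j = (if snd j then (nn (fst j), True) else (fn (fst j), False))"
definition "dn j = (if snd j then (fn (fst j), True) else (nn (fst j), False))"
definition "rk j = (if snd j then height (fst j) else CARD('v) - height (fst j))"
text \<open>The states of a leaf are observed, so only the labels of inner nodes may be
  chosen.\<close>

definition "Sg = {\<sigma>. \<forall>v\<in>range leaf. \<sigma> v = sgn x0 v}"

sublocale chain J dn up y0 rk
proof
  fix j assume j: "j \<in> J"
  then obtain v b where vb: "j = (v, b)" "v \<in> deg2" unfolding J_def by auto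
  note n = deg2_nbrs[OF vb(2)]
  show "dn j \<in> J \<Longrightarrow> up (dn j) = j" using vb nn_eq[OF n(2)] fn_eq[OF _ n(1)]
    unfolding J_def up_def dn_def by auto
  show "up j \<in> J \<Longrightarrow> dn (up j) = j" using vb nn_eq[OF n(2)] fn_eq[OF _ n(1)]
    unfolding J_def up_def dn_def by auto
  \<comment> \<open>Truncated subtraction reverses the order strictly only below this bound.\<close>
  have "height u \<le> CARD('v)" for u unfolding height_def by (auto intro: card_mono)
  then have "CARD('v) - height (nn v) < CARD('v) - height v"
    using height_near[OF n(1)] by (meson diff_less_mono2 less_le_trans)
  then show "rk (dn j) < rk j" using height_near[OF n(2)] vb unfolding rk_def dn_def by auto
qed

lemma Q_far:
  assumes "y \<in> Q" "v \<in> deg2"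
  shows "y $ (fn v, True) \<le> y $ (v, True)" "y $ (v, True) \<le> y $ (nn v, True)"
    "y $ (nn v, False) \<le> y $ (v, False)" "y $ (v, False) \<le> y $ (fn v, False)"
proof -
  have "\<forall>j\<in>J. y $ dn j \<le> y $ j \<and> y $ j \<le> y $ up j" using assms(1) unfolding chain_polytope_def by blast
  then have "y $ dn (v, b) \<le> y $ (v, b) \<and> y $ (v, b) \<le> y $ up (v, b)" for b
    using assms(2) unfolding J_def by blast
  from this[of True] this[of False]
  show "y $ (fn v, True) \<le> y $ (v, True)" "y $ (v, True) \<le> y $ (nn v, True)"
    "y $ (nn v, False) \<le> y $ (v, False)" "y $ (v, False) \<le> y $ (fn v, False)"
    unfolding dn_def up_def by simp_all
qed

lemma Q_fixed: "y \<in> Q \<Longrightarrow> v \<notin> deg2 \<Longrightarrow> y $ (v, b) = y0 $ (v, b)"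
  unfolding chain_polytope_def J_def by blast

text \<open>An edge with a degree-two end is among the constraints of \<open>Q\<close>. At any other
  forest edge both ends carry the values of the base point, where nesting is known.\<close>

lemma Q_near:
  assumes y: "y \<in> Q" and wv: "near w v"
  shows "y $ (w, True) \<le> y $ (v, True)" "y $ (v, False) \<le> y $ (w, False)"
proof -
  consider "w \<in> deg2" | "v \<in> deg2" | "w \<notin> deg2" "v \<notin> deg2" by blast
  then have "y $ (w, True) \<le> y $ (v, True) \<and> y $ (v, False) \<le> y $ (w, False)"
  proof cases
    case 1
    then show ?thesis using Q_far[OF y 1] nn_eq[OF wv] by simp
  next
    case 2
    then show ?thesis using Q_far[OF y 2] fn_eq[OF 2 wv] by simp
  next
    case 3
    then show ?thesis using Q_fixed[OF y] Xi_hull(1,2)[OF base wv] by simp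
  qed
  then show "y $ (w, True) \<le> y $ (v, True)" "y $ (v, False) \<le> y $ (w, False)" by auto
qed

text \<open>The interval at a degree-two node contains that of its farther neighbour. Going outwards
  along the chain ends at a fixed node, whose interval contains the mean in its interior because the
  centred values have opposite signs.\<close>

lemma Q_lam:
  assumes y: "y \<in> Q"
  shows "y $ (v, False) < lam v \<and> lam v < y $ (v, True)"
proof (induction v rule: measure_induct_rule[of height])
  case (less v)
  show ?case
  proof (cases "v \<in> deg2")
    case True
    note n = deg2_nbrs(2)[OF True]
    have "lam (fn v) = lam v" using rep_fadj[OF near_fadj[OF n]] unfolding lam_def by simp
    then show ?thesis using less[OF height_near[OF n]] Q_far[OF y True] by simp
  next
    case False
    have "z x0 v True * z x0 v False < 0" by (rule z_Xi_sign[OF base])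
    then show ?thesis unfolding Q_fixed[OF y False] srt_nth z_def by (auto simp: mult_less_0_iff)
  qed
qed

lemma relabel_sgn:
  assumes "y \<in> Q"
  shows "sgn (relabel \<sigma> y) = \<sigma>"
proof
  fix v
  have "y $ (v, False) < y $ (v, True)" using Q_lam[OF assms, of v] by simp
  then show "sgn (relabel \<sigma> y) v = \<sigma> v" unfolding sgn_def relabel_nth by (cases "\<sigma> v") auto
qed

lemma relabel_admissible:
  assumes "y \<in> Q"
  shows "admissible (relabel \<sigma> y)"
  unfolding admissible_def
proof
  fix v
  show "z (relabel \<sigma> y) v True * z (relabel \<sigma> y) v False < 0"
    using Q_lam[OF assms, of v] unfolding z_def relabel_nth
    by (cases "\<sigma> v") (auto simp: mult_less_0_iff)
qed

lemma Xi_image: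
  assumes \<theta>: "\<theta> \<in> fib"
  shows "srt (Xi \<theta>) \<in> Q" "sgn (Xi \<theta>) \<in> Sg"
proof -
  have 1: "srt (Xi \<theta>) $ (v, b) = y0 $ (v, b)" if "v \<notin> deg2" for v b
  proof (cases "v \<in> range leaf")
    case True
    then have "Xi \<theta> $ (v, s) = x0 $ (v, s)" for s using Xi_leaf[OF \<theta> base] by auto
    then show ?thesis unfolding srt_def by simp
  next
    case False
    from Xi_branch[OF \<theta> base False that] show ?thesis unfolding srt_def
      by (auto simp: max.commute min.commute)
  qed
  have 2: "srt (Xi \<theta>) $ dn j \<le> srt (Xi \<theta>) $ j \<and> srt (Xi \<theta>) $ j \<le> srt (Xi \<theta>) $ up j" if "j \<in> J" for j
  proof -
    obtain v b where vb: "j = (v, b)" "v \<in> deg2" using \<open>j \<in> J\<close> unfolding J_def by auto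
    note n = deg2_nbrs[OF vb(2)]
    show ?thesis using Xi_hull(1,2)[OF \<theta> n(1)] Xi_hull(1,2)[OF \<theta> n(2)]
      unfolding vb(1) dn_def up_def by (cases b) auto
  qed
  show "srt (Xi \<theta>) \<in> Q" unfolding chain_polytope_def
  proof (intro CollectI conjI allI impI ballI)
    fix i assume "i \<notin> J"
    then show "srt (Xi \<theta>) $ i = y0 $ i" using 1[of "fst i" "snd i"] unfolding J_def
      by (metis SigmaI UNIV_I prod.collapse)
  qed (use 2 in auto)
  show "sgn (Xi \<theta>) \<in> Sg" unfolding Sg_def sgn_def using Xi_leaf[OF \<theta> base] by auto
qed

lemma relabel_leaf:
  assumes "y \<in> Q" "\<sigma> \<in> Sg" "v \<in> range leaf"
  shows "relabel \<sigma> y $ (v, s) = x0 $ (v, s)"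
proof -
  have "v \<notin> deg2" using deg2_inner assms(3) by blast
  then have "relabel \<sigma> y $ (v, s) = relabel (sgn x0) y0 $ (v, s)"
    using Q_fixed[OF assms(1)] assms(2,3) unfolding relabel_nth Sg_def by auto
  then show ?thesis unfolding relabel_srt .
qed

text \<open>The claim is that a centred value at the farther node divided by one at the nearer node
  is at most 1. The divisor is positive at the upper end and negative at the lower end of the nearer
  interval, so the two cases are exactly the two inclusions of nested intervals.\<close>

lemma kern_nonneg:
  assumes y: "y \<in> Q" and ab: "fadj a b"
  shows "0 \<le> kern (relabel \<sigma> y) a s b t"
proof -
  have *: "z (relabel \<sigma> y) w t / z (relabel \<sigma> y) v s \<le> 1" if wv: "near w v" for w v s t
  proof -
    have lam: "lam w = lam v" using rep_fadj near_fadj[OF wv] unfolding lam_def by simp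
    have w: "y $ (v, False) \<le> relabel \<sigma> y $ (w, t)" "relabel \<sigma> y $ (w, t) \<le> y $ (v, True)"
      using Q_near[OF y wv] Q_lam[OF y, of w] unfolding relabel_nth
      by (cases "t = \<sigma> w"; simp)+
    show ?thesis
    proof (cases "s = \<sigma> v")
      case True
      then have "z (relabel \<sigma> y) v s = y $ (v, True) - lam v" unfolding z_def relabel_nth by simp
      then show ?thesis using w Q_lam[OF y, of v] by (simp add: z_def lam divide_le_eq_1)
    next
      case False
      then have "z (relabel \<sigma> y) v s = y $ (v, False) - lam v" unfolding z_def relabel_nth by simp
      then show ?thesis using w Q_lam[OF y, of v] by (simp add: z_def lam divide_le_eq_1)
    qed
  qed
  show ?thesis
  proof (cases "near b a")
    case True
    then show ?thesis using *[OF True] unfolding kern_def by simp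
  next
    case False
    then have "near a b" using near_iff ab by blast
    then show ?thesis using *[of a b] False unfolding kern_def by simp
  qed
qed

lemma Psi_Theta:
  assumes y: "y \<in> Q"
  shows "Psi (relabel \<sigma> y) \<in> Theta r"
proof -
  let ?x = "relabel \<sigma> y"
  note adm = relabel_admissible[OF y, of \<sigma>]
  have m: "0 \<le> marg ?x v s" "marg ?x v True \<le> 1" for v s
    using marg_pos[OF adm, of v s] marg_sum[OF adm, of v] marg_pos[OF adm, of v False] by linarith+
  have "0 \<le> marg ?x v True * kern ?x u i v True \<and> marg ?x v True * kern ?x u i v True \<le> 1"
    if "(u, v) \<in> F" for u v i
  proof -
    have "fadj u v" using that unfolding fadj_def by blast
    note k = kern_nonneg[OF y this] kern_norm[OF adm this, of i]
    have "0 \<le> marg ?x v t * kern ?x u i v t" for t using m k(1) by simp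
    from this[of True] this[of False] show ?thesis using k(2) by simp
  qed
  then show ?thesis unfolding Theta_def Psi_def using m by auto
qed

text \<open>Away from degree-two nodes the vector agrees with the base point up to exchanging
  states, and exactly so at leaves. Such changes preserve the law of the leaves, and
  \<open>Psi_inj\<close> identifies the coordinates of the resulting parameter.\<close>

lemma Psi_image:
  assumes y: "y \<in> Q" and \<sigma>: "\<sigma> \<in> Sg"
  shows "Psi (relabel \<sigma> y) \<in> fib" "Xi (Psi (relabel \<sigma> y)) = relabel \<sigma> y"
proof -
  let ?x = "relabel \<sigma> y"
  note adm = relabel_admissible[OF y, of \<sigma>]
  have br: "(\<forall>s. ?x $ (v, s) = x0 $ (v, s)) \<or> (\<forall>s. ?x $ (v, s) = x0 $ (v, \<not> s))" if "v \<notin> deg2" for v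
  proof -
    have x0: "x0 $ (v, s) = y0 $ (v, s = sgn x0 v)" for s
      using relabel_srt[of x0] relabel_nth[of "sgn x0" y0 v s] by simp
    have x: "?x $ (v, s) = y0 $ (v, s = \<sigma> v)" for s
      unfolding relabel_nth using Q_fixed[OF y that] by simp
    show ?thesis unfolding x x0 by (cases "\<sigma> v = sgn x0 v") (auto intro!: arg_cong[of _ _ "($) y0"])
  qed
  have "f_T E r leaf (Psi ?x) \<beta> = pmf p \<beta>" for \<beta>
  proof -
    have "f_T E r leaf (Psi ?x) \<beta> = leaf_sum x0 \<beta>"
      unfolding f_T_Psi[OF adm]
      by (rule leaf_sum_eq[OF adm admissible_Xi[OF base]]) (use relabel_leaf[OF y \<sigma>] br in auto)
    also have "\<dots> = f_T E r leaf \<theta>0 \<beta>"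
      using f_T_Psi[OF admissible_Xi[OF base]] Psi_Xi[OF base] by simp
    finally show ?thesis using base unfolding fiber_def by simp
  qed
  then show f: "Psi ?x \<in> fib" unfolding fiber_def using Psi_Theta[OF y] by auto
  show "Xi (Psi ?x) = ?x"
  proof (rule Psi_inj[OF admissible_Xi[OF f] adm Psi_Xi[OF f]])
    fix v s assume "v \<in> range leaf"
    then show "Xi (Psi ?x) $ (v, s) = ?x $ (v, s)"
      using Xi_leaf[OF f base] relabel_leaf[OF y \<sigma>] by auto
  qed
qed

section \<open>The fiber as a disjoint union of relabelled copies of the polytope\<close>

definition "pieces = (\<lambda>\<sigma>. relabel \<sigma> ` Q) ` Sg"

lemma Xi_fib: "Xi ` fib = \<Union>pieces"
proof (intro equalityI subsetI)
  fix x assume "x \<in> Xi ` fib"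
  then obtain \<theta> where \<theta>: "\<theta> \<in> fib" "x = Xi \<theta>" by blast
  then have "x = relabel (sgn x) (srt x)" "srt x \<in> Q" "sgn x \<in> Sg" using Xi_image relabel_srt by auto
  then show "x \<in> \<Union>pieces" unfolding pieces_def by blast
next
  fix x assume "x \<in> \<Union>pieces"
  then obtain \<sigma> y where "\<sigma> \<in> Sg" "y \<in> Q" "x = relabel \<sigma> y" unfolding pieces_def by blast
  then show "x \<in> Xi ` fib" using Psi_image by (metis imageI)
qed

lemma diffeomorphic_fib: "diffeomorphic fib (\<Union>pieces)"
proof (rule diffeomorphicI[of _ Xi _ Psi])
  show "smooth_map_on fib Xi" by (rule smooth_Xi)
  show "smooth_map_on (\<Union>pieces) Psi"
    by (rule smooth_map_onI[OF open_admissible _ smooth_Psi])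
      (use relabel_admissible in \<open>auto simp: pieces_def\<close>)
  show "Psi y \<in> fib" "Xi (Psi y) = y" if "y \<in> \<Union>pieces" for y
    using that Psi_image unfolding pieces_def by auto
qed (use Xi_fib Psi_Xi in auto)

lemma Q_nonempty: "y0 \<in> Q"
  using Xi_image(1)[OF base] .

lemma disjoint_pieces: "disjoint pieces"
proof -
  have "\<sigma> = \<sigma>'" if "y \<in> Q" "y' \<in> Q" "relabel \<sigma> y = relabel \<sigma>' y'" for \<sigma> \<sigma>' y y'
    using that relabel_sgn by metis
  then show ?thesis unfolding disjoint_def pieces_def by blast
qed

lemma card_J: "card J = 2 * card deg2"
  unfolding J_def by (simp add: card_cartesian_product)

theorem fiber_polyhedra:
  obtains d where "disjoint_polyhedra d pieces" "manifold_with_corners d fib"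
    "d \<le> 2 * card deg2" "nondegenerate_at_degree_two E r leaf p \<Longrightarrow> d = 2 * card deg2"
proof -
  obtain d where d: "aff_dim Q = int d" "manifold_with_corners d Q" "d \<le> card J"
    "\<And>x. x \<in> Q \<Longrightarrow> \<forall>j\<in>J. x $ dn j < x $ j \<Longrightarrow> d = card J"
    using chain_polytope_manifold Q_nonempty by blast
  have inj: "inj (relabel \<sigma>)" for \<sigma> by (rule inj_on_inverseI[of _ "relabel \<sigma>"]) (rule relabel_relabel)
  have bij: "bij (relabel \<sigma>)" for \<sigma> using inj relabel_relabel by (metis bijI surjI)
  have poly: "polyhedron P" "aff_dim P = int d" "manifold_with_corners d P" if PP: "P \<in> pieces" for P
  proof -
    obtain \<sigma> where P: "P = relabel \<sigma> ` Q" using PP unfolding pieces_def by blast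
    show "polyhedron P" unfolding P
      using polyhedron_linear_image_eq[OF linear_relabel bij] polyhedron_chain_polytope by blast
    show "aff_dim P = int d" unfolding P
      using aff_dim_injective_linear_image[OF linear_relabel inj] d(1) by simp
    show "manifold_with_corners d P" unfolding P
      using manifold_with_corners_diffeomorphic[OF diffeomorphic_sym d(2)]
        diffeomorphic_linear_image[OF linear_relabel linear_relabel relabel_relabel] by blast
  qed
  have fin: "finite pieces" unfolding pieces_def by simp
  show ?thesis
  proof (rule that)
    show "disjoint_polyhedra d pieces"
      unfolding disjoint_polyhedra_def using fin disjoint_pieces poly by blast
    show "manifold_with_corners d fib"
      by (rule manifold_with_corners_diffeomorphic[OF diffeomorphic_fib manifold_with_corners_Union])
        (use fin disjoint_pieces poly polyhedron_imp_closed in auto)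
    show "d \<le> 2 * card deg2" using d(3) card_J by simp
    assume "nondegenerate_at_degree_two E r leaf p"
    then obtain \<theta> where \<theta>: "\<theta> \<in> fib" and str: "\<forall>(u, v)\<in>F. node_degree F u = 2 \<or> node_degree F v = 2 \<longrightarrow>
        (\<forall>i. 0 < \<theta> $ (v, i) \<and> \<theta> $ (v, i) < 1)" unfolding nondegenerate_at_degree_two_def by blast
    \<comment> \<open>Strictness of the lower inequalities alone forces full dimension, because at a
      maximal point lower and upper inequalities are strict at the same indices.\<close>
    have "srt (Xi \<theta>) $ dn j < srt (Xi \<theta>) $ j" if "j \<in> J" for j
    proof -
      obtain v b where vb: "j = (v, b)" "v \<in> deg2" using \<open>j \<in> J\<close> unfolding J_def by auto
      note n = deg2_nbrs[OF vb(2)]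
      have "srt (Xi \<theta>) $ (fn v, True) < srt (Xi \<theta>) $ (v, True)"
        using Xi_hull(3)[OF \<theta> n(2)] joint_pos[OF \<theta> n(2) _ str] vb(2) by blast
      moreover have "srt (Xi \<theta>) $ (nn v, False) < srt (Xi \<theta>) $ (v, False)"
        using Xi_hull(3)[OF \<theta> n(1)] joint_pos[OF \<theta> n(1) _ str] vb(2) by blast
      ultimately show ?thesis unfolding vb(1) dn_def by (cases b) auto
    qed
    then show "d = 2 * card deg2" using d(4)[OF Xi_image(1)[OF \<theta>]] card_J by simp
  qed
qed

text \<open>Without degree-two nodes the polytope is a single point, so the points of the fiber
  correspond to the labellings in \<open>Sg\<close>, which \<open>sgn\<close> recovers.\<close>

theorem fiber_finite:
  assumes "deg2 = {}"
  shows "finite fib" "card fib = 2 ^ (CARD('v) - CARD('n))"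
proof -
  have "Q = {y0}" using Q_nonempty assms unfolding chain_polytope_def J_def by (auto simp: vec_eq_iff)
  then have img: "Xi ` fib = (\<lambda>\<sigma>. relabel \<sigma> y0) ` Sg" unfolding Xi_fib pieces_def by auto
  have inj: "inj_on Xi fib" by (rule inj_on_inverseI[of _ Psi]) (rule Psi_Xi)
  have "finite (Xi ` fib)" unfolding img by simp
  then show "finite fib" using inj by (rule finite_imageD)
  have "card fib = card (Xi ` fib)" using inj by (simp add: card_image)
  also have "\<dots> = card Sg" unfolding img
    by (rule card_image) (rule inj_on_inverseI[of _ sgn], rule relabel_sgn[OF Q_nonempty])
  also have "\<dots> = 2 ^ (CARD('v) - CARD('n))"
    unfolding Sg_def card_fixed_on card_image[OF inj_leaf] ..
  finally show "card fib = 2 ^ (CARD('v) - CARD('n))" .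
qed

end

theorem theorem5p4:
  fixes E :: "('v::finite \<times> 'v) set" and r :: 'v
    and leaf :: "'n::finite \<Rightarrow> 'v" and p :: "('n \<Rightarrow> bool) pmf"
  assumes "rooted_tree E r"
    and "leaf_labelling E leaf"
    and "p \<in> tree_model E r leaf"
    and "\<forall>i. leaf_mean p i * (1 - leaf_mean p i) \<noteq> 0"
  shows
    "((\<forall>v. v \<notin> range leaf \<longrightarrow> 3 \<le> node_degree (forest_edges E leaf p) v) \<longrightarrow>
        finite (fiber E r leaf p) \<and> card (fiber E r leaf p) = 2 ^ (CARD('v) - CARD('n)))
     \<and>
     ((\<forall>v. v \<notin> range leaf \<longrightarrow> 2 \<le> node_degree (forest_edges E leaf p) v) \<longrightarrow>
        (\<exists>(\<P> :: 'v param set set) d.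
           disjoint_polyhedra d \<P> \<and> diffeomorphic (fiber E r leaf p) (\<Union>\<P>) \<and>
           manifold_with_corners d (fiber E r leaf p) \<and>
           d \<le> 2 * card {v. node_degree (forest_edges E leaf p) v = 2} \<and>
           (nondegenerate_at_degree_two E r leaf p \<longrightarrow>
              d = 2 * card {v. node_degree (forest_edges E leaf p) v = 2})))"
proof -
  obtain \<theta>0 where \<theta>0: "\<theta>0 \<in> fiber E r leaf p"
    using assms(3) unfolding tree_model_def fiber_def by auto
  have leaf: "inj leaf" "node_degree E (leaf i) = 1" for i
    using assms(2) unfolding leaf_labelling_def bij_betw_def by auto
  have FE: "forest_edges E leaf p \<subseteq> E" unfolding forest_edges_def by blast
  \<comment> \<open>Only an inequality: the single edge at a leaf may be isolated, leaving degree 0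
    in the forest.\<close>
  have deg: "node_degree (forest_edges E leaf p) (leaf i) \<le> 1" for i
  proof -
    have "node_degree (forest_edges E leaf p) (leaf i) \<le> node_degree E (leaf i)"
      unfolding node_degree_def by (intro card_mono finite) (use FE in auto)
    then show ?thesis using leaf(2) by simp
  qed
  have based: "based_fiber E r leaf p \<theta>0"
    if "\<forall>v. v \<notin> range leaf \<longrightarrow> 2 \<le> node_degree (forest_edges E leaf p) v"
    by unfold_locales (use assms leaf FE deg \<theta>0 that in auto)
  show ?thesis
  proof (intro conjI impI)
    assume 3: "\<forall>v. v \<notin> range leaf \<longrightarrow> 3 \<le> node_degree (forest_edges E leaf p) v"
    then interpret based_fiber E r leaf p \<theta>0 by (intro based) force
    have "deg2 = {}"
      using 3 deg2_inner unfolding deg2_def by force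
    from fiber_finite[OF this] show "finite (fiber E r leaf p)"
      "card (fiber E r leaf p) = 2 ^ (CARD('v) - CARD('n))" .
  next
    assume "\<forall>v. v \<notin> range leaf \<longrightarrow> 2 \<le> node_degree (forest_edges E leaf p) v"
    then interpret based_fiber E r leaf p \<theta>0 by (rule based)
    obtain d where "disjoint_polyhedra d pieces" "manifold_with_corners d (fiber E r leaf p)"
      "d \<le> 2 * card deg2" "nondegenerate_at_degree_two E r leaf p \<Longrightarrow> d = 2 * card deg2"
      using fiber_polyhedra by blast
    then show "\<exists>(\<P> :: 'v param set set) d.
           disjoint_polyhedra d \<P> \<and> diffeomorphic (fiber E r leaf p) (\<Union>\<P>) \<and>
           manifold_with_corners d (fiber E r leaf p) \<and>
           d \<le> 2 * card {v. node_degree (forest_edges E leaf p) v = 2} \<and>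
           (nondegenerate_at_degree_two E r leaf p \<longrightarrow>
              d = 2 * card {v. node_degree (forest_edges E leaf p) v = 2})"
      using diffeomorphic_fib unfolding deg2_def by (intro exI[of _ pieces] exI[of _ d]) simp
  qed
qed

end
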